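(* Let $d\ge 1$ and let $V(z,\omega)$, $z\in\mathbb{Z}^d$, be i.i.d. random variables on $(\Omega,\mathcal{F},\mathbb{P})$ such that $V(0,\omega)\in[0,\infty]$ a.s., $\mathbb{P}(V(0,\omega)=0)<1$, and $\operatorname{ess\,inf}_{\omega\in\Omega}V(0,\omega)=0$. If $d=1$, assume in addition that $\mathbb{P}(V(0,\omega)\in(0,\infty))>0$. Then there is a constant $C\in(0,\infty)$ such that $\limsup_{\|y\|\to\infty}E_{Q^0_y}(\tau_y)/\|y\|\le C$ and such that for every unit vector $s\in\mathbb{R}^d$ $$\frac{d\beta_{\lambda+V}(s)}{d\lambda}\Big|_{\lambda=0+}\le C.$$
   Context: $\mathbb{E}$ is expectation with respect to $\mathbb{P}$. $P^x$ is the law of the simple symmetric nearest-neighbor random walk $(S_n)_{n\ge0}$ on $\mathbb{Z}^d$ started at $x$ (independent of the environment), with expectation $E^x$; $\tau_y=\inf\{n\ge0:S_n=y\}$; $e^{-\infty}=0$. For $y\neq0$ the annealed path measure is $Q^0_y(A)=(Z^0_y)^{-1}\mathbb{E}E^0(\mathbf{1}_{\{\tau_y<\infty\}}\mathbf{1}_A e^{-\sum_{n=0}^{\tau_y-1}V(S_n,\omega)})$ with $Z^0_y=\mathbb{E}E^0(\mathbf{1}_{\{\tau_y<\infty\}}e^{-\sum_{n=0}^{\tau_y-1}V(S_n,\omega)})$, and $E_{Q^0_y}$ is its expectation. The annealed Lyapunov exponent of a potential $V$ is the norm on $\mathbb{R}^d$ given by $\beta_V(h)=-\lim_{r\to\infty}\frac1r\log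 Z^0_{[rh]}$, $h\in\mathbb{R}^d$ ($[\cdot]$ is the componentwise integer part; the limit is known to exist), and $\beta_{\lambda+V}$ is the same quantity for the potential $\lambda+V(z,\omega)$, $\lambda\ge0$. It is known that $\lambda\mapsto\beta_{\lambda+V}(h)$ is concave on $[0,\infty)$, so that its right derivative at $0$ exists. $\|\cdot\|$ is a fixed norm on $\mathbb{R}^d$ (e.g. Euclidean), and a unit vector is one with $\|s\|=1$. *)

theory Defs
  imports "HOL-Probability.Probability"
begin

section \<open>Simple random walk on the integer lattice\<close>

type_synonym 'd path = "nat \<Rightarrow> int ^ 'd"

definition path_space :: "('d::finite) path measure" where
  "path_space = PiM UNIV (\<lambda>_::nat. count_space UNIV)"

definition step_pmf :: "(int ^ 'd::finite) pmf" where
  "step_pmf = pmf_of_set {e. \<exists>i. e = axis i 1 \<or> e = axis i (-1)}"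

text \<open>The law \<open>P\<^sup>x\<close> of the walk started at \<open>x\<close>.\<close>

definition walk_law :: "int ^ 'd::finite \<Rightarrow> 'd path measure" where
  "walk_law x = distr (PiM UNIV (\<lambda>_::nat. measure_pmf step_pmf)) path_space
                  (\<lambda>\<xi> n. x + (\<Sum>k<n. \<xi> k))"

text \<open>\<open>Inf {} = \<infinity>\<close> in type \<^typ>\<open>enat\<close>, so the hitting time is infinite if \<open>y\<close> is never visited.\<close>

definition hit_time :: "int ^ 'd::finite \<Rightarrow> 'd path \<Rightarrow> enat" where
  "hit_time y S = (INF n\<in>{n. S n = y}. enat n)"


section \<open>Potentials and annealed path measures\<close>

text \<open>The function \<open>x \<mapsto> e\<^sup>-\<^sup>x\<close> on the extended reals, with \<open>e\<^sup>-\<^sup>\<infinity> = 0\<close>.  Potentials are only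
  almost surely nonnegative, so the value at \<open>-\<infinity>\<close> matters on a null set only.\<close>

definition exp_minus :: "ereal \<Rightarrow> ennreal" where
  "exp_minus x = (case x of ereal r \<Rightarrow> ennreal (exp (- r)) | PInfty \<Rightarrow> 0 | MInfty \<Rightarrow> top)"

definition path_weight ::
    "(int ^ 'd::finite \<Rightarrow> 'w \<Rightarrow> ereal) \<Rightarrow> int ^ 'd \<Rightarrow> 'w \<Rightarrow> 'd path \<Rightarrow> ennreal" where
  "path_weight V y \<omega> S =
     (if hit_time y S < \<infinity> then exp_minus (\<Sum>n<the_enat (hit_time y S). V (S n) \<omega>) else 0)"

definition Z_ann :: "'w measure \<Rightarrow> (int ^ 'd::finite \<Rightarrow> 'w \<Rightarrow> ereal) \<Rightarrow> int ^ 'd \<Rightarrow> ennreal" where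
  "Z_ann M V y = (\<integral>\<^sup>+\<omega>. (\<integral>\<^sup>+S. path_weight V y \<omega> S \<partial>walk_law 0) \<partial>M)"

text \<open>The annealed path measure: the marginal on path space of the joint law of environment and
  walk reweighted by \<^const>\<open>path_weight\<close>.  Lemma \<open>emeasure_Q_ann\<close> below gives the usual formula
  for the probability of a path event.\<close>

definition Q_ann :: "'w measure \<Rightarrow> (int ^ 'd::finite \<Rightarrow> 'w \<Rightarrow> ereal) \<Rightarrow> int ^ 'd \<Rightarrow> 'd path measure" where
  "Q_ann M V y =
     distr (density (M \<Otimes>\<^sub>M walk_law 0) (\<lambda>(\<omega>, S). path_weight V y \<omega> S / Z_ann M V y)) path_space snd"


section \<open>Annealed Lyapunov exponents\<close>

definition lattice_floor :: "real ^ 'd::finite \<Rightarrow> int ^ 'd" where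
  "lattice_floor h = (\<chi> i. \<lfloor>h $ i\<rfloor>)"

definition lyapunov_ann :: "'w measure \<Rightarrow> (int ^ 'd::finite \<Rightarrow> 'w \<Rightarrow> ereal) \<Rightarrow> real ^ 'd \<Rightarrow> real" where
  "lyapunov_ann M V h =
     - Lim at_top (\<lambda>r::real. 1 / r * ln (enn2real (Z_ann M V (lattice_floor (r *\<^sub>R h)))))"


section \<open>Further notions\<close>

definition essinf :: "'w measure \<Rightarrow> ('w \<Rightarrow> ereal) \<Rightarrow> ereal" where
  "essinf M f = - esssup M (\<lambda>\<omega>. - f \<omega>)"

definition is_norm :: "(real ^ 'd::finite \<Rightarrow> real) \<Rightarrow> bool" where
  "is_norm N \<longleftrightarrow> (\<forall>x. N x = 0 \<longleftrightarrow> x = 0) \<and> (\<forall>a x. N (a *\<^sub>R x) = \<bar>a\<bar> * N x)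
                 \<and> (\<forall>x y. N (x + y) \<le> N x + N y)"

definition real_vec :: "int ^ 'd::finite \<Rightarrow> real ^ 'd" where
  "real_vec y = (\<chi> i. of_int (y $ i))"


section \<open>Measurability and consistency of the definitions\<close>

lemma space_walk_law [simp]: "space (walk_law x) = UNIV"
  by (simp add: walk_law_def path_space_def space_PiM)

lemma sets_walk_law [measurable_cong, simp]: "sets (walk_law x) = sets path_space"
  by (simp add: walk_law_def)

lemma measurable_path_nth [measurable]: "(\<lambda>S. S n) \<in> path_space \<rightarrow>\<^sub>M count_space UNIV"
  unfolding path_space_def by (rule measurable_component_singleton) simp

lemma prob_space_walk_law: "prob_space (walk_law x)"
proof -
  interpret P: product_prob_space "\<lambda>_::nat. measure_pmf step_pmf" UNIV
    by unfold_locales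
  have "(\<lambda>\<xi> n. x + (\<Sum>k<n. \<xi> k)) \<in> PiM UNIV (\<lambda>_::nat. measure_pmf step_pmf) \<rightarrow>\<^sub>M path_space"
    unfolding path_space_def
  proof (rule measurable_PiM_single')
    fix n
    show "(\<lambda>\<xi>. x + (\<Sum>k<n. \<xi> k)) \<in> PiM UNIV (\<lambda>_::nat. measure_pmf step_pmf) \<rightarrow>\<^sub>M count_space UNIV"
    proof (induction n)
      case (Suc n)
      have c: "(\<lambda>\<xi>. \<xi> n) \<in> PiM UNIV (\<lambda>_::nat. measure_pmf step_pmf) \<rightarrow>\<^sub>M count_space UNIV"
        using measurable_component_singleton[of n UNIV "\<lambda>_::nat. measure_pmf step_pmf"]
        by (simp cong: measurable_cong_sets)
      have "(\<lambda>\<xi>. (x + (\<Sum>k<n. \<xi> k)) + \<xi> n)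
              \<in> PiM UNIV (\<lambda>_::nat. measure_pmf step_pmf) \<rightarrow>\<^sub>M count_space UNIV"
        by (rule measurable_compose_countable[OF measurable_compose[OF c] Suc]) simp
      then show ?case by (simp add: add.assoc)
    qed simp
  qed (auto simp: space_PiM)
  then show ?thesis
    unfolding walk_law_def by (rule P.prob_space_distr)
qed

lemma measurable_exp_minus [measurable]: "exp_minus \<in> borel_measurable borel"
proof -
  have "exp_minus = (\<lambda>x. if x = \<infinity> then 0 else if x = -\<infinity> then top
                          else ennreal (exp (- real_of_ereal x)))"
    by (rule ext) (auto simp: exp_minus_def split: ereal.split)
  then show ?thesis by (rule ssubst) measurable 
qed

lemma measurable_hit_time [measurable]: "hit_time (y :: int ^ 'd::finite) \<in> path_space \<rightarrow>\<^sub>M count_space UNIV"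
proof -
  have "hit_time y = (\<lambda>S. INF n. if S n = y then enat n else \<infinity>)"
  proof (rule ext, rule antisym)
    fix S :: "'d path"
    show "hit_time y S \<le> (INF n. if S n = y then enat n else \<infinity>)"
      unfolding hit_time_def
    proof (rule INF_greatest)
      fix n
      show "(INF n\<in>{n. S n = y}. enat n) \<le> (if S n = y then enat n else \<infinity>)"
        by (cases "S n = y") (auto intro: INF_lower)
    qed
    show "(INF n. if S n = y then enat n else \<infinity>) \<le> hit_time y S"
      unfolding hit_time_def
    proof (rule INF_greatest)
      fix n assume "n \<in> {n. S n = y}"
      then show "(INF n. if S n = y then enat n else \<infinity>) \<le> enat n"
        by (intro INF_lower2[of n]) auto
    qed
  qed
  then show ?thesis by (rule ssubst) measurable
qed

lemma measurable_path_weight: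
  fixes V :: "int ^ 'd::finite \<Rightarrow> 'w \<Rightarrow> ereal"
  assumes [measurable]: "\<And>z. V z \<in> borel_measurable M"
  shows "(\<lambda>(\<omega>, S). path_weight V y \<omega> S) \<in> borel_measurable (M \<Otimes>\<^sub>M path_space)"
proof -
  have [measurable]: "(\<lambda>p. V (snd p n) (fst p)) \<in> borel_measurable (M \<Otimes>\<^sub>M path_space)" for n
    by (rule measurable_compose_countable[where f = "\<lambda>z p. V z (fst p)" and g = "\<lambda>p. snd p n"])
       measurable
  have h [measurable]: "(\<lambda>p. hit_time y (snd p)) \<in> M \<Otimes>\<^sub>M path_space \<rightarrow>\<^sub>M count_space UNIV"
    by measurable
  have "(\<lambda>p. (\<lambda>t p. if t < \<infinity> then exp_minus (\<Sum>n<the_enat t. V (snd p n) (fst p)) else 0)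
               (hit_time y (snd p)) p) \<in> borel_measurable (M \<Otimes>\<^sub>M path_space)"
    by (rule measurable_compose_countable[OF _ h]) (simp; measurable)
  then show ?thesis by (simp add: path_weight_def split_beta')
qed

lemma emeasure_Q_ann:
  fixes V :: "int ^ 'd::finite \<Rightarrow> 'w \<Rightarrow> ereal"
  assumes V [measurable]: "\<And>z. V z \<in> borel_measurable M" and A [measurable]: "A \<in> sets path_space"
  shows "emeasure (Q_ann M V y) A =
           (\<integral>\<^sup>+\<omega>. (\<integral>\<^sup>+S. indicator A S * path_weight V y \<omega> S \<partial>walk_law 0) \<partial>M) / Z_ann M V y"
proof -
  interpret W: prob_space "walk_law (0 :: int ^ 'd)" by (rule prob_space_walk_law)
  let ?J = "M \<Otimes>\<^sub>M walk_law (0 :: int ^ 'd)"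
  have w [measurable]: "(\<lambda>p. path_weight V y (fst p) (snd p)) \<in> borel_measurable ?J"
    using measurable_path_weight[where V = V and y = y, OF V]
    by (simp add: split_beta' cong: measurable_cong_sets)
  have A' [measurable]: "A \<in> sets (walk_law 0)" using A by simp
  have s [measurable]: "snd \<in> ?J \<rightarrow>\<^sub>M path_space"
    using measurable_snd[of M "walk_law (0 :: int ^ 'd)"] by (simp cong: measurable_cong_sets)
  have B: "snd -` A \<inter> space ?J \<in> sets ?J" using s A by (rule measurable_sets)
  have "emeasure (Q_ann M V y) A =
      (\<integral>\<^sup>+p. path_weight V y (fst p) (snd p) / Z_ann M V y
              * indicator (snd -` A \<inter> space ?J) p \<partial>?J)"
    unfolding Q_ann_def using B
    by (subst emeasure_distr) (auto simp: emeasure_density split_beta')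
  also have "\<dots> = (\<integral>\<^sup>+p. (indicator A (snd p) * path_weight V y (fst p) (snd p)) / Z_ann M V y \<partial>?J)"
    by (rule nn_integral_cong)
       (auto simp: indicator_def space_pair_measure ennreal_times_divide mult.commute)
  also have "\<dots> = (\<integral>\<^sup>+p. (indicator A (snd p) * path_weight V y (fst p) (snd p)) \<partial>?J) / Z_ann M V y"
    by (rule nn_integral_divide) measurable
  also have "(\<integral>\<^sup>+p. (indicator A (snd p) * path_weight V y (fst p) (snd p)) \<partial>?J)
      = (\<integral>\<^sup>+\<omega>. (\<integral>\<^sup>+S. indicator A S * path_weight V y \<omega> S \<partial>walk_law 0) \<partial>M)"
    by (subst W.nn_integral_fst[symmetric]) (simp_all, measurable)
  finally show ?thesis .
qed

end

theory Submission
  imports Defs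
begin

text \<open>The mean hitting time is \<open>\<Sum>\<^sub>z E [G(0,z) G(z,y)] / Z\<close> with the Green function \<open>G\<close> of the walk
  killed by the potential and at \<open>y\<close>, whereas the mean number of visited sites is
  \<open>\<Sum>\<^sub>z E [G\<^sub>z(0,z) G(z,y)] / Z\<close> with \<open>G\<^sub>z(0,z)\<close> counting only the paths stopped at their first visit to \<open>z\<close>.
  The latter is at most linear in \<open>y\<close>, since every new site costs a factor less than 1 and \<open>Z\<close> decays at
  most exponentially. So it suffices to compare the two sums.

  Call a site an obstacle if its potential exceeds a small level, or if it is \<open>y\<close>. If \<open>r\<close> is the distance
  from \<open>z\<close> to the nearest obstacle, then \<open>G\<close> is at most exponential in \<open>r\<close> near \<open>z\<close>, while the ball of
  radius \<open>r\<close> around \<open>z\<close> is free of obstacles, and this environment is independent of the pieces of the path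
  before its first entrance into and after its last exit from the ball. Replacing the piece in between by a
  direct crossing in a fresh environment costs \<open>exp (O r)\<close>. In dimension at least 2 this is negligible
  compared to the probability \<open>exp (- c r\<^sup>d)\<close> of a free ball. In dimension 1 it has to be shown that
  crossing an interval is exponentially cheaper than having it free of obstacles. This follows from a
  renewal argument at the sites with potential in \<open>(0, \<infinity>)\<close>: crossing a gap of length \<open>l\<close> between two of
  them succeeds with probability of order \<open>1 / l\<close>, and the sum of these over \<open>l\<close> diverges.

  The bound on the derivative follows by Jensen's inequality, and the Lyapunov exponents exist by Fekete's
  lemma.\<close>

section \<open>Green functions of killed nearest-neighbour kernels\<close>

text \<open>The two sums differ by the returns to \<open>z\<close>, which admit no uniform bound:
  the potential comes arbitrarily close to 0, so \<open>z\<close> may lie in a large region where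
  the walk lingers almost for free. Such a region is correlated with the rest of the path in the
  annealed average; the surgery is arranged so that it is read by one factor only.

  What has to be summed is, up to powers of \<open>r\<close>,
  \<open>lam ^ (4 * r) * q ^ n / kappa r\<close>: two Green functions over distances up to
  \<open>2 * r\<close>, the probability that all \<open>n\<close> sites of the ball are free, and
  the mean weight of a crossing. In dimension 1 one has \<open>n = 2 * r - 1\<close>, so every
  factor is exponential in \<open>r\<close> and the rates decide. There \<open>lam\<close> may be
  taken close to 1 and \<open>q\<close> close to the probability \<open>p\<close> that the potential
  vanishes, and a crossing rate above \<open>p\<close> is required. If the potential took the values
  0 and \<infinity> only, a crossing would force its interval to be free and the two rates would
  coincide; sites with values in between break this tie.

  Consecutive pieces of a path may share sites, so supermultiplicativity of \<open>Z\<close> rests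
  on positive association instead of independence.\<close>

definition nbr :: "(int ^ 'd::finite) set" where
  "nbr = {e. \<exists>i. e = axis i 1 \<or> e = axis i (-1)}"

definition kstep :: "(int ^ 'd::finite \<Rightarrow> ennreal) \<Rightarrow> (int ^ 'd \<Rightarrow> ennreal) \<Rightarrow> int ^ 'd \<Rightarrow> ennreal" where
  "kstep k f x = k x * (\<Sum>e\<in>nbr. f (x + e))"

definition potential :: "(int ^ 'd::finite \<Rightarrow> ennreal) \<Rightarrow> (int ^ 'd \<Rightarrow> ennreal) \<Rightarrow> int ^ 'd \<Rightarrow> ennreal" where
  "potential k g x = (\<Sum>n. (kstep k ^^ n) g x)"

definition green :: "(int ^ 'd::finite \<Rightarrow> ennreal) \<Rightarrow> int ^ 'd \<Rightarrow> int ^ 'd \<Rightarrow> ennreal" where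
  "green k x w = potential k (indicator {w}) x"

text \<open>The weight \<open>k\<close> is taken at all sites of a path but the last one. Hence \<open>green k x w\<close> with \<open>k w = 0\<close> is
  the total weight of the paths from \<open>x\<close> that are stopped at their first visit to \<open>w\<close>.\<close>

lemma finite_nbr [simp]: "finite (nbr :: (int ^ 'd::finite) set)"
  by (rule finite_subset[of _ "range (\<lambda>i. axis i 1) \<union> range (\<lambda>i. axis i (-1))"])
     (auto simp: nbr_def)

lemma nbr_nonempty [simp]: "nbr \<noteq> ({} :: (int ^ 'd::finite) set)"
  by (auto simp: nbr_def)

lemma uminus_nbr: "e \<in> nbr \<Longrightarrow> - e \<in> (nbr :: (int ^ 'd::finite) set)"
  by (auto simp: nbr_def axis_def vec_eq_iff)

lemma card_nbr_pos: "card (nbr :: (int ^ 'd::finite) set) > 0"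
  by (simp add: card_gt_0_iff)

lemma kstep_mono: "(\<And>x. k x \<le> k' x) \<Longrightarrow> (\<And>x. f x \<le> f' x) \<Longrightarrow> kstep k f x \<le> kstep k' f' x"
  unfolding kstep_def by (intro mult_mono sum_mono) auto

lemma kstep_add: "kstep k (\<lambda>x. f x + g x) x = kstep k f x + kstep k g x"
  by (simp add: kstep_def sum.distrib distrib_left)

lemma kstep_cmult: "kstep k (\<lambda>x. c * f x) x = c * kstep k f x"
  by (simp add: kstep_def sum_distrib_left mult_ac)

lemma kstep_zero [simp]: "kstep k (\<lambda>x. 0) x = 0"
  by (simp add: kstep_def)

lemma kstep_sum: "kstep k (\<lambda>x. \<Sum>i\<in>I. f i x) x = (\<Sum>i\<in>I. kstep k (f i) x)"
  by (induction I rule: infinite_finite_induct) (simp_all add: kstep_add)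

lemma kstep_suminf: "kstep k (\<lambda>x. \<Sum>n. f n x) x = (\<Sum>n. kstep k (f n) x)"
  unfolding kstep_def
  by (subst suminf_sum[symmetric]) auto

lemma kstep_pow_Suc: "(kstep k ^^ Suc n) f x = k x * (\<Sum>e\<in>nbr. (kstep k ^^ n) f (x + e))"
  by (simp add: kstep_def)

lemma kstep_pow_mono:
  "(\<And>x. k x \<le> k' x) \<Longrightarrow> (\<And>x. f x \<le> f' x) \<Longrightarrow> (kstep k ^^ n) f x \<le> (kstep k' ^^ n) f' x"
  by (induction n arbitrary: x) (auto intro!: kstep_mono)

lemma kstep_pow_add: "(kstep k ^^ n) (\<lambda>x. f x + g x) x = (kstep k ^^ n) f x + (kstep k ^^ n) g x"
proof (induction n arbitrary: x)
  case (Suc n)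
  then have "(kstep k ^^ n) (\<lambda>x. f x + g x) = (\<lambda>x. (kstep k ^^ n) f x + (kstep k ^^ n) g x)"
    by blast
  then show ?case by (simp add: kstep_add)
qed simp

lemma kstep_pow_cmult: "(kstep k ^^ n) (\<lambda>x. c * f x) x = c * (kstep k ^^ n) f x"
proof (induction n arbitrary: x)
  case (Suc n)
  then have "(kstep k ^^ n) (\<lambda>x. c * f x) = (\<lambda>x. c * (kstep k ^^ n) f x)"
    by blast
  then show ?case by (simp add: kstep_cmult)
qed simp

lemma potential_unfold: "potential k g x = g x + kstep k (potential k g) x"
proof -
  have "potential k g x = (kstep k ^^ 0) g x + (\<Sum>n. (kstep k ^^ Suc n) g x)"
    unfolding potential_def by (subst suminf_offset[where i = 1]) auto
  also have "(\<Sum>n. (kstep k ^^ Suc n) g x) = kstep k (potential k g) x"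
    using kstep_suminf[of k "\<lambda>n. (kstep k ^^ n) g" x]
    by (simp add: potential_def[abs_def] o_def)
  finally show ?thesis by simp
qed

lemma potential_partial_unfold:
  "(\<Sum>n<Suc N. (kstep k ^^ n) g x) = g x + kstep k (\<lambda>x. \<Sum>n<N. (kstep k ^^ n) g x) x"
  by (subst sum.lessThan_Suc_shift) (simp add: kstep_sum del: sum.lessThan_Suc)

text \<open>Induction on the partial sums of the Neumann series. Any supersolution qualifies, even
  one with infinite values.\<close>

lemma potential_least:
  assumes "\<And>x. g x + kstep k u x \<le> u x"
  shows "potential k g x \<le> u x"
proof -
  have *: "(\<Sum>n<N. (kstep k ^^ n) g x) \<le> u x" for N x
  proof (induction N arbitrary: x)
    case (Suc N)
    have "(\<Sum>n<Suc N. (kstep k ^^ n) g x) \<le> g x + kstep k u x"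
      unfolding potential_partial_unfold
      by (intro add_mono kstep_mono order_refl Suc)
    also have "\<dots> \<le> u x" by (rule assms)
    finally show ?case .
  qed simp
  have "potential k g x = (SUP N. (\<Sum>n<N. (kstep k ^^ n) g x))"
    unfolding potential_def by (rule suminf_eq_SUP)
  also have "\<dots> \<le> u x" by (intro SUP_least *)
  finally show ?thesis .
qed

lemma potential_mono:
  assumes "\<And>x. k x \<le> k' x" "\<And>x. g x \<le> g' x"
  shows "potential k g x \<le> potential k' g' x"
  unfolding potential_def by (intro suminf_le kstep_pow_mono assms) auto

lemma potential_cmult: "potential k (\<lambda>x. c * g x) x = c * potential k g x"
  unfolding potential_def by (simp add: kstep_pow_cmult)

lemma potential_add: "potential k (\<lambda>x. f x + g x) x = potential k f x + potential k g x"
  unfolding potential_def by (simp add: kstep_pow_add suminf_add)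

lemma potential_zero [simp]: "potential k (\<lambda>x. 0) x = 0"
  using potential_cmult[of k 0 "\<lambda>x. 0" x] by simp

lemma potential_sum: "potential k (\<lambda>x. \<Sum>i\<in>I. f i x) x = (\<Sum>i\<in>I. potential k (f i) x)"
  by (induction I rule: infinite_finite_induct) (simp_all add: potential_add)

text \<open>Counting the steps of a path amounts to choosing one of its positions, that is, to splitting
  it there into two paths.\<close>

lemma time_potential_le:
  "(\<Sum>n. of_nat n * (kstep k ^^ n) g x) \<le> potential k (kstep k (potential k g)) x"
proof -
  let ?v = "potential k (kstep k (potential k g))"
  have *: "(\<Sum>n<N. of_nat n * (kstep k ^^ n) g x) \<le> ?v x" for N x
  proof (induction N arbitrary: x)
    case (Suc N)
    have "(\<Sum>n<Suc N. of_nat n * (kstep k ^^ n) g x)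
        = (\<Sum>n<N. of_nat (Suc n) * (kstep k ^^ Suc n) g x)"
      by (subst sum.lessThan_Suc_shift) (simp del: of_nat_Suc)
    also have "\<dots> = (\<Sum>n<N. kstep k (\<lambda>x. of_nat n * (kstep k ^^ n) g x) x)
         + (\<Sum>n<N. (kstep k ^^ Suc n) g x)"
      by (simp add: kstep_cmult sum.distrib[symmetric] distrib_right add.commute)
    also have "\<dots> = kstep k (\<lambda>x. \<Sum>n<N. of_nat n * (kstep k ^^ n) g x) x
         + kstep k (\<lambda>x. \<Sum>n<N. (kstep k ^^ n) g x) x"
      by (simp add: kstep_sum)
    also have "\<dots> \<le> kstep k ?v x + kstep k (potential k g) x"
      by (intro add_mono kstep_mono Suc order_refl)
         (simp add: potential_def sum_le_suminf)
    also have "\<dots> = ?v x"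
      by (subst potential_unfold[of k "kstep k (potential k g)" x]) (rule add.commute)
    finally show ?case .
  qed simp
  show ?thesis
    by (subst suminf_eq_SUP) (intro SUP_least *)
qed

lemma green_unfold: "green k x w = indicator {w} x + kstep k (\<lambda>x. green k x w) x"
  using potential_unfold[of k "indicator {w}" x] by (simp add: green_def[abs_def])

lemma green_least:
  assumes "\<And>x. indicator {w} x + kstep k u x \<le> u x"
  shows "green k x w \<le> u x"
  unfolding green_def by (rule potential_least) (rule assms)

lemma green_mono: "(\<And>x. k x \<le> k' x) \<Longrightarrow> green k x w \<le> green k' x w"
  unfolding green_def by (intro potential_mono) auto

lemma green_killed: "k x = 0 \<Longrightarrow> green k x w = indicator {w} x"
  by (subst green_unfold) (simp add: kstep_def)

lemma green_step: "e \<in> nbr \<Longrightarrow> k x * green k (x + e) w \<le> green k x w"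
proof -
  assume e: "e \<in> nbr"
  have "green k (x + e) w \<le> (\<Sum>e\<in>nbr. green k (x + e) w)"
    using e by (intro member_le_sum) auto
  then have "k x * green k (x + e) w \<le> kstep k (\<lambda>x. green k x w) x"
    unfolding kstep_def by (intro mult_left_mono) auto
  also have "\<dots> \<le> green k x w" by (subst (2) green_unfold) simp
  finally show ?thesis .
qed

text \<open>By linearity, since \<open>g\<close> is a superposition of point masses. This makes the
  site visible at which \<open>time_potential_le\<close> splits a path.\<close>

lemma potential_eq_sum_green:
  "potential k g x = (\<integral>\<^sup>+z. green k x z * g z \<partial>count_space UNIV)"
proof -
  have *: "(kstep k ^^ n) g x = (\<integral>\<^sup>+z. (kstep k ^^ n) (indicator {z}) x * g z \<partial>count_space UNIV)" for n
  proof (induction n arbitrary: x)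
    case 0
    have "(\<integral>\<^sup>+z. indicator {z} x * g z \<partial>count_space UNIV)
        = (\<integral>\<^sup>+z. g z * indicator {x} z \<partial>count_space UNIV)"
      by (intro nn_integral_cong) (auto simp: indicator_def)
    then show ?case by (simp add: nn_integral_indicator_singleton)
  next
    case (Suc n)
    have "(kstep k ^^ Suc n) g x
        = k x * (\<Sum>e\<in>nbr. \<integral>\<^sup>+z. (kstep k ^^ n) (indicator {z}) (x + e) * g z \<partial>count_space UNIV)"
      using Suc by (simp only: kstep_pow_Suc)
    also have "\<dots> = (\<integral>\<^sup>+z. k x * (\<Sum>e\<in>nbr. (kstep k ^^ n) (indicator {z}) (x + e) * g z) \<partial>count_space UNIV)"
      by (subst nn_integral_sum[symmetric], simp, subst nn_integral_cmult[symmetric]) auto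
    finally show ?case by (simp only: kstep_pow_Suc sum_distrib_right mult.assoc)
  qed
  have "potential k g x = (\<Sum>n. \<integral>\<^sup>+z. (kstep k ^^ n) (indicator {z}) x * g z \<partial>count_space UNIV)"
    unfolding potential_def using * by simp
  also have "\<dots> = (\<integral>\<^sup>+z. (\<Sum>n. (kstep k ^^ n) (indicator {z}) x * g z) \<partial>count_space UNIV)"
    by (subst nn_integral_suminf) auto
  finally show ?thesis by (simp add: green_def potential_def)
qed

text \<open>All decompositions of a path below are comparisons with the minimal solution of the
  Poisson equation (\<open>potential_least\<close>), so no path has to be cut explicitly.\<close>

lemma green_concat:
  assumes "\<And>x. k' x \<le> k x" "k' c = 0"
  shows "green k' x c * green k c w \<le> green k x w"
proof -
  have "potential k' (\<lambda>x. green k c w * indicator {c} x) x \<le> green k x w"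
  proof (rule potential_least)
    fix x
    show "green k c w * indicator {c} x + kstep k' (\<lambda>x. green k x w) x \<le> green k x w"
    proof (cases "x = c")
      case True
      then show ?thesis using assms by (simp add: kstep_def)
    next
      case False
      have "kstep k' (\<lambda>x. green k x w) x \<le> kstep k (\<lambda>x. green k x w) x"
        by (rule kstep_mono) (auto simp: assms)
      also have "\<dots> \<le> green k x w" by (subst (2) green_unfold) simp
      finally show ?thesis using False by simp
    qed
  qed
  then show ?thesis
    unfolding potential_cmult by (simp only: green_def[symmetric] mult.commute)
qed

section \<open>Decompositions of Green functions at visits to a finite set\<close>

definition kill :: "(int ^ 'd::finite) set \<Rightarrow> (int ^ 'd \<Rightarrow> ennreal) \<Rightarrow> int ^ 'd \<Rightarrow> ennreal" where
  "kill B k x = (if x \<in> B then 0 else k x)"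

lemma green_kill_in: "x \<in> B \<Longrightarrow> green (kill B k) x w = indicator {w} x"
  by (simp add: green_killed kill_def)

lemma kstep_kill: "x \<notin> B \<Longrightarrow> kstep (kill B k) f x = kstep k f x"
  by (simp add: kstep_def kill_def)

text \<open>The right-hand side equals \<open>green k x w\<close> on \<open>B\<close> and solves the
  Poisson equation off \<open>B\<close>, so it is a supersolution.\<close>

lemma green_first_entrance:
  assumes B: "finite B" and w: "w \<in> B"
  shows "green k x w \<le> (\<Sum>b\<in>B. green (kill B k) x b * green k b w)"
proof -
  let ?u = "\<lambda>x. \<Sum>b\<in>B. green k b w * green (kill B k) x b"
  have in_B: "?u x = green k x w" if "x \<in> B" for x
    using B that by (simp add: green_kill_in indicator_def if_distrib sum.delta cong: if_cong)
  have out: "?u x = kstep k ?u x" if "x \<notin> B" for x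
  proof -
    have "green (kill B k) x b = kstep k (\<lambda>x. green (kill B k) x b) x" if "b \<in> B" for b
      using \<open>x \<notin> B\<close> that by (subst green_unfold) (auto simp: kstep_kill indicator_def)
    then have "?u x = (\<Sum>b\<in>B. green k b w * kstep k (\<lambda>x. green (kill B k) x b) x)"
      by (intro sum.cong) auto
    then show ?thesis by (simp add: kstep_sum kstep_cmult)
  qed
  \<comment> \<open>Needed below at sites of \<open>B\<close>: their neighbours may lie off
    \<open>B\<close>, where \<open>?u\<close> is not yet known to equal the Green function.\<close>
  have le: "?u x \<le> green k x w" for x
  proof -
    have "potential (kill B k) (\<lambda>x. \<Sum>b\<in>B. green k b w * indicator {b} x) x \<le> green k x w"
    proof (rule potential_least)
      fix x
      show "(\<Sum>b\<in>B. green k b w * indicator {b} x) + kstep (kill B k) (\<lambda>x. green k x w) x \<le> green k x w"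
      proof (cases "x \<in> B")
        case True
        then show ?thesis using B
          by (simp add: kstep_def kill_def indicator_def if_distrib sum.delta cong: if_cong)
      next
        case False
        then have "(\<Sum>b\<in>B. green k b w * indicator {b} x) = 0"
          by (intro sum.neutral) (auto simp: indicator_def)
        moreover have "kstep k (\<lambda>x. green k x w) x \<le> green k x w"
          by (subst (2) green_unfold) simp
        ultimately show ?thesis using False by (simp add: kstep_kill)
      qed
    qed
    also have "potential (kill B k) (\<lambda>x. \<Sum>b\<in>B. green k b w * indicator {b} x) x = ?u x"
      by (simp add: potential_sum potential_cmult green_def)
    finally show ?thesis .
  qed
  have "green k x w \<le> ?u x"
  proof (rule green_least)
    fix x
    show "indicator {w} x + kstep k ?u x \<le> ?u x"
    proof (cases "x \<in> B")
      case True
      have "indicator {w} x + kstep k ?u x \<le> indicator {w} x + kstep k (\<lambda>x. green k x w) x"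
        by (intro add_mono kstep_mono le order_refl)
      also have "\<dots> = ?u x" using True by (simp only: in_B green_unfold[symmetric])
      finally show ?thesis .
    next
      case False
      then show ?thesis using out[OF False] w by (auto simp: indicator_def)
    qed
  qed
  then show ?thesis by (simp add: mult.commute)
qed

text \<open>Two point masses are propagated by the kernel killed at \<open>z\<close>: one at
  \<open>w\<close>, and one at \<open>z\<close> carrying the weight of everything after the first
  visit to \<open>z\<close>.\<close>

lemma green_avoid_or_hit:
  assumes "z \<noteq> w"
  shows "green (kill {z} k) x w + green (kill {z} k) x z * green k z w \<le> green k x w"
proof -
  let ?g = "\<lambda>x. indicator {w} x + green k z w * indicator {z} x"
  have "potential (kill {z} k) ?g x \<le> green k x w"
  proof (rule potential_least)
    fix x
    show "?g x + kstep (kill {z} k) (\<lambda>x. green k x w) x \<le> green k x w"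
    proof (cases "x = z")
      case True
      then show ?thesis using assms by (simp add: kstep_def kill_def)
    next
      case False
      then show ?thesis by (subst green_unfold[of k x]) (simp add: kstep_kill)
    qed
  qed
  also have "potential (kill {z} k) ?g x
      = potential (kill {z} k) (indicator {w}) x
        + potential (kill {z} k) (\<lambda>x. green k z w * indicator {z} x) x"
    by (rule potential_add)
  finally show ?thesis
    unfolding potential_cmult by (simp only: green_def[symmetric] mult.commute)
qed

lemma green_last_exit:
  assumes B: "finite B" and w: "w \<notin> B" and x: "x \<in> B"
  shows "green k x w \<le> (\<Sum>b\<in>B. green k x b * kstep k (\<lambda>v. green (kill B k) v w) b)"
proof -
  \<comment> \<open>Weight of leaving \<open>b\<close> and reaching \<open>w\<close> without another
    visit to \<open>B\<close>. The extra summand in \<open>?u\<close> covers paths that avoid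
    \<open>B\<close> altogether and vanishes for starting points in \<open>B\<close>.\<close>
  define c where "c b = kstep k (\<lambda>v. green (kill B k) v w) b" for b
  let ?u = "\<lambda>x. green (kill B k) x w + (\<Sum>b\<in>B. c b * green k x b)"
  have step: "kstep k ?u x = kstep k (\<lambda>v. green (kill B k) v w) x
      + (\<Sum>b\<in>B. c b * kstep k (\<lambda>x. green k x b) x)" for x
    by (simp add: kstep_add kstep_sum kstep_cmult)
  have "green k x w \<le> ?u x"
  proof (rule green_least)
    fix x
    have s: "(\<Sum>b\<in>B. c b * green k x b)
        = (\<Sum>b\<in>B. c b * indicator {b} x) + (\<Sum>b\<in>B. c b * kstep k (\<lambda>x. green k x b) x)"
      by (subst green_unfold) (simp add: distrib_left sum.distrib)
    show "indicator {w} x + kstep k ?u x \<le> ?u x"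
    proof (cases "x \<in> B")
      case True
      then have "(\<Sum>b\<in>B. c b * indicator {b} x) = c x"
        using B by (simp add: indicator_def if_distrib sum.delta cong: if_cong)
      then show ?thesis
        using True by (simp only: step s green_kill_in) (simp add: c_def add_ac)
    next
      case False
      then have "(\<Sum>b\<in>B. c b * indicator {b} x) = 0"
        by (intro sum.neutral) (auto simp: indicator_def)
      moreover have "green (kill B k) x w
          = indicator {w} x + kstep k (\<lambda>v. green (kill B k) v w) x"
        using False by (subst green_unfold) (simp add: kstep_kill)
      ultimately show ?thesis by (simp only: step s) (simp add: add_ac)
    qed
  qed
  also have "green (kill B k) x w = 0"
    using w x by (auto simp: green_kill_in indicator_def)
  finally show ?thesis by (simp add: c_def mult.commute)
qed

lemma measurable_kstep_pow:
  assumes [measurable]: "\<And>x. (\<lambda>\<omega>. k \<omega> x) \<in> borel_measurable M"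
  shows "(\<lambda>\<omega>. (kstep (k \<omega>) ^^ n) g x) \<in> borel_measurable M"
proof (induction n arbitrary: x)
  case (Suc n)
  note [measurable] = Suc
  show ?case unfolding kstep_pow_Suc by measurable
qed simp

lemma measurable_green:
  assumes "\<And>x. (\<lambda>\<omega>. k \<omega> x) \<in> borel_measurable M"
  shows "(\<lambda>\<omega>. green (k \<omega>) x w) \<in> borel_measurable M"
proof -
  note [measurable] = measurable_kstep_pow[OF assms]
  show ?thesis unfolding green_def potential_def by measurable
qed

section \<open>Expansion over explicit paths\<close>

fun trail :: "'a::plus \<Rightarrow> 'a list \<Rightarrow> 'a list" where
  "trail x [] = []"
| "trail x (e # s) = x # trail (x + e) s"

definition steps :: "nat \<Rightarrow> (int ^ 'd::finite) list set" where
  "steps n = {s. set s \<subseteq> nbr \<and> length s = n}"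

lemma finite_steps [simp]: "finite (steps n)"
  unfolding steps_def by (rule finite_lists_length_eq) simp

lemma length_trail [simp]: "length (trail x s) = length s"
  by (induction s arbitrary: x) auto

lemma steps_Suc: "steps (Suc n) = (\<lambda>(e, s). e # s) ` (nbr \<times> steps n)"
  by (auto simp: steps_def image_iff length_Suc_conv)

lemma sum_steps_Suc: "(\<Sum>s\<in>steps (Suc n). F s) = (\<Sum>e\<in>nbr. \<Sum>s\<in>steps n. F (e # s))"
  unfolding steps_Suc
  by (subst sum.reindex) (auto simp: inj_on_def sum.cartesian_product split_beta')

text \<open>\<open>trail\<close> omits the end point of a path because a site is charged on
  departure. In this form averages over the environment can be taken path by path.\<close>

lemma kstep_pow_eq_sum_paths:
  fixes x :: "int ^ 'd::finite"
  shows "(kstep k ^^ n) (indicator {w}) x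
    = (\<Sum>s\<in>steps n. (\<Prod>z\<leftarrow>trail x s. k z) * indicator {w} (x + sum_list s))"
proof (induction n arbitrary: x)
  case 0
  have "steps 0 = {[] :: (int ^ 'd) list}" by (auto simp: steps_def)
  then show ?case by simp
next
  case (Suc n)
  show ?case
    unfolding kstep_pow_Suc Suc sum_steps_Suc
    by (simp only: sum_distrib_left trail.simps list.map prod_list.Cons sum_list.Cons mult.assoc add.assoc)
qed

section \<open>The l1 distance on the lattice\<close>

definition l1 :: "int ^ 'd::finite \<Rightarrow> nat" where
  "l1 x = (\<Sum>i\<in>UNIV. nat \<bar>x $ i\<bar>)"

lemma l1_zero [simp]: "l1 0 = 0"
  by (simp add: l1_def)

lemma l1_eq_0_iff [simp]: "l1 x = 0 \<longleftrightarrow> x = 0"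
  by (auto simp: l1_def vec_eq_iff)

lemma l1_triangle: "l1 (x + y) \<le> l1 x + l1 y"
  unfolding l1_def sum.distrib[symmetric] by (intro sum_mono) auto

lemma l1_minus_commute: "l1 (x - y) = l1 (y - x)"
  unfolding l1_def by (intro sum.cong) auto

lemma l1_nbr: "e \<in> nbr \<Longrightarrow> l1 e = 1"
proof -
  assume "e \<in> nbr"
  then obtain i c where e: "e = axis i c" and c: "c = 1 \<or> c = -1"
    by (auto simp: nbr_def)
  have "l1 e = (\<Sum>j\<in>UNIV. if j = i then nat \<bar>c\<bar> else 0)"
    unfolding l1_def e by (intro sum.cong) (auto simp: axis_def)
  then show ?thesis using c by auto
qed

lemma nbr_nonzero: "e \<in> nbr \<Longrightarrow> e \<noteq> 0"
  using l1_nbr by fastforce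

lemma l1_step: "e \<in> nbr \<Longrightarrow> l1 (x + e) \<le> Suc (l1 x)"
  using l1_triangle[of x e] by (simp add: l1_nbr)

lemma l1_step_down:
  assumes "x \<noteq> 0"
  obtains e where "e \<in> nbr" "l1 x = Suc (l1 (x + e))"
proof -
  obtain i where i: "x $ i \<noteq> 0" using assms by (auto simp: vec_eq_iff)
  define e :: "int ^ 'a" where "e = axis i (- sgn (x $ i))"
  have "e \<in> nbr" using i by (auto simp: e_def nbr_def sgn_if)
  moreover have "l1 x = Suc (l1 (x + e))"
  proof -
    have "l1 y = nat \<bar>y $ i\<bar> + (\<Sum>j\<in>UNIV - {i}. nat \<bar>y $ j\<bar>)" for y :: "int ^ 'a"
      unfolding l1_def by (rule sum.remove) auto
    moreover have "(\<Sum>j\<in>UNIV - {i}. nat \<bar>(x + e) $ j\<bar>) = (\<Sum>j\<in>UNIV - {i}. nat \<bar>x $ j\<bar>)"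
      by (intro sum.cong) (auto simp: e_def axis_def)
    moreover have "nat \<bar>x $ i\<bar> = Suc (nat \<bar>(x + e) $ i\<bar>)"
      using i by (auto simp: e_def axis_def sgn_if)
    ultimately show ?thesis by simp
  qed
  ultimately show ?thesis by (rule that)
qed

lemma green_eq_paths:
  fixes x :: "int ^ 'd::finite"
  shows "green k x w = (\<integral>\<^sup>+s. (\<Prod>z\<leftarrow>trail x s. k z) * indicator {w} (x + sum_list s)
      * indicator {s. set s \<subseteq> nbr} s \<partial>count_space UNIV)"
proof -
  let ?f = "\<lambda>s. (\<Prod>z\<leftarrow>trail x s. k z) * indicator {w} (x + sum_list s)"
  have "green k x w = (\<Sum>n. \<Sum>s\<in>steps n. ?f s)"
    unfolding green_def potential_def kstep_pow_eq_sum_paths ..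
  also have "\<dots> = (\<Sum>n. \<integral>\<^sup>+s. ?f s * indicator (steps n) s \<partial>count_space UNIV)"
    by (subst nn_integral_count_space_indicator[symmetric])
       (simp_all add: nn_integral_count_space_finite)
  also have "\<dots> = (\<integral>\<^sup>+s. (\<Sum>n. ?f s * indicator (steps n) s) \<partial>count_space UNIV)"
    by (subst nn_integral_suminf) auto
  also have "\<dots> = (\<integral>\<^sup>+s. ?f s * indicator {s. set s \<subseteq> nbr} s \<partial>count_space UNIV)"
  proof (rule nn_integral_cong)
    fix s :: "(int ^ 'd) list"
    have "(\<Sum>n. ?f s * indicator (steps n) s) = (\<Sum>n\<in>{length s}. ?f s * indicator (steps n) s)"
      by (rule suminf_finite) (auto simp: steps_def)
    then show "(\<Sum>n. ?f s * indicator (steps n) s) = ?f s * indicator {s. set s \<subseteq> nbr} s"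
      by (simp add: steps_def indicator_def)
  qed
  finally show ?thesis .
qed

lemma trail_translate: "trail (x + y) s = map ((+) x) (trail y (s :: 'a::semigroup_add list))"
  by (induction s arbitrary: y) (auto simp: add.assoc)

text \<open>\<open>A\<close> is the set of sites from which the walk may go on; a path may end
  outside \<open>A\<close>, but not continue there. So \<open>ker (-{y})\<close> describes the walk
  stopped at its first visit to \<open>y\<close>, and removing \<open>B\<close> from
  \<open>A\<close> forbids passing through \<open>B\<close>.\<close>

definition ker :: "(int ^ 'd::finite) set \<Rightarrow> (int ^ 'd \<Rightarrow> real) \<Rightarrow> int ^ 'd \<Rightarrow> ennreal" where
  "ker A \<phi> z = (if z \<in> A then ennreal (\<phi> z / real (card (nbr :: (int ^ 'd) set))) else 0)"

lemma kill_ker: "kill B (ker A \<phi>) = ker (A - B) \<phi>"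
  by (auto simp: kill_def ker_def)

lemma ker_mono: "A \<subseteq> A' \<Longrightarrow> ker A \<phi> x \<le> ker A' \<phi> x"
  by (auto simp: ker_def)

lemma green_ker_mono: "A \<subseteq> A' \<Longrightarrow> green (ker A \<phi>) x w \<le> green (ker A' \<phi>) x w"
  by (intro green_mono ker_mono)

lemma ker_cong: "(\<And>z. z \<in> A \<Longrightarrow> \<phi> z = \<phi>' z) \<Longrightarrow> ker A \<phi> = ker A \<phi>'"
  by (auto simp: ker_def)

lemma kstep_ker_le_const:
  fixes x :: "int ^ 'd::finite"
  assumes "\<phi> x \<le> 1" "\<And>e. e \<in> nbr \<Longrightarrow> f (x + e) \<le> c"
  shows "kstep (ker A \<phi>) f x \<le> c"
proof -
  let ?D = "real (card (nbr :: (int ^ 'd) set))"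
  have D: "?D > 0" using card_nbr_pos by simp
  have "ker A \<phi> x \<le> ennreal (1 / ?D)"
    using assms(1) D by (auto simp: ker_def intro!: ennreal_leI divide_right_mono)
  moreover have "(\<Sum>e\<in>nbr. f (x + e)) \<le> of_nat (card (nbr :: (int ^ 'd) set)) * c"
    using assms(2) by (rule sum_bounded_above)
  ultimately have "kstep (ker A \<phi>) f x \<le> ennreal (1 / ?D) * (of_nat (card (nbr :: (int ^ 'd) set)) * c)"
    unfolding kstep_def by (intro mult_mono) auto
  also have "\<dots> = ennreal (1 / ?D * ?D) * c"
    using D by (subst ennreal_mult) (auto simp: ennreal_of_nat_eq_real_of_nat mult.assoc)
  also have "\<dots> = c" using D by simp
  finally show ?thesis .
qed

lemma green_ker_le_1:
  assumes "\<And>x. \<phi> x \<le> 1" "w \<notin> A"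
  shows "green (ker A \<phi>) x w \<le> 1"
proof (rule green_least)
  fix x
  show "indicator {w} x + kstep (ker A \<phi>) (\<lambda>x. 1) x \<le> 1"
  proof (cases "x = w")
    case True
    then show ?thesis using assms by (simp add: kstep_def ker_def)
  next
    case False
    then show ?thesis using kstep_ker_le_const[of \<phi> x "\<lambda>x. 1" 1 A] assms by simp
  qed
qed

text \<open>Not an instance of \<open>green_concat\<close>: the first piece is stopped at
  \<open>c\<close> but may pass through \<open>w\<close> on its way. Where it does, \<open>w\<close>
  has been hit, and the value 1 there dominates by \<open>green_ker_le_1\<close>.\<close>

lemma hitting_concat:
  assumes "\<And>x. \<phi> x \<le> 1"
  shows "green (ker (-{c}) \<phi>) x c * green (ker (-{w}) \<phi>) c w \<le> green (ker (-{w}) \<phi>) x w"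
proof -
  let ?v = "\<lambda>x. green (ker (-{w}) \<phi>) x w"
  have "potential (ker (-{c}) \<phi>) (\<lambda>x. ?v c * indicator {c} x) x \<le> ?v x"
  proof (rule potential_least)
    fix x
    show "?v c * indicator {c} x + kstep (ker (-{c}) \<phi>) ?v x \<le> ?v x"
    proof (cases "x = c")
      case True
      then show ?thesis by (simp add: kstep_def ker_def)
    next
      case c: False
      show ?thesis
      proof (cases "x = w")
        case True
        then have "?v x = 1" by (simp add: green_killed ker_def)
        moreover have "kstep (ker (-{c}) \<phi>) ?v x \<le> 1"
          by (intro kstep_ker_le_const green_ker_le_1 assms) auto
        ultimately show ?thesis using c by simp
      next
        case False
        then have "kstep (ker (-{c}) \<phi>) ?v x = kstep (ker (-{w}) \<phi>) ?v x"
          using c by (simp add: kstep_def ker_def)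
        also have "\<dots> \<le> ?v x" by (subst (2) green_unfold) simp
        finally show ?thesis using c by simp
      qed
    qed
  qed
  then show ?thesis
    unfolding potential_cmult by (simp only: green_def[symmetric] mult.commute)
qed

lemma prod_list_ker:
  fixes xs :: "(int ^ 'd::finite) list"
  assumes "\<And>z. 0 \<le> \<phi> z"
  shows "(\<Prod>z\<leftarrow>xs. ker A \<phi> z)
    = indicator {xs. set xs \<subseteq> A} xs
      * ennreal ((\<Prod>z\<leftarrow>xs. \<phi> z) / real (card (nbr :: (int ^ 'd) set)) ^ length xs)"
proof (induction xs)
  case (Cons z xs)
  have "0 \<le> (\<Prod>z\<leftarrow>xs. \<phi> z)" using assms by (induction xs) auto
  then show ?case using Cons assms
    by (auto simp: ker_def ennreal_mult[symmetric] divide_simps mult_ac indicator_def)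
qed simp

lemma prod_list_eq_prod_count:
  assumes "finite S" "set xs \<subseteq> S"
  shows "(\<Prod>z\<leftarrow>xs. f z :: 'b::comm_monoid_mult) = (\<Prod>z\<in>S. f z ^ count_list xs z)"
  using assms(2)
proof (induction xs)
  case (Cons a xs)
  have "(\<Prod>z\<in>S. f z ^ count_list (a # xs) z)
      = (\<Prod>z\<in>S. (if z = a then f z else 1) * f z ^ count_list xs z)"
    by (intro prod.cong) auto
  also have "\<dots> = f a * (\<Prod>z\<in>S. f z ^ count_list xs z)"
    using Cons.prems assms(1) by (subst prod.distrib) (simp add: prod.delta)
  finally show ?case using Cons by simp
qed simp

section \<open>Independent site weights\<close>

text \<open>\<open>X z\<close> stands for the exponential of minus the potential at
  \<open>z\<close>. \<open>prob_pos\<close> gives the exponential lower bound on \<open>Z\<close>,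
  \<open>prob_less_1\<close> the cost of every new site.\<close>

locale iid_weights = prob_space M for M :: "'w measure" +
  fixes X :: "int ^ 'd::finite \<Rightarrow> 'w \<Rightarrow> real"
  assumes indep: "indep_vars (\<lambda>_. borel) X UNIV"
    and ident: "\<And>z. distr M borel (X z) = distr M borel (X 0)"
    and X_nonneg [simp]: "\<And>z \<omega>. 0 \<le> X z \<omega>"
    and X_le_1 [simp]: "\<And>z \<omega>. X z \<omega> \<le> 1"
    and prob_pos: "prob {\<omega> \<in> space M. X 0 \<omega> > 0} > 0"
    and prob_less_1: "prob {\<omega> \<in> space M. X 0 \<omega> = 1} < 1"
begin

definition deg :: real where "deg = real (card (nbr :: (int ^ 'd) set))"

lemma deg_pos: "deg > 0" and deg_ge_1: "deg \<ge> 1"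
  using card_nbr_pos[where 'd = 'd] by (auto simp: deg_def)

lemma measurable_X [measurable]: "X z \<in> borel_measurable M"
  using indep by (auto simp: indep_vars_def)

definition G :: "(int ^ 'd) set \<Rightarrow> int ^ 'd \<Rightarrow> int ^ 'd \<Rightarrow> 'w \<Rightarrow> ennreal" where
  "G A x w \<omega> = green (ker A (\<lambda>z. X z \<omega>)) x w"

definition EG :: "(int ^ 'd) set \<Rightarrow> int ^ 'd \<Rightarrow> int ^ 'd \<Rightarrow> ennreal" where
  "EG A x w = (\<integral>\<^sup>+\<omega>. G A x w \<omega> \<partial>M)"

definition Z :: "int ^ 'd \<Rightarrow> ennreal" where
  "Z y = EG (-{y}) 0 y"

lemma measurable_ker: "(\<lambda>\<omega>. ker A (\<lambda>z. X z \<omega>) x) \<in> borel_measurable M"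
  by (cases "x \<in> A") (simp_all add: ker_def)

lemma measurable_G [measurable]: "G A x w \<in> borel_measurable M"
  unfolding G_def[abs_def] by (intro measurable_green measurable_ker)

lemma G_mono: "A \<subseteq> A' \<Longrightarrow> G A x w \<omega> \<le> G A' x w \<omega>"
  unfolding G_def by (rule green_ker_mono)

lemma EG_mono: "A \<subseteq> A' \<Longrightarrow> EG A x w \<le> EG A' x w"
  unfolding EG_def by (intro nn_integral_mono G_mono)

lemma G_concat: "A' \<subseteq> A - {c} \<Longrightarrow> G A' x c \<omega> * G A c w \<omega> \<le> G A x w \<omega>"
  unfolding G_def by (rule green_concat) (auto simp: ker_def)

lemma G_le_1: "w \<notin> A \<Longrightarrow> G A x w \<omega> \<le> 1"
  unfolding G_def by (rule green_ker_le_1) auto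

lemma distr_integral_X:
  assumes [measurable]: "f \<in> borel_measurable borel"
  shows "expectation (\<lambda>\<omega>. f (X z \<omega>) :: real) = expectation (\<lambda>\<omega>. f (X 0 \<omega>))"
  using integral_distr[of "X z" M borel f] integral_distr[of "X 0" M borel f]
  by (simp add: ident[of z])

lemma prob_X:
  assumes [measurable]: "S \<in> sets borel"
  shows "prob {\<omega> \<in> space M. X z \<omega> \<in> S} = prob {\<omega> \<in> space M. X 0 \<omega> \<in> S}"
  using measure_distr[of "X z" M borel S] measure_distr[of "X 0" M borel S]
  by (simp add: ident[of z] vimage_def Int_def conj_commute)

text \<open>Invariance under \<open>restrict\<close> expresses that \<open>F\<close> and
  \<open>H\<close> read the environment on \<open>A\<close> and \<open>B\<close> only, so
  functionals of the whole environment can be inserted directly.\<close>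

lemma independent_factors:
  assumes AB: "A \<inter> B = {}"
    and F: "F \<in> borel_measurable (PiM A (\<lambda>_. borel))" "\<And>\<phi>. F (restrict \<phi> A) = F \<phi>"
    and H: "H \<in> borel_measurable (PiM B (\<lambda>_. borel))" "\<And>\<phi>. H (restrict \<phi> B) = H \<phi>"
  shows "(\<integral>\<^sup>+\<omega>. F (\<lambda>z. X z \<omega>) * H (\<lambda>z. X z \<omega>) \<partial>M)
    = (\<integral>\<^sup>+\<omega>. F (\<lambda>z. X z \<omega>) \<partial>M) * (\<integral>\<^sup>+\<omega>. H (\<lambda>z. X z \<omega>) \<partial>M :: ennreal)"
proof -
  have "indep_var borel (F \<circ> (\<lambda>\<omega>. restrict (\<lambda>i. X i \<omega>) A)) borel (H \<circ> (\<lambda>\<omega>. restrict (\<lambda>i. X i \<omega>) B))"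
    by (rule indep_var_compose[OF indep_var_restrict[OF indep AB] F(1) H(1)]) auto
  then have "indep_var borel (\<lambda>\<omega>. F (\<lambda>z. X z \<omega>)) borel (\<lambda>\<omega>. H (\<lambda>z. X z \<omega>))"
    by (simp add: o_def F H)
  then have "indep_vars (\<lambda>_. borel) (case_bool (\<lambda>\<omega>. F (\<lambda>z. X z \<omega>)) (\<lambda>\<omega>. H (\<lambda>z. X z \<omega>))) UNIV"
    unfolding indep_var_def by (rule indep_vars_cong[THEN iffD1, rotated -1]) (auto split: bool.split)
  from indep_vars_nn_integral[OF _ this] show ?thesis
    by (simp add: UNIV_bool mult.commute)
qed

lemma measurable_green_PiM:
  assumes "A' \<subseteq> A"
  shows "(\<lambda>\<phi>. green (ker A' \<phi>) x w) \<in> borel_measurable (PiM A (\<lambda>_. borel))"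
proof (rule measurable_green)
  fix z
  show "(\<lambda>\<phi>. ker A' \<phi> z) \<in> borel_measurable (PiM A (\<lambda>_. borel))"
  proof (cases "z \<in> A'")
    case True
    then have [measurable]: "(\<lambda>\<phi>. \<phi> z) \<in> borel_measurable (PiM A (\<lambda>_. borel))"
      using assms by (intro measurable_component_singleton) auto
    show ?thesis using True by (simp add: ker_def)
  qed (simp add: ker_def)
qed

lemma green_restrict: "A' \<subseteq> A \<Longrightarrow> green (ker A' (restrict \<phi> A)) x w = green (ker A' \<phi>) x w"
  by (subst ker_cong[of A' "restrict \<phi> A" \<phi>]) auto

section \<open>Moments of the site weight and mean weights of paths\<close>

definition moment :: "nat \<Rightarrow> real" where
  "moment l = expectation (\<lambda>\<omega>. X 0 \<omega> ^ l)"

definition path_mean :: "(int ^ 'd) list \<Rightarrow> real" where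
  "path_mean xs = expectation (\<lambda>\<omega>. \<Prod>z\<leftarrow>xs. X z \<omega>)"

lemma integrable_X_pow [simp]: "integrable M (\<lambda>\<omega>. X z \<omega> ^ l)"
  by (rule integrable_const_bound[of _ 1]) (auto simp: power_le_one)

lemma moment_0 [simp]: "moment 0 = 1"
  by (simp add: moment_def prob_space)

lemma moment_nonneg: "0 \<le> moment l"
  unfolding moment_def by (intro integral_nonneg_AE) auto

lemma moment_antimono: "l \<le> m \<Longrightarrow> moment m \<le> moment l"
  unfolding moment_def by (intro integral_mono) (auto intro: power_decreasing)

lemma moment_1_pos: "moment 1 > 0"
proof (rule ccontr)
  assume "\<not> ?thesis"
  then have "moment 1 = 0" using moment_nonneg[of 1] by simp
  then have "AE \<omega> in M. X 0 \<omega> = 0"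
    unfolding moment_def using integrable_X_pow[of 0 1]
    by (subst (asm) integral_nonneg_eq_0_iff_AE) auto
  then have "prob {\<omega> \<in> space M. X 0 \<omega> > 0} = 0"
    by (subst prob_eq_0) auto
  then show False using prob_pos by simp
qed

lemma moment_1_less_1: "moment 1 < 1"
proof (rule ccontr)
  assume "\<not> ?thesis"
  then have "moment 1 = 1" using moment_antimono[of 0 1] by simp
  then have "expectation (\<lambda>\<omega>. 1 - X 0 \<omega>) = 0"
    using integrable_X_pow[of 0 1] by (simp add: moment_def prob_space)
  then have "AE \<omega> in M. 1 - X 0 \<omega> = 0"
    using integrable_X_pow[of 0 1]
    by (subst (asm) integral_nonneg_eq_0_iff_AE) auto
  then have "prob {\<omega> \<in> space M. X 0 \<omega> = 1} = 1"
    by (subst prob_Collect_eq_1) auto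
  then show False using prob_less_1 by simp
qed

text \<open>Chebyshev's association inequality: \<open>(X\<^sup>l - c\<^sup>l) (X\<^sup>m - c\<^sup>m) \<ge> 0\<close> with
  \<open>c\<^sup>l = moment l\<close>.\<close>

lemma moment_add: "moment l * moment m \<le> moment (l + m)"
proof (cases "l = 0")
  case False
  define c where "c = root l (moment l)"
  have c: "c \<ge> 0" "c ^ l = moment l"
    using False moment_nonneg by (auto simp: c_def)
  have "0 \<le> (X 0 \<omega> ^ l - c ^ l) * (X 0 \<omega> ^ m - c ^ m)" for \<omega>
  proof (cases "X 0 \<omega> \<le> c")
    case True
    then show ?thesis by (intro mult_nonpos_nonpos) (auto intro: power_mono)
  next
    case False
    then show ?thesis using c(1) by (intro mult_nonneg_nonneg) (auto intro: power_mono)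
  qed
  then have "0 \<le> expectation (\<lambda>\<omega>. (X 0 \<omega> ^ l - c ^ l) * (X 0 \<omega> ^ m - c ^ m))"
    by (intro integral_nonneg_AE) auto
  also have "\<dots> = expectation (\<lambda>\<omega>. X 0 \<omega> ^ (l + m) - c ^ m * X 0 \<omega> ^ l
      - c ^ l * X 0 \<omega> ^ m + c ^ l * c ^ m)"
    by (simp add: algebra_simps power_add)
  also have "\<dots> = moment (l + m) - c ^ m * moment l - c ^ l * moment m + c ^ l * c ^ m"
    by (simp add: moment_def prob_space)
  finally show ?thesis using c by simp
qed simp

lemma path_mean_eq:
  assumes "finite S" "set xs \<subseteq> S"
  shows "path_mean xs = (\<Prod>z\<in>S. moment (count_list xs z))"
proof -
  have "path_mean xs = expectation (\<lambda>\<omega>. \<Prod>z\<in>S. X z \<omega> ^ count_list xs z)"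
    unfolding path_mean_def prod_list_eq_prod_count[OF assms] ..
  also have "\<dots> = (\<Prod>z\<in>S. expectation (\<lambda>\<omega>. X z \<omega> ^ count_list xs z))"
    using assms(1)
    by (intro indep_vars_lebesgue_integral indep_vars_compose2[OF indep_vars_subset[OF indep]]) auto
  also have "\<dots> = (\<Prod>z\<in>S. moment (count_list xs z))"
    unfolding moment_def by (intro prod.cong refl distr_integral_X) auto
  finally show ?thesis .
qed

lemma path_mean_nonneg: "0 \<le> path_mean xs"
  by (subst path_mean_eq[of "set xs"]) (auto intro: prod_nonneg moment_nonneg)

text \<open>A site visited by both pieces contributes \<open>moment (l + m)\<close> instead of
  \<open>moment l * moment m\<close>, so \<open>moment_add\<close> applies site by site: overlaps
  can only help.\<close>

lemma path_mean_append: "path_mean xs * path_mean ys \<le> path_mean (xs @ ys)"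
proof -
  let ?S = "set xs \<union> set ys"
  have "path_mean xs * path_mean ys
      = (\<Prod>z\<in>?S. moment (count_list xs z) * moment (count_list ys z))"
    by (subst (1 2) path_mean_eq[of ?S]) (auto simp: prod.distrib)
  also have "\<dots> \<le> (\<Prod>z\<in>?S. moment (count_list (xs @ ys) z))"
    by (intro prod_mono) (auto intro: moment_add moment_nonneg mult_nonneg_nonneg)
  also have "\<dots> = path_mean (xs @ ys)"
    by (subst path_mean_eq[of ?S]) auto
  finally show ?thesis .
qed

lemma path_mean_translate: "path_mean (map ((+) a) xs) = path_mean xs"
proof -
  have "path_mean (map ((+) a) xs) = (\<Prod>z\<in>(+) a ` set xs. moment (count_list (map ((+) a) xs) z))"
    by (subst path_mean_eq[of "(+) a ` set xs"]) auto
  also have "\<dots> = (\<Prod>z\<in>set xs. moment (count_list (map ((+) a) xs) (a + z)))"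
    by (subst prod.reindex) auto
  also have "\<dots> = (\<Prod>z\<in>set xs. moment (count_list xs z))"
    by (intro prod.cong refl arg_cong[of _ _ moment] count_list_inj_map) auto
  also have "\<dots> = path_mean xs" by (subst path_mean_eq[of "set xs"]) auto
  finally show ?thesis .
qed

text \<open>Each visited site is charged for one visit only, as the higher moments are at most
  \<open>moment 1\<close>.\<close>

lemma path_mean_le: "path_mean xs \<le> moment 1 ^ card (set xs)"
proof -
  have "path_mean xs = (\<Prod>z\<in>set xs. moment (count_list xs z))"
    by (rule path_mean_eq) auto
  also have "\<dots> \<le> (\<Prod>z\<in>set xs. moment 1)"
    by (intro prod_mono) (auto intro!: moment_nonneg moment_antimono simp: Suc_le_eq count_list_0_iff
        neq0_conv[symmetric] simp del: neq0_conv)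
  finally show ?thesis by simp
qed

text \<open>Association, applied to one departure at a time.\<close>

lemma path_mean_ge: "moment 1 ^ length xs \<le> path_mean xs"
proof (induction xs)
  case (Cons z xs)
  have "path_mean [z] = moment 1" by (subst path_mean_eq[of "{z}"]) auto
  then have "moment 1 ^ length (z # xs) \<le> path_mean [z] * path_mean xs"
    using Cons moment_1_pos by simp
  also have "\<dots> \<le> path_mean (z # xs)" using path_mean_append[of "[z]" xs] by simp
  finally show ?case .
qed (simp add: path_mean_def prob_space)

lemma nn_integral_path: "(\<integral>\<^sup>+\<omega>. ennreal (\<Prod>z\<leftarrow>xs. X z \<omega>) \<partial>M) = ennreal (path_mean xs)"
proof -
  have *: "(\<Prod>z\<leftarrow>xs. X z \<omega>) \<ge> 0 \<and> (\<Prod>z\<leftarrow>xs. X z \<omega>) \<le> 1" for \<omega>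
    by (induction xs) (auto intro: mult_le_one)
  have [measurable]: "(\<lambda>\<omega>. \<Prod>z\<leftarrow>xs. X z \<omega>) \<in> borel_measurable M"
    by (induction xs) auto
  show ?thesis
    unfolding path_mean_def using *
    by (intro nn_integral_eq_integral integrable_const_bound[of _ 1]) auto
qed

definition path_coeff :: "(int ^ 'd) set \<Rightarrow> int ^ 'd \<Rightarrow> int ^ 'd \<Rightarrow> (int ^ 'd) list \<Rightarrow> real" where
  "path_coeff A x w s = (if set s \<subseteq> nbr \<and> set (trail x s) \<subseteq> A \<and> x + sum_list s = w
     then (1 / deg) ^ length s else 0)"

lemma path_coeff_nonneg: "0 \<le> path_coeff A x w s"
  using deg_pos by (simp add: path_coeff_def)

lemma green_ker_paths:
  assumes "\<And>z. 0 \<le> \<phi> z"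
  shows "green (ker A \<phi>) x w
    = (\<integral>\<^sup>+s. ennreal (path_coeff A x w s) * ennreal (\<Prod>z\<leftarrow>trail x s. \<phi> z) \<partial>count_space UNIV)"
proof -
  have "0 \<le> (\<Prod>z\<leftarrow>xs. \<phi> z)" for xs using assms by (induction xs) auto
  then show ?thesis
    unfolding green_eq_paths prod_list_ker[OF assms] deg_def[symmetric]
    using deg_pos
    by (intro nn_integral_cong)
       (auto simp: path_coeff_def ennreal_mult[symmetric] indicator_def power_one_over field_simps)
qed

lemma G_paths: "G A x w \<omega>
    = (\<integral>\<^sup>+s. ennreal (path_coeff A x w s) * ennreal (\<Prod>z\<leftarrow>trail x s. X z \<omega>) \<partial>count_space UNIV)"
  unfolding G_def by (rule green_ker_paths) auto

lemma measurable_path [measurable]: "(\<lambda>\<omega>. \<Prod>z\<leftarrow>xs. X z \<omega>) \<in> borel_measurable M"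
  by (induction xs) auto

lemma nn_integral_swap:
  fixes f :: "'c::countable \<Rightarrow> 'w \<Rightarrow> ennreal"
  assumes [measurable]: "\<And>s. f s \<in> borel_measurable M"
  shows "(\<integral>\<^sup>+\<omega>. (\<integral>\<^sup>+s. f s \<omega> \<partial>count_space UNIV) \<partial>M) = (\<integral>\<^sup>+s. (\<integral>\<^sup>+\<omega>. f s \<omega> \<partial>M) \<partial>count_space UNIV)"
proof -
  interpret C: sigma_finite_measure "count_space (UNIV :: 'c set)"
    by (rule sigma_finite_measure_count_space)
  interpret pair_sigma_finite "count_space (UNIV :: 'c set)" M ..
  have "(\<lambda>(s, \<omega>). f s \<omega>) \<in> borel_measurable (count_space UNIV \<Otimes>\<^sub>M M)"
    by (rule measurable_pair_measure_countable1) auto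
  then show ?thesis by (rule Fubini')
qed

lemma EG_paths:
  "EG A x w = (\<integral>\<^sup>+s. ennreal (path_coeff A x w s) * ennreal (path_mean (trail x s)) \<partial>count_space UNIV)"
  unfolding EG_def G_paths
  by (subst nn_integral_swap) (auto simp: nn_integral_cmult nn_integral_path)

text \<open>Both Green functions are sums of monomials in the site weights with nonnegative
  coefficients, so the association of monomials in \<open>path_mean_append\<close> carries over by
  Tonelli.\<close>

lemma EG_association: "EG A x w * EG A' x' w' \<le> (\<integral>\<^sup>+\<omega>. G A x w \<omega> * G A' x' w' \<omega> \<partial>M)"
proof -
  let ?c = "\<lambda>s. ennreal (path_coeff A x w s)" and ?c' = "\<lambda>s. ennreal (path_coeff A' x' w' s)"
  have "EG A x w * EG A' x' w' = (\<integral>\<^sup>+s. \<integral>\<^sup>+s'. (?c s * ennreal (path_mean (trail x s)))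
        * (?c' s' * ennreal (path_mean (trail x' s'))) \<partial>count_space UNIV \<partial>count_space UNIV)"
    unfolding EG_paths by (simp add: nn_integral_cmult nn_integral_multc)
  also have "\<dots> \<le> (\<integral>\<^sup>+s. \<integral>\<^sup>+s'. ?c s * ?c' s' * ennreal (path_mean (trail x s @ trail x' s'))
       \<partial>count_space UNIV \<partial>count_space UNIV)"
  proof (intro nn_integral_mono)
    fix s s'
    have "(?c s * ennreal (path_mean (trail x s))) * (?c' s' * ennreal (path_mean (trail x' s')))
        = ?c s * ?c' s' * ennreal (path_mean (trail x s) * path_mean (trail x' s'))"
      by (simp add: ennreal_mult path_mean_nonneg mult_ac)
    also have "\<dots> \<le> ?c s * ?c' s' * ennreal (path_mean (trail x s @ trail x' s'))"
      by (intro mult_left_mono ennreal_leI path_mean_append) auto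
    finally show "(?c s * ennreal (path_mean (trail x s))) * (?c' s' * ennreal (path_mean (trail x' s')))
       \<le> ?c s * ?c' s' * ennreal (path_mean (trail x s @ trail x' s'))" .
  qed
  also have "\<dots> = (\<integral>\<^sup>+s. \<integral>\<^sup>+s'. \<integral>\<^sup>+\<omega>. (?c s * ennreal (\<Prod>z\<leftarrow>trail x s. X z \<omega>))
        * (?c' s' * ennreal (\<Prod>z\<leftarrow>trail x' s'. X z \<omega>)) \<partial>M \<partial>count_space UNIV \<partial>count_space UNIV)"
  proof (intro nn_integral_cong)
    fix s s'
    have *: "(\<Prod>z\<leftarrow>xs. X z \<omega>) \<ge> 0" for xs \<omega> by (induction xs) auto
    have "(\<integral>\<^sup>+\<omega>. (?c s * ennreal (\<Prod>z\<leftarrow>trail x s. X z \<omega>))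
        * (?c' s' * ennreal (\<Prod>z\<leftarrow>trail x' s'. X z \<omega>)) \<partial>M)
        = (\<integral>\<^sup>+\<omega>. ?c s * ?c' s' * ennreal (\<Prod>z\<leftarrow>trail x s @ trail x' s'. X z \<omega>) \<partial>M)"
      using * by (intro nn_integral_cong) (simp add: ennreal_mult mult_ac)
    then show "?c s * ?c' s' * ennreal (path_mean (trail x s @ trail x' s'))
        = (\<integral>\<^sup>+\<omega>. (?c s * ennreal (\<Prod>z\<leftarrow>trail x s. X z \<omega>))
        * (?c' s' * ennreal (\<Prod>z\<leftarrow>trail x' s'. X z \<omega>)) \<partial>M)"
      by (simp only: nn_integral_path[symmetric]) (subst nn_integral_cmult, auto)
  qed
  also have "\<dots> = (\<integral>\<^sup>+s. \<integral>\<^sup>+\<omega>. \<integral>\<^sup>+s'. (?c s * ennreal (\<Prod>z\<leftarrow>trail x s. X z \<omega>))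
        * (?c' s' * ennreal (\<Prod>z\<leftarrow>trail x' s'. X z \<omega>)) \<partial>count_space UNIV \<partial>M \<partial>count_space UNIV)"
    by (subst nn_integral_swap) auto
  also have "\<dots> = (\<integral>\<^sup>+s. \<integral>\<^sup>+\<omega>. ?c s * ennreal (\<Prod>z\<leftarrow>trail x s. X z \<omega>) * G A' x' w' \<omega> \<partial>M \<partial>count_space UNIV)"
    unfolding G_paths by (subst nn_integral_cmult) auto
  also have "\<dots> = (\<integral>\<^sup>+\<omega>. \<integral>\<^sup>+s. ?c s * ennreal (\<Prod>z\<leftarrow>trail x s. X z \<omega>) * G A' x' w' \<omega> \<partial>count_space UNIV \<partial>M)"
    by (subst nn_integral_swap) auto
  also have "\<dots> = (\<integral>\<^sup>+\<omega>. G A x w \<omega> * G A' x' w' \<omega> \<partial>M)"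
    unfolding G_paths[of A x w] by (subst nn_integral_multc) auto
  finally show ?thesis .
qed

lemma EG_translate: "EG ((+) a ` A) (a + x) (a + w) = EG A x w"
proof -
  have "path_coeff ((+) a ` A) (a + x) (a + w) s = path_coeff A x w s" for s
    by (auto simp: path_coeff_def trail_translate add.assoc)
  then show ?thesis
    unfolding EG_paths by (simp add: trail_translate path_mean_translate)
qed

text \<open>The paths to \<open>x\<close> and from \<open>x\<close> may share sites. Association
  replaces independence, and \<open>hitting_concat\<close> glues the pieces in each
  environment.\<close>

lemma Z_supermult: "Z x * Z y \<le> Z (x + y)"
proof -
  have "(+) x ` (-{y}) = -{x + y}"
    by (simp add: bij_image_Compl_eq bij_plus)
  then have "Z x * Z y = EG (-{x}) 0 x * EG (-{x + y}) x (x + y)"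
    using EG_translate[of x "-{y}" 0 y] by (simp add: Z_def)
  also have "\<dots> \<le> (\<integral>\<^sup>+\<omega>. G (-{x}) 0 x \<omega> * G (-{x + y}) x (x + y) \<omega> \<partial>M)"
    by (rule EG_association)
  also have "\<dots> \<le> Z (x + y)"
    unfolding Z_def EG_def G_def by (intro nn_integral_mono hitting_concat) auto
  finally show ?thesis .
qed

lemma Z_0 [simp]: "Z 0 = 1"
  by (simp add: Z_def EG_def G_def green_killed ker_def emeasure_space_1)

lemma Z_le_1: "Z y \<le> 1"
proof -
  have "Z y \<le> (\<integral>\<^sup>+\<omega>. 1 \<partial>M)"
    unfolding Z_def EG_def by (intro nn_integral_mono G_le_1) auto
  then show ?thesis by (simp add: emeasure_space_1)
qed

lemma nn_integral_X: "(\<integral>\<^sup>+\<omega>. ennreal (X z \<omega>) \<partial>M) = ennreal (moment 1)"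
  using nn_integral_path[of "[z]"] path_mean_eq[of "{z}" "[z]"] by simp

lemma Z_nbr: "e \<in> nbr \<Longrightarrow> ennreal (moment 1 / deg) \<le> Z e"
proof -
  assume e: "e \<in> nbr"
  have "ennreal (X 0 \<omega> / deg) \<le> G (-{e}) 0 e \<omega>" for \<omega>
    using green_step[OF e, of "ker (-{e}) (\<lambda>z. X z \<omega>)" 0 e] nbr_nonzero[OF e]
    by (simp add: G_def green_killed[of _ e] ker_def deg_def)
  then have "(\<integral>\<^sup>+\<omega>. ennreal (X 0 \<omega> / deg) \<partial>M) \<le> Z e"
    unfolding Z_def EG_def by (intro nn_integral_mono)
  moreover have "(\<integral>\<^sup>+\<omega>. ennreal (X 0 \<omega> / deg) \<partial>M) = ennreal (moment 1 / deg)"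
    using deg_pos nn_integral_X[of 0] moment_1_pos
    by (simp add: divide_ennreal[symmetric] nn_integral_divide)
  ultimately show ?thesis by simp
qed

lemma Z_ge: "ennreal ((moment 1 / deg) ^ l1 y) \<le> Z y"
proof (induction "l1 y" arbitrary: y)
  case (Suc n)
  then have "y \<noteq> 0" by auto
  then obtain e where e: "e \<in> nbr" "l1 y = Suc (l1 (y + e))" by (rule l1_step_down)
  have "ennreal ((moment 1 / deg) ^ l1 y) = ennreal (moment 1 / deg) * ennreal ((moment 1 / deg) ^ l1 (y + e))"
    using e moment_1_pos deg_pos by (simp add: ennreal_mult[symmetric])
  also have "\<dots> \<le> Z (- e) * Z (y + e)"
    using e Suc by (intro mult_mono Z_nbr uminus_nbr Suc(1)) auto
  also have "\<dots> \<le> Z y" using Z_supermult[of "-e" "y + e"] by simp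
  finally show ?case .
qed simp

lemma Z_pos: "0 < Z y"
  using Z_ge[of y] moment_1_pos deg_pos
  by (metis divide_pos_pos ennreal_less_zero_iff order_less_le_trans zero_less_power)

section \<open>The range of the path\<close>

text \<open>The weight of the paths to \<open>y\<close> through \<open>z\<close>, factorised at the first visit to \<open>z\<close>.\<close>

definition visit :: "int ^ 'd \<Rightarrow> int ^ 'd \<Rightarrow> 'w \<Rightarrow> ennreal" where
  "visit y z \<omega> = G (-{y} - {z}) 0 z \<omega> * G (-{y}) z y \<omega>"

lemma measurable_visit [measurable]: "visit y z \<in> borel_measurable M"
  unfolding visit_def[abs_def] by measurable

text \<open>Cancel the paths that avoid \<open>z\<close> on both sides of
  \<open>green_avoid_or_hit\<close>; the cancellation is legitimate because their total weight is at
  most 1.\<close>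

lemma visit_le_paths:
  assumes "z \<noteq> y"
  shows "visit y z \<omega> \<le> (\<integral>\<^sup>+s. ennreal (path_coeff (-{y}) 0 y s) * ennreal (\<Prod>z\<leftarrow>trail 0 s. X z \<omega>)
     * indicator (set (trail 0 s)) z \<partial>count_space UNIV)" (is "_ \<le> ?R")
proof -
  let ?c = "\<lambda>s. ennreal (path_coeff (-{y}) 0 y s) * ennreal (\<Prod>z\<leftarrow>trail 0 s. X z \<omega>)"
  have "G (-{y} - {z}) 0 y \<omega> + visit y z \<omega> \<le> G (-{y}) 0 y \<omega>"
    using green_avoid_or_hit[OF assms, of "ker (-{y}) (\<lambda>z. X z \<omega>)" 0]
    by (simp add: G_def visit_def kill_ker)
  also have "G (-{y}) 0 y \<omega> = (\<integral>\<^sup>+s. ?c s * indicator (- set (trail 0 s)) z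
       + ?c s * indicator (set (trail 0 s)) z \<partial>count_space UNIV)"
    unfolding G_paths by (intro nn_integral_cong) (auto simp: indicator_def)
  also have "\<dots> = (\<integral>\<^sup>+s. ?c s * indicator (- set (trail 0 s)) z \<partial>count_space UNIV) + ?R"
    by (rule nn_integral_add) auto
  also have "(\<integral>\<^sup>+s. ?c s * indicator (- set (trail 0 s)) z \<partial>count_space UNIV) = G (-{y} - {z}) 0 y \<omega>"
    unfolding G_paths by (intro nn_integral_cong) (auto simp: path_coeff_def indicator_def)
  finally have "G (-{y} - {z}) 0 y \<omega> + visit y z \<omega> \<le> G (-{y} - {z}) 0 y \<omega> + ?R" .
  moreover have "G (-{y} - {z}) 0 y \<omega> \<noteq> \<infinity>"
    using G_le_1[of y "-{y} - {z}" 0 \<omega>] by (auto simp: top_unique)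
  ultimately show ?thesis by (simp add: ennreal_add_left_cancel_le)
qed

text \<open>Summed over \<open>z\<close>, the indicators of the visited sites add up to the size of
  the range.\<close>

lemma mean_range_le_paths:
  "(\<integral>\<^sup>+z. (\<integral>\<^sup>+\<omega>. visit y z \<omega> \<partial>M) * indicator (-{y}) z \<partial>count_space UNIV)
    \<le> (\<integral>\<^sup>+s. ennreal (path_coeff (-{y}) 0 y s) * ennreal (path_mean (trail 0 s))
        * of_nat (card (set (trail 0 s))) \<partial>count_space UNIV)"
proof -
  let ?c = "\<lambda>s. ennreal (path_coeff (-{y}) 0 y s)"
  let ?F = "\<lambda>z s. ?c s * ennreal (path_mean (trail 0 s)) * indicator (set (trail 0 s)) z"
  have "(\<integral>\<^sup>+z. (\<integral>\<^sup>+\<omega>. visit y z \<omega> \<partial>M) * indicator (-{y}) z \<partial>count_space UNIV)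
      \<le> (\<integral>\<^sup>+z. (\<integral>\<^sup>+\<omega>. \<integral>\<^sup>+s. ?c s * ennreal (\<Prod>z\<leftarrow>trail 0 s. X z \<omega>) * indicator (set (trail 0 s)) z
          \<partial>count_space UNIV \<partial>M) \<partial>count_space UNIV)"
    by (intro nn_integral_mono) (auto simp: indicator_def[of "-{y}"] intro!: nn_integral_mono visit_le_paths)
  also have "\<dots> = (\<integral>\<^sup>+z. \<integral>\<^sup>+s. ?F z s \<partial>count_space UNIV \<partial>count_space UNIV)"
    by (subst nn_integral_swap) (auto simp: nn_integral_cmult nn_integral_multc nn_integral_path)
  also have "\<dots> = (\<integral>\<^sup>+s. \<integral>\<^sup>+z. ?F z s \<partial>count_space UNIV \<partial>count_space UNIV)"
    using nn_integral_fst_count_space[of "\<lambda>(z, s). ?F z s"]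
      nn_integral_snd_count_space[of "\<lambda>(z, s). ?F z s"]
    by (simp only: prod.case)
  also have "\<dots> = (\<integral>\<^sup>+s. ?c s * ennreal (path_mean (trail 0 s)) * of_nat (card (set (trail 0 s))) \<partial>count_space UNIV)"
    by (intro nn_integral_cong) (simp add: nn_integral_cmult)
  finally show ?thesis .
qed

text \<open>Every new site costs a factor \<open>moment 1 < 1\<close>, whereas \<open>Z y\<close> is at least exponential in \<open>l1 y\<close>.\<close>

lemma mean_range_bound:
  obtains K where "K \<ge> 0" "\<And>y. y \<noteq> 0 \<Longrightarrow>
    (\<integral>\<^sup>+z. (\<integral>\<^sup>+\<omega>. visit y z \<omega> \<partial>M) * indicator (-{y}) z \<partial>count_space UNIV)
      \<le> ennreal (K * real (l1 y)) * Z y"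
proof
  define f where "f = moment 1"
  define b where "b = f / deg"
  \<comment> \<open>\<open>a\<close> is the rate paid per new site, \<open>c\<close> an upper bound
    for the decay rate of \<open>Z\<close> per unit of distance.\<close>
  define a where "a = ln (1 / f)"
  define c where "c = - ln b"
  have f: "0 < f" "f < 1" using moment_1_pos moment_1_less_1 by (auto simp: f_def)
  have b: "0 < b" "b < 1" using f deg_ge_1 by (auto simp: b_def divide_simps)
  have a: "a > 0" using f by (simp add: a_def)
  have c: "c > 0" using b by (simp add: c_def)
  show "(c + 1) / a \<ge> 0" using a c by simp
  fix y :: "int ^ 'd"
  assume "y \<noteq> 0"
  then have y: "l1 y \<ge> 1" by (metis l1_eq_0_iff less_one not_less)
  let ?c = "\<lambda>s. path_coeff (-{y}) 0 y s"
  \<comment> \<open>From \<open>t <= exp t\<close> at \<open>t = R * a - c * l1 y\<close>: the part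
    of the range beyond \<open>c * l1 y / a\<close> is paid for by \<open>b ^ l1 y\<close>, which is
    at most \<open>Z y\<close>.\<close>
  have le: "real R * p \<le> c * l1 y / a * p + b ^ l1 y / a" if p: "0 \<le> p" "p \<le> f ^ R" for R p
  proof -
    have "real R * a - c * l1 y \<le> exp (real R * a - c * l1 y)"
      using exp_ge_add_one_self[of "real R * a - c * l1 y"] by linarith
    also have "\<dots> = exp (real R * a) * exp (real (l1 y) * ln b)"
      by (simp add: c_def exp_add[symmetric] mult.commute)
    also have "\<dots> = (1 / f) ^ R * b ^ l1 y"
      using f b by (simp only: exp_of_nat_mult a_def exp_ln divide_pos_pos zero_less_one)
    finally have "(real R * a - c * l1 y) * p \<le> (1 / f) ^ R * b ^ l1 y * p"
      using p by (intro mult_right_mono)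
    also have "\<dots> \<le> (1 / f) ^ R * b ^ l1 y * f ^ R"
      using p f b by (intro mult_left_mono) auto
    also have "\<dots> = b ^ l1 y" using f by (simp add: power_one_over)
    finally show ?thesis using a by (simp add: field_simps)
  qed
  have "(\<integral>\<^sup>+z. (\<integral>\<^sup>+\<omega>. visit y z \<omega> \<partial>M) * indicator (-{y}) z \<partial>count_space UNIV)
    \<le> (\<integral>\<^sup>+s. ennreal (?c s) * ennreal (path_mean (trail 0 s))
        * of_nat (card (set (trail 0 s))) \<partial>count_space UNIV)"
    by (rule mean_range_le_paths)
  also have "\<dots> \<le> (\<integral>\<^sup>+s. ennreal (c * l1 y / a) * (ennreal (?c s) * ennreal (path_mean (trail 0 s)))
        + ennreal (b ^ l1 y / a) * ennreal (?c s) \<partial>count_space UNIV)"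
  proof (intro nn_integral_mono)
    fix s
    let ?p = "path_mean (trail 0 s)" and ?R = "card (set (trail 0 s))"
    have "?c s * (real ?R * ?p) \<le> ?c s * (c * l1 y / a * ?p + b ^ l1 y / a)"
      by (intro mult_left_mono le path_coeff_nonneg path_mean_nonneg)
         (use path_mean_le in \<open>auto simp: f_def\<close>)
    then have "ennreal (?c s * (real ?R * ?p)) \<le> ennreal (c * l1 y / a * (?c s * ?p) + b ^ l1 y / a * ?c s)"
      by (intro ennreal_leI) (simp add: algebra_simps)
    then show "ennreal (?c s) * ennreal ?p * of_nat ?R
        \<le> ennreal (c * l1 y / a) * (ennreal (?c s) * ennreal ?p) + ennreal (b ^ l1 y / a) * ennreal (?c s)"
      using a b c
      by (simp add: ennreal_mult[symmetric] ennreal_plus[symmetric] path_coeff_nonneg path_mean_nonneg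
          ennreal_of_nat_eq_real_of_nat mult_ac del: ennreal_plus)
  qed
  also have "\<dots> = ennreal (c * l1 y / a) * Z y
      + ennreal (b ^ l1 y / a) * (\<integral>\<^sup>+s. ennreal (?c s) \<partial>count_space UNIV)"
    unfolding Z_def EG_paths
    by (subst nn_integral_add) (simp_all add: nn_integral_cmult)
  \<comment> \<open>Without the site weights, the path coefficients add up to a hitting probability
    of the free walk.\<close>
  also have "(\<integral>\<^sup>+s. ennreal (?c s) \<partial>count_space UNIV) = green (ker (-{y}) (\<lambda>_. 1)) 0 y"
    by (subst green_ker_paths) (auto intro!: nn_integral_cong simp: map_replicate_const)
  also have "ennreal (c * l1 y / a) * Z y + ennreal (b ^ l1 y / a) * green (ker (-{y}) (\<lambda>_. 1)) 0 y
      \<le> ennreal (c * l1 y / a) * Z y + ennreal (1 / a) * Z y"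
  proof (intro add_left_mono)
    have "ennreal (b ^ l1 y / a) * green (ker (-{y}) (\<lambda>_. 1)) 0 y \<le> ennreal (b ^ l1 y / a) * 1"
      by (intro mult_left_mono green_ker_le_1) auto
    also have "\<dots> = ennreal (1 / a) * ennreal (b ^ l1 y)"
      using a b by (simp add: ennreal_mult[symmetric])
    also have "\<dots> \<le> ennreal (1 / a) * Z y"
      using Z_ge[of y] by (intro mult_left_mono) (auto simp: b_def f_def)
    finally show "ennreal (b ^ l1 y / a) * green (ker (-{y}) (\<lambda>_. 1)) 0 y \<le> ennreal (1 / a) * Z y" .
  qed
  also have "\<dots> = ennreal (c * l1 y / a + 1 / a) * Z y"
    using a c by (simp add: ennreal_plus distrib_right)
  also have "\<dots> \<le> ennreal ((c + 1) / a * l1 y) * Z y"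
    using a y by (intro mult_right_mono ennreal_leI) (auto simp: field_simps)
  finally show "(\<integral>\<^sup>+z. (\<integral>\<^sup>+\<omega>. visit y z \<omega> \<partial>M) * indicator (-{y}) z \<partial>count_space UNIV)
      \<le> ennreal ((c + 1) / a * real (l1 y)) * Z y" .
qed

end

section \<open>Green functions near an obstacle\<close>

text \<open>Strict subharmonicity of \<open>lam ^ (- l1 x)\<close> away from the origin, with gain
  \<open>eps\<close>. The type argument fixes the dimension.\<close>

definition radial_growth :: "'d::finite itself \<Rightarrow> real \<Rightarrow> real \<Rightarrow> bool" where
  "radial_growth _ lam eps \<longleftrightarrow> (\<forall>x :: int ^ 'd. x \<noteq> 0 \<longrightarrow>
     (1 + eps) * real (card (nbr :: (int ^ 'd) set)) * (1 / lam) ^ l1 x \<le> (\<Sum>e\<in>nbr. (1 / lam) ^ l1 (x + e)))"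

text \<open>A single neighbour closer to the origin already has \<open>lam\<close> times the value,
  and \<open>lam\<close> is twice the number of neighbours.\<close>

lemma radial_growth_general:
  "radial_growth TYPE('d::finite) (2 * real (card (nbr :: (int ^ 'd) set))) 1"
  unfolding radial_growth_def
proof (intro allI impI)
  fix x :: "int ^ 'd"
  let ?D = "real (card (nbr :: (int ^ 'd) set))"
  have D: "?D > 0" using card_nbr_pos by simp
  assume "x \<noteq> 0"
  then obtain e where e: "e \<in> nbr" "l1 x = Suc (l1 (x + e))" by (rule l1_step_down)
  have "(1 + 1) * ?D * (1 / (2 * ?D)) ^ l1 x = (1 / (2 * ?D)) ^ l1 (x + e)"
    using e D by simp
  also have "\<dots> \<le> (\<Sum>e\<in>nbr. (1 / (2 * ?D)) ^ l1 (x + e))"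
    using e(1) by (intro member_le_sum) auto
  finally show "(1 + 1) * ?D * (1 / (2 * ?D)) ^ l1 x \<le> (\<Sum>e\<in>nbr. (1 / (2 * ?D)) ^ l1 (x + e))" .
qed

text \<open>One neighbour is closer by 1, the other farther by at most 1, so the average gains the
  factor \<open>(lam + 1 / lam) / 2\<close>. The choice of \<open>lam\<close> is left open since in
  dimension 1 it has to be close to 1.\<close>

lemma radial_growth_one_dim:
  assumes card: "card (nbr :: (int ^ 'd::finite) set) = 2" and lam: "lam > 1"
  shows "radial_growth TYPE('d) lam ((lam + 1 / lam) / 2 - 1)"
  unfolding radial_growth_def
proof (intro allI impI)
  fix x :: "int ^ 'd"
  assume "x \<noteq> 0"
  then obtain e where e: "e \<in> nbr" "l1 x = Suc (l1 (x + e))" by (rule l1_step_down)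
  from card e(1) have "card (nbr - {e}) = 1" by simp
  then obtain f where f: "nbr - {e} = {f}" by (auto simp: card_1_singleton_iff)
  have "(1 / lam) ^ Suc (l1 x) \<le> (1 / lam) ^ l1 (x + f)"
    using lam f by (intro power_decreasing l1_step) auto
  moreover have "(\<Sum>e\<in>nbr. (1 / lam) ^ l1 (x + e)) = (1 / lam) ^ l1 (x + e) + (1 / lam) ^ l1 (x + f)"
    using e(1) f by (subst sum.remove[of _ e]) auto
  moreover have "(1 / lam) ^ l1 (x + e) = lam * (1 / lam) ^ l1 x"
    using e(2) lam by simp
  ultimately show "(1 + ((lam + 1 / lam) / 2 - 1)) * real (card (nbr :: (int ^ 'd) set)) * (1 / lam) ^ l1 x
      \<le> (\<Sum>e\<in>nbr. (1 / lam) ^ l1 (x + e))"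
    using card by (simp add: algebra_simps)
qed

text \<open>A supersolution of the form \<open>a - c \<cdot> lam ^ (- l1 (x - p))\<close>: the subtracted bump is subharmonic away
  from the obstacle \<open>p\<close>, and at \<open>p\<close> the killing compensates it.\<close>

lemma green_le_near_obstacle:
  fixes p :: "int ^ 'd::finite"
  assumes \<phi>: "\<And>x. 0 \<le> \<phi> x" "\<And>x. \<phi> x \<le> 1"
    and \<zeta>: "0 \<le> \<zeta>" "\<zeta> < 1" and p: "p \<notin> A \<or> \<phi> p \<le> \<zeta>"
    and lam: "lam \<ge> 1" and eps: "eps > 0" and growth: "radial_growth TYPE('d) lam eps"
  shows "green (ker A \<phi>) x w \<le> ennreal ((lam ^ l1 (w - p) / eps + 1) / (1 - \<zeta>))"
proof -
  let ?D = "real (card (nbr :: (int ^ 'd) set))"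
  have D: "?D > 0" using card_nbr_pos by simp
  define h where "h x = (1 / lam) ^ l1 (x - p)" for x
  \<comment> \<open>\<open>c\<close> is chosen so that the gain \<open>c * eps * h w\<close> pays
    for the unit source at \<open>w\<close>. With \<open>a - \<zeta> * a = c + 1\<close>, the
    killing at \<open>p\<close> pays for the missing bump \<open>c\<close> and for a source that may
    sit at \<open>p\<close> itself.\<close>
  define c where "c = lam ^ l1 (w - p) / eps"
  define a where "a = (c + 1) / (1 - \<zeta>)"
  define u where "u x = a - c * h x" for x
  have c: "c > 0" using lam eps by (simp add: c_def)
  have h: "0 \<le> h x" "h x \<le> 1" for x using lam by (auto simp: h_def power_le_one)
  have a: "a * (1 - \<zeta>) = c + 1" using \<zeta> by (simp add: a_def)
  have ac: "c + 1 \<le> a"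
    unfolding a_def using \<zeta> c by (simp add: pos_le_divide_eq algebra_simps)
  have u: "0 \<le> u x" "u x \<le> a" for x
  proof -
    have "c * h x \<le> c * 1" using h c by (intro mult_left_mono) auto
    then show "0 \<le> u x" using ac by (simp add: u_def)
    show "u x \<le> a" using h c by (simp add: u_def)
  qed
  have kstep_u: "kstep (ker A \<phi>) (\<lambda>x. ennreal (u x)) x
      = (if x \<in> A then ennreal (\<phi> x / ?D * (\<Sum>e\<in>nbr. u (x + e))) else 0)" for x
    using u \<phi>(1) D
    by (auto simp: kstep_def ker_def sum_ennreal ennreal_mult[symmetric] sum_nonneg intro!: divide_nonneg_nonneg)
  have "green (ker A \<phi>) x w \<le> ennreal (u x)"
  proof (rule green_least)
    fix x
    have ind: "indicator {w} x = ennreal (if x = w then 1 else 0)" by (simp add: indicator_def)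
    have avg: "(\<Sum>e\<in>nbr. u (x + e)) \<le> ?D * a"
      using sum_bounded_above[of nbr "\<lambda>e. u (x + e)" a] u by simp
    have "(if x = w then 1 else 0) + (if x \<in> A then \<phi> x / ?D * (\<Sum>e\<in>nbr. u (x + e)) else 0) \<le> u x"
    proof (cases "x = p")
      case True
      have "(if x \<in> A then \<phi> x / ?D * (\<Sum>e\<in>nbr. u (x + e)) else 0) \<le> \<zeta> * a"
      proof (cases "x \<in> A")
        case True
        then have "\<phi> x / ?D * (\<Sum>e\<in>nbr. u (x + e)) \<le> \<zeta> / ?D * (?D * a)"
          using p \<open>x = p\<close> D \<zeta> \<phi> by (intro mult_mono avg divide_right_mono sum_nonneg u) auto
        then show ?thesis using True D by simp
      next
        case False
        then show ?thesis using \<zeta> ac c by simp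
      qed
      moreover have "u x = a - c" using True by (simp add: u_def h_def)
      moreover have "a - \<zeta> * a = c + 1" using a by (simp add: algebra_simps)
      ultimately show ?thesis by (smt (verit))
    next
      case False
      have hs: "(1 + eps) * ?D * h x \<le> (\<Sum>e\<in>nbr. h (x + e))"
        using growth[unfolded radial_growth_def, rule_format, of "x - p"] False
        by (simp add: h_def algebra_simps)
      have "(\<Sum>e\<in>nbr. u (x + e)) = ?D * a - c * (\<Sum>e\<in>nbr. h (x + e))"
        by (simp add: u_def sum_subtractf sum_distrib_left)
      also have "\<dots> \<le> ?D * a - c * ((1 + eps) * ?D * h x)"
        using hs c by (intro diff_left_mono mult_left_mono) auto
      also have "\<dots> = ?D * (u x - c * eps * h x)" by (simp add: u_def algebra_simps)
      finally have s: "(\<Sum>e\<in>nbr. u (x + e)) / ?D \<le> u x - c * eps * h x"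
        using D by (simp add: field_simps)
      have "\<phi> x / ?D * (\<Sum>e\<in>nbr. u (x + e)) \<le> (\<Sum>e\<in>nbr. u (x + e)) / ?D"
        using \<phi>[of x] D u mult_right_mono[of "\<phi> x" 1 "\<Sum>e\<in>nbr. u (x + e)"]
        by (simp add: sum_nonneg divide_right_mono)
      moreover have "0 \<le> (\<Sum>e\<in>nbr. u (x + e)) / ?D" using u D by (simp add: sum_nonneg)
      ultimately have "(if x \<in> A then \<phi> x / ?D * (\<Sum>e\<in>nbr. u (x + e)) else 0) \<le> u x - c * eps * h x"
        using s by auto
      moreover have "(if x = w then 1 else 0) \<le> c * eps * h x"
        using lam eps c h by (auto simp: c_def h_def power_one_over)
      ultimately show ?thesis by linarith
    qed
    then show "indicator {w} x + kstep (ker A \<phi>) (\<lambda>x. ennreal (u x)) x \<le> ennreal (u x)"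
      unfolding kstep_u ind using u \<phi> D
      by (cases "x \<in> A") (simp_all add: ennreal_plus[symmetric] sum_nonneg ennreal_leI del: ennreal_plus)
  qed
  also have "\<dots> \<le> ennreal a" using u by (intro ennreal_leI)
  finally show ?thesis by (simp add: a_def c_def)
qed

text \<open>The ball is open: radius 0 gives the empty set, and a nearest obstacle at distance
  \<open>r\<close> lies just outside, so that the ball is free.\<close>

definition l1ball :: "int ^ 'd::finite \<Rightarrow> nat \<Rightarrow> (int ^ 'd) set" where
  "l1ball z r = {x. l1 (x - z) < r}"

lemma l1ball_translate: "l1ball z r = (+) z ` l1ball 0 r"
proof -
  have "x \<in> (+) z ` l1ball 0 r" if "x \<in> l1ball z r" for x
    using that by (intro image_eqI[of _ _ "x - z"]) (auto simp: l1ball_def)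
  then show ?thesis by (auto simp: l1ball_def)
qed

lemma l1ball_zero_subset: "l1ball 0 r \<subseteq> {x. \<forall>i. x $ i \<in> {- int r<..<int r}}"
proof
  fix x :: "int ^ 'd::finite"
  assume x: "x \<in> l1ball 0 r"
  have "x $ i \<in> {- int r<..<int r}" for i
  proof -
    have "nat \<bar>x $ i\<bar> \<le> l1 x"
      unfolding l1_def by (rule member_le_sum) auto
    also have "\<dots> < r" using x by (simp add: l1ball_def)
    finally show ?thesis by auto
  qed
  then show "x \<in> {x. \<forall>i. x $ i \<in> {- int r<..<int r}}" by simp
qed

lemma box_eq_image:
  "{x :: int ^ 'd::finite. \<forall>i. x $ i \<in> S} = vec_lambda ` (PiE UNIV (\<lambda>_. S))"
proof (intro equalityI subsetI)
  fix x :: "int ^ 'd"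
  assume "x \<in> {x. \<forall>i. x $ i \<in> S}"
  then show "x \<in> vec_lambda ` (PiE UNIV (\<lambda>_. S))"
    by (intro image_eqI[of _ _ "\<lambda>i. x $ i"]) auto
qed auto

lemma finite_l1ball [simp]: "finite (l1ball z r)"
proof -
  have "finite (l1ball (0 :: int ^ 'a) r)"
    by (rule finite_subset[OF l1ball_zero_subset]) (simp only: box_eq_image, intro finite_imageI finite_PiE, auto)
  then show ?thesis by (subst l1ball_translate) simp
qed

lemma card_l1ball: "card (l1ball (z :: int ^ 'd::finite) r) = card (l1ball (0 :: int ^ 'd) r)"
  by (subst l1ball_translate) (simp add: card_image)

lemma card_l1ball_le: "card (l1ball (z :: int ^ 'd::finite) r) \<le> (2 * r) ^ CARD('d)"
proof -
  have "card (l1ball z r) \<le> card {x :: int ^ 'd. \<forall>i. x $ i \<in> {- int r<..<int r}}"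
    unfolding card_l1ball[of z]
    by (rule card_mono[OF _ l1ball_zero_subset]) (simp only: box_eq_image, intro finite_imageI finite_PiE, auto)
  also have "\<dots> \<le> card (PiE (UNIV :: 'd set) (\<lambda>_. {- int r<..<int r}))"
    unfolding box_eq_image by (rule card_image_le) (simp add: finite_PiE)
  also have "\<dots> \<le> (2 * r) ^ CARD('d)"
  proof -
    have "card {- int r<..<int r} \<le> 2 * r" by simp
    then have "card {- int r<..<int r} ^ CARD('d) \<le> (2 * r) ^ CARD('d)" by (rule power_mono) simp
    then show ?thesis by (subst card_PiE) (simp_all del: card_greaterThanLessThan_int)
  qed
  finally show ?thesis .
qed

section \<open>Local surgery\<close>

context iid_weights
begin

lemma nn_integral_indicator_X:
  assumes [measurable]: "S \<in> sets borel"
  shows "(\<integral>\<^sup>+\<omega>. indicator S (X x \<omega>) \<partial>M) = ennreal (prob {\<omega> \<in> space M. X 0 \<omega> \<in> S})"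
proof -
  have "(\<integral>\<^sup>+\<omega>. indicator S (X x \<omega>) \<partial>M) = (\<integral>\<^sup>+\<omega>. indicator {\<omega> \<in> space M. X x \<omega> \<in> S} \<omega> \<partial>M)"
    by (intro nn_integral_cong) (auto simp: indicator_def)
  also have "\<dots> = ennreal (prob {\<omega> \<in> space M. X x \<omega> \<in> S})"
    by (subst nn_integral_indicator) (auto simp: emeasure_eq_measure)
  also have "prob {\<omega> \<in> space M. X x \<omega> \<in> S} = prob {\<omega> \<in> space M. X 0 \<omega> \<in> S}"
    by (rule prob_X) (rule assms)
  finally show ?thesis .
qed

lemma prob_all_greater:
  assumes "finite B"
  shows "(\<integral>\<^sup>+\<omega>. (\<Prod>x\<in>B. indicator {\<zeta><..} (X x \<omega>)) \<partial>M) = ennreal (prob {\<omega> \<in> space M. X 0 \<omega> > \<zeta>} ^ card B)"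
proof -
  have "(\<integral>\<^sup>+\<omega>. (\<Prod>x\<in>B. indicator {\<zeta><..} (X x \<omega>)) \<partial>M)
      = (\<Prod>x\<in>B. \<integral>\<^sup>+\<omega>. indicator {\<zeta><..} (X x \<omega>) \<partial>M)"
    using assms
    by (intro indep_vars_nn_integral indep_vars_compose2[OF indep_vars_subset[OF indep]]) auto
  then show ?thesis by (simp add: nn_integral_indicator_X ennreal_power)
qed

lemma measurable_outside:
  "(\<lambda>\<phi>. green (ker (-{y} - B) \<phi>) x w * green (ker (-{y} - B) \<phi>) x' w')
    \<in> borel_measurable (PiM (-B) (\<lambda>_. borel))"
  by (intro borel_measurable_times_ennreal measurable_green_PiM) auto

lemma outside_indep_inside:
  assumes "finite B" and H: "H \<in> borel_measurable (PiM B (\<lambda>_. borel))" "\<And>\<phi>. H (restrict \<phi> B) = H \<phi>"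
  shows "(\<integral>\<^sup>+\<omega>. (G (-{y} - B) x w \<omega> * G (-{y} - B) x' w' \<omega>) * H (\<lambda>z. X z \<omega>) \<partial>M)
    = (\<integral>\<^sup>+\<omega>. G (-{y} - B) x w \<omega> * G (-{y} - B) x' w' \<omega> \<partial>M) * (\<integral>\<^sup>+\<omega>. H (\<lambda>z. X z \<omega>) \<partial>M)"
proof -
  have sub: "-{y} - B \<subseteq> -B" by auto
  show ?thesis
    unfolding G_def
    by (rule independent_factors[of "-B" B "\<lambda>\<phi>. green (ker (-{y} - B) \<phi>) x w * green (ker (-{y} - B) \<phi>) x' w'" H])
       (use H measurable_outside in \<open>auto simp: green_restrict[OF sub]\<close>)
qed

lemma outside_free:
  assumes B: "finite B"
  shows "(\<integral>\<^sup>+\<omega>. (G (-{y} - B) x w \<omega> * G (-{y} - B) x' w' \<omega>) * (\<Prod>x\<in>B. indicator {\<zeta><..} (X x \<omega>)) \<partial>M)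
    = (\<integral>\<^sup>+\<omega>. G (-{y} - B) x w \<omega> * G (-{y} - B) x' w' \<omega> \<partial>M)
       * ennreal (prob {\<omega> \<in> space M. X 0 \<omega> > \<zeta>} ^ card B)"
proof -
  have "(\<integral>\<^sup>+\<omega>. (G (-{y} - B) x w \<omega> * G (-{y} - B) x' w' \<omega>)
        * (\<lambda>\<phi>. \<Prod>x\<in>B. indicator {\<zeta><..} (\<phi> x)) (\<lambda>z. X z \<omega>) \<partial>M)
    = (\<integral>\<^sup>+\<omega>. G (-{y} - B) x w \<omega> * G (-{y} - B) x' w' \<omega> \<partial>M)
       * (\<integral>\<^sup>+\<omega>. (\<lambda>\<phi>. \<Prod>x\<in>B. indicator {\<zeta><..} (\<phi> x)) (\<lambda>z. X z \<omega>) \<partial>M)"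
    by (rule outside_indep_inside[OF B]) auto
  then show ?thesis by (simp add: prob_all_greater[OF B])
qed

text \<open>The outer factors read the environment off \<open>B\<close> and the crossing reads it on
  \<open>B\<close>, so a crossing averaged in a fresh environment can be planted between them. The
  outcome is a path stopped at its first visit to \<open>a\<close>, followed by one from
  \<open>a\<close> to \<open>y\<close>.\<close>

lemma outside_crossing:
  assumes B: "finite B" and a: "a \<in> B" and c: "c \<notin> B" and y: "y \<notin> B"
  shows "(\<integral>\<^sup>+\<omega>. G (-{y} - B) 0 a \<omega> * G (-{y} - B) c y \<omega> \<partial>M) * EG B a c \<le> (\<integral>\<^sup>+\<omega>. visit y a \<omega> \<partial>M)"
proof -
  have "(\<integral>\<^sup>+\<omega>. G (-{y} - B) 0 a \<omega> * G (-{y} - B) c y \<omega> \<partial>M) * EG B a c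
      = (\<integral>\<^sup>+\<omega>. (G (-{y} - B) 0 a \<omega> * G (-{y} - B) c y \<omega>) * G B a c \<omega> \<partial>M)"
    unfolding EG_def
    using outside_indep_inside[OF B, of "\<lambda>\<phi>. green (ker B \<phi>) a c" y 0 a c y]
      measurable_green_PiM[of B B a c] green_restrict[of B B]
    by (simp add: G_def[abs_def])
  also have "\<dots> \<le> (\<integral>\<^sup>+\<omega>. visit y a \<omega> \<partial>M)"
  proof (intro nn_integral_mono)
    fix \<omega>
    have "G (-{y} - B) 0 a \<omega> * (G B a c \<omega> * G (-{y} - B) c y \<omega>)
        \<le> G (-{y} - {a}) 0 a \<omega> * (G B a c \<omega> * G (-{y}) c y \<omega>)"
      using a by (intro mult_mono G_mono) auto
    also have "\<dots> \<le> G (-{y} - {a}) 0 a \<omega> * G (-{y}) a y \<omega>"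
      using c y by (intro mult_left_mono G_concat) auto
    finally show "(G (-{y} - B) 0 a \<omega> * G (-{y} - B) c y \<omega>) * G B a c \<omega> \<le> visit y a \<omega>"
      by (simp add: visit_def mult_ac)
  qed
  finally show ?thesis .
qed

text \<open>Annealed weight of hitting \<open>y\<close> at time exactly \<open>n\<close>; divided by
  \<open>Z y\<close> it is the law of the hitting time.\<close>

definition time_term :: "int ^ 'd \<Rightarrow> nat \<Rightarrow> ennreal" where
  "time_term y n = (\<integral>\<^sup>+\<omega>. (kstep (ker (-{y}) (\<lambda>z. X z \<omega>)) ^^ n) (indicator {y}) 0 \<partial>M)"

lemma measurable_time_term [measurable]:
  "(\<lambda>\<omega>. (kstep (ker A (\<lambda>z. X z \<omega>)) ^^ n) g x) \<in> borel_measurable M"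
  by (intro measurable_kstep_pow measurable_ker)

lemma suminf_time_term: "(\<Sum>n. time_term y n) = Z y"
  unfolding time_term_def Z_def EG_def G_def green_def potential_def
  by (rule nn_integral_suminf[symmetric]) measurable

text \<open>The position chosen in \<open>time_potential_le\<close> becomes the site
  \<open>z\<close>; \<open>z = y\<close> drops out because no step starts at
  \<open>y\<close>.\<close>

lemma mean_time_le:
  "(\<Sum>n. of_nat n * time_term y n)
    \<le> (\<integral>\<^sup>+z. (\<integral>\<^sup>+\<omega>. G (-{y}) 0 z \<omega> * G (-{y}) z y \<omega> \<partial>M) * indicator (-{y}) z \<partial>count_space UNIV)"
proof -
  let ?k = "\<lambda>\<omega>. ker (-{y}) (\<lambda>z. X z \<omega>)"
  have "(\<Sum>n. of_nat n * time_term y n) = (\<Sum>n. \<integral>\<^sup>+\<omega>. of_nat n * (kstep (?k \<omega>) ^^ n) (indicator {y}) 0 \<partial>M)"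
    unfolding time_term_def by (subst nn_integral_cmult) auto
  also have "\<dots> = (\<integral>\<^sup>+\<omega>. (\<Sum>n. of_nat n * (kstep (?k \<omega>) ^^ n) (indicator {y}) 0) \<partial>M)"
    by (subst nn_integral_suminf) auto
  also have "\<dots> \<le> (\<integral>\<^sup>+\<omega>. (\<integral>\<^sup>+z. G (-{y}) 0 z \<omega> * G (-{y}) z y \<omega> * indicator (-{y}) z \<partial>count_space UNIV) \<partial>M)"
  proof (intro nn_integral_mono)
    fix \<omega>
    have "(\<Sum>n. of_nat n * (kstep (?k \<omega>) ^^ n) (indicator {y}) 0)
        \<le> potential (?k \<omega>) (kstep (?k \<omega>) (potential (?k \<omega>) (indicator {y}))) 0"
      by (rule time_potential_le)
    also have "\<dots> = (\<integral>\<^sup>+z. green (?k \<omega>) 0 z * kstep (?k \<omega>) (\<lambda>x. green (?k \<omega>) x y) z \<partial>count_space UNIV)"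
      by (subst potential_eq_sum_green) (simp add: green_def[abs_def])
    also have "\<dots> \<le> (\<integral>\<^sup>+z. G (-{y}) 0 z \<omega> * G (-{y}) z y \<omega> * indicator (-{y}) z \<partial>count_space UNIV)"
    proof (intro nn_integral_mono)
      fix z
      have "kstep (?k \<omega>) (\<lambda>x. green (?k \<omega>) x y) z \<le> G (-{y}) z y \<omega> * indicator (-{y}) z"
      proof (cases "z = y")
        case True
        then show ?thesis by (simp add: kstep_def ker_def)
      next
        case False
        then show ?thesis by (simp add: G_def) (subst (2) green_unfold, simp)
      qed
      then show "green (?k \<omega>) 0 z * kstep (?k \<omega>) (\<lambda>x. green (?k \<omega>) x y) z
          \<le> G (-{y}) 0 z \<omega> * G (-{y}) z y \<omega> * indicator (-{y}) z"
        unfolding G_def[of _ 0] by (simp only: mult.assoc) (intro mult_left_mono, auto)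
    qed
    finally show "(\<Sum>n. of_nat n * (kstep (?k \<omega>) ^^ n) (indicator {y}) 0)
        \<le> (\<integral>\<^sup>+z. G (-{y}) 0 z \<omega> * G (-{y}) z y \<omega> * indicator (-{y}) z \<partial>count_space UNIV)" .
  qed
  also have "\<dots> = (\<integral>\<^sup>+z. (\<integral>\<^sup>+\<omega>. G (-{y}) 0 z \<omega> * G (-{y}) z y \<omega> \<partial>M) * indicator (-{y}) z \<partial>count_space UNIV)"
    by (subst nn_integral_swap) (auto simp: nn_integral_multc)
  finally show ?thesis .
qed

end

text \<open>Sites with \<open>X \<le> \<zeta>\<close> are obstacles. An \<open>l1\<close>-ball of radius \<open>r\<close> around \<open>z\<close> without obstacles
  has probability \<open>q ^ card (l1ball z r)\<close>, while replacing the part of the path between its first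
  entrance into and its last exit from that ball by a crossing inside costs at most \<open>1 / kappa r\<close>.\<close>

locale surgery = iid_weights M X for M :: "'w measure" and X :: "int ^ 'd::finite \<Rightarrow> 'w \<Rightarrow> real" +
  fixes \<zeta> lam eps :: real and kappa :: "nat \<Rightarrow> real"
  assumes \<zeta>: "0 \<le> \<zeta>" "\<zeta> < 1" and lam: "lam \<ge> 1" and eps: "eps > 0"
    and growth: "radial_growth TYPE('d) lam eps"
    and kappa_pos: "\<And>r. kappa r > 0"
    and crossing: "\<And>r z a c. l1 (a - z) < r \<Longrightarrow> l1 (c - z) = r \<Longrightarrow> ennreal (kappa r) \<le> EG (l1ball z r) a c"
begin

definition q :: real where "q = prob {\<omega> \<in> space M. X 0 \<omega> > \<zeta>}"

text \<open>The bound of \<open>green_le_near_obstacle\<close> at distance \<open>2 * r\<close>,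
  which covers a target inside a ball of radius \<open>r\<close> and an obstacle at distance
  \<open>r\<close> from its centre.\<close>

definition bound :: "nat \<Rightarrow> real" where "bound r = (lam ^ (2 * r) / eps + 1) / (1 - \<zeta>)"

lemma bound_nonneg: "0 \<le> bound r"
  using lam eps \<zeta> by (simp add: bound_def)

lemma G_le_bound:
  assumes "p = y \<or> X p \<omega> \<le> \<zeta>" "l1 (w - p) \<le> 2 * r"
  shows "G (-{y}) x w \<omega> \<le> ennreal (bound r)"
proof -
  have "G (-{y}) x w \<omega> \<le> ennreal ((lam ^ l1 (w - p) / eps + 1) / (1 - \<zeta>))"
    unfolding G_def using assms(1)
    by (intro green_le_near_obstacle \<zeta> lam eps growth) auto
  also have "\<dots> \<le> ennreal (bound r)"
    unfolding bound_def using lam eps \<zeta> assms(2)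
    by (intro ennreal_leI divide_right_mono add_right_mono power_increasing) auto
  finally show ?thesis .
qed

text \<open>Contribution of the sites \<open>z\<close> at distance \<open>r\<close> from the nearest
  obstacle. Only the free ball is recorded, not the obstacle at distance \<open>r\<close>: the
  indicators then depend on the environment in the ball alone and are independent of the outer Green
  functions. A ball containing \<open>y\<close> is not free, whence the value 0;
  \<open>r = 0\<close> is treated without surgery.\<close>

definition free_term :: "int ^ 'd \<Rightarrow> int ^ 'd \<Rightarrow> nat \<Rightarrow> 'w \<Rightarrow> ennreal" where
  "free_term y z r \<omega> = (if r = 0 \<or> y \<in> l1ball z r then 0 else
     (\<Sum>a\<in>l1ball z r. \<Sum>b\<in>l1ball z r. \<Sum>e\<in>nbr. ennreal (bound r ^ 2) *
       ((G (-{y} - l1ball z r) 0 a \<omega> * G (-{y} - l1ball z r) (b + e) y \<omega>)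
         * (\<Prod>x\<in>l1ball z r. indicator {\<zeta><..} (X x \<omega>)))))"

lemma measurable_free_term [measurable]: "free_term y z r \<in> borel_measurable M"
  unfolding free_term_def[abs_def] by measurable

text \<open>The visit to \<open>z\<close> is framed by the first entrance \<open>a\<close> into the
  ball and the last exit \<open>b\<close> from it. The Green functions from \<open>a\<close> to
  \<open>z\<close> and from \<open>z\<close> to \<open>b\<close> end within \<open>2 * r\<close> of
  the obstacle \<open>p\<close>, so each is at most \<open>bound r\<close>.\<close>

lemma free_termI:
  assumes r: "r > 0" and y: "y \<notin> l1ball z r" and free: "\<And>x. x \<in> l1ball z r \<Longrightarrow> X x \<omega> > \<zeta>"
    and p: "p = y \<or> X p \<omega> \<le> \<zeta>" "l1 (p - z) = r"
  shows "G (-{y}) 0 z \<omega> * G (-{y}) z y \<omega> \<le> free_term y z r \<omega>"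
proof -
  let ?B = "l1ball z r" and ?k = "ker (-{y}) (\<lambda>z. X z \<omega>)" and ?b = "ennreal (bound r)"
  have z: "z \<in> ?B" using r by (simp add: l1ball_def)
  have le: "G (-{y}) x w \<omega> \<le> ?b" if "w \<in> ?B" for x w
  proof (rule G_le_bound[OF p(1)])
    have "l1 (w - p) \<le> l1 (w - z) + l1 (z - p)" using l1_triangle[of "w - z" "z - p"] by simp
    then show "l1 (w - p) \<le> 2 * r"
      using that p(2) by (simp add: l1ball_def l1_minus_commute[of z p])
  qed
  have "G (-{y}) 0 z \<omega> \<le> (\<Sum>a\<in>?B. G (-{y} - ?B) 0 a \<omega> * G (-{y}) a z \<omega>)"
    using green_first_entrance[of ?B z ?k 0] z by (simp add: G_def kill_ker)
  also have "\<dots> \<le> (\<Sum>a\<in>?B. G (-{y} - ?B) 0 a \<omega> * ?b)"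
    using z by (intro sum_mono mult_left_mono le) auto
  finally have 1: "G (-{y}) 0 z \<omega> \<le> (\<Sum>a\<in>?B. G (-{y} - ?B) 0 a \<omega>) * ?b"
    by (simp add: sum_distrib_right)
  have k1: "?k b \<le> 1" for b
    using X_le_1[of b \<omega>] card_nbr_pos[where 'd = 'd]
    by (auto simp: ker_def simp del: X_le_1 intro!: ennreal_leI[of _ 1, simplified])
  have "G (-{y}) z y \<omega> \<le> (\<Sum>b\<in>?B. G (-{y}) z b \<omega> * kstep ?k (\<lambda>v. green (kill ?B ?k) v y) b)"
    unfolding G_def using z y by (intro green_last_exit) auto
  also have "\<dots> \<le> (\<Sum>b\<in>?B. ?b * (1 * (\<Sum>e\<in>nbr. G (-{y} - ?B) (b + e) y \<omega>)))"
    unfolding kstep_def G_def[of "-{y} - ?B"] kill_ker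
    by (intro sum_mono mult_mono le k1) auto
  finally have 2: "G (-{y}) z y \<omega> \<le> ?b * (\<Sum>b\<in>?B. \<Sum>e\<in>nbr. G (-{y} - ?B) (b + e) y \<omega>)"
    by (simp add: sum_distrib_left)
  have "G (-{y}) 0 z \<omega> * G (-{y}) z y \<omega>
      \<le> ((\<Sum>a\<in>?B. G (-{y} - ?B) 0 a \<omega>) * ?b) * (?b * (\<Sum>b\<in>?B. \<Sum>e\<in>nbr. G (-{y} - ?B) (b + e) y \<omega>))"
    by (intro mult_mono 1 2) auto
  also have "\<dots> = ennreal (bound r ^ 2) * ((\<Sum>a\<in>?B. G (-{y} - ?B) 0 a \<omega>)
       * (\<Sum>b\<in>?B. \<Sum>e\<in>nbr. G (-{y} - ?B) (b + e) y \<omega>))"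
    using bound_nonneg by (simp add: power2_eq_square ennreal_mult mult_ac)
  also have "\<dots> = (\<Sum>a\<in>?B. \<Sum>b\<in>?B. \<Sum>e\<in>nbr. ennreal (bound r ^ 2) *
       (G (-{y} - ?B) 0 a \<omega> * G (-{y} - ?B) (b + e) y \<omega>))"
    by (subst sum_product) (simp add: sum_distrib_left)
  also have "\<dots> = free_term y z r \<omega>"
  proof -
    have "(\<Prod>x\<in>?B. indicator {\<zeta><..} (X x \<omega>)) = (1 :: ennreal)"
      using free by (intro prod.neutral) auto
    then show ?thesis using r y by (simp add: free_term_def)
  qed
  finally show ?thesis .
qed

lemma green_product_le:
  assumes zy: "z \<noteq> y"
  shows "G (-{y}) 0 z \<omega> * G (-{y}) z y \<omega> \<le> ennreal (bound 0) * visit y z \<omega> + (\<Sum>r. free_term y z r \<omega>)"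
proof -
  let ?P = "\<lambda>r. \<exists>p. (p = y \<or> X p \<omega> \<le> \<zeta>) \<and> l1 (p - z) = r"
  define r where "r = (LEAST r. ?P r)"
  have "?P r" unfolding r_def by (rule LeastI[of ?P "l1 (y - z)"]) auto
  then obtain p where p: "p = y \<or> X p \<omega> \<le> \<zeta>" "l1 (p - z) = r" by auto
  have least: "p \<noteq> y \<and> \<zeta> < X p \<omega>" if "l1 (p - z) < r" for p
  proof (rule ccontr)
    assume "\<not> ?thesis"
    then have "?P (l1 (p - z))" by (intro exI[of _ p]) (auto simp: not_less)
    then have "r \<le> l1 (p - z)" unfolding r_def by (rule Least_le)
    then show False using that by simp
  qed
  show ?thesis
  proof (cases "r = 0")
    \<comment> \<open>Here \<open>z\<close> is an obstacle itself: the returns to \<open>z\<close>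
      cost at most \<open>bound 0\<close>, and what remains is \<open>visit y z\<close>.\<close>
    case True
    then have "p = z" using p by simp
    have "G (-{y}) 0 z \<omega> \<le> G (-{y} - {z}) 0 z \<omega> * G (-{y}) z z \<omega>"
      using green_first_entrance[of "{z}" z "ker (-{y}) (\<lambda>z. X z \<omega>)" 0]
      by (simp add: G_def kill_ker)
    also have "\<dots> \<le> G (-{y} - {z}) 0 z \<omega> * ennreal (bound 0)"
      using p \<open>p = z\<close> by (intro mult_left_mono G_le_bound[of z]) auto
    finally have "G (-{y}) 0 z \<omega> * G (-{y}) z y \<omega>
        \<le> (G (-{y} - {z}) 0 z \<omega> * ennreal (bound 0)) * G (-{y}) z y \<omega>"
      by (intro mult_right_mono) auto
    also have "\<dots> = ennreal (bound 0) * visit y z \<omega>" by (simp add: visit_def mult_ac)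
    finally show ?thesis by (rule order_trans) simp
  next
    case False
    have "G (-{y}) 0 z \<omega> * G (-{y}) z y \<omega> \<le> free_term y z r \<omega>"
      using False p least by (intro free_termI) (auto simp: l1ball_def)
    also have "\<dots> = (\<Sum>r\<in>{r}. free_term y z r \<omega>)" by simp
    also have "\<dots> \<le> (\<Sum>r. free_term y z r \<omega>)" by (rule sum_le_suminf) auto
    finally show ?thesis by (rule order_trans) simp
  qed
qed

text \<open>Two Green bounds, the probability of a free ball, the number of pairs
  \<open>(b, e)\<close> through which the ball can be left, and the price of a planted
  crossing.\<close>

definition cost :: "nat \<Rightarrow> real" where
  "cost r = bound r ^ 2 * q ^ card (l1ball (0 :: int ^ 'd) r) * real (card (l1ball (0 :: int ^ 'd) r)) * deg / kappa r"

lemma q_nonneg: "0 \<le> q"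
  by (simp add: q_def)

lemma cost_nonneg: "0 \<le> cost r"
  unfolding cost_def using kappa_pos[of r] deg_pos q_nonneg
  by (intro divide_nonneg_pos mult_nonneg_nonneg) auto

text \<open>A crossing from the entrance \<open>a\<close> to the exit site \<open>b + e\<close> is
  planted at the price \<open>1 / kappa r\<close>; by \<open>outside_crossing\<close> the outer
  factors then amount to at most \<open>visit y a\<close>.\<close>

lemma free_term_le:
  "(\<integral>\<^sup>+\<omega>. free_term y z r \<omega> \<partial>M)
    \<le> ennreal (cost r) * (\<Sum>a\<in>l1ball z r. (\<integral>\<^sup>+\<omega>. visit y a \<omega> \<partial>M) * indicator (-{y}) a)"
proof (cases "r = 0 \<or> y \<in> l1ball z r")
  case True
  then show ?thesis by (simp add: free_term_def)
next
  case False
  let ?B = "l1ball z r"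
  let ?H = "\<lambda>a b e. \<integral>\<^sup>+\<omega>. G (-{y} - ?B) 0 a \<omega> * G (-{y} - ?B) (b + e) y \<omega> \<partial>M"
  define Q where "Q = q ^ card (l1ball (0 :: int ^ 'd) r)"
  have const: "(\<Sum>a\<in>?B. \<Sum>b\<in>?B. \<Sum>e\<in>(nbr :: (int ^ 'd) set). c * f a)
      = (of_nat (card ?B) * of_nat (card (nbr :: (int ^ 'd) set)) * c) * (\<Sum>a\<in>?B. f a)" for c and f :: "int ^ 'd \<Rightarrow> ennreal"
    by (subst sum_distrib_left, intro sum.cong) (simp_all add: mult_ac)
  have "(\<integral>\<^sup>+\<omega>. free_term y z r \<omega> \<partial>M) = (\<Sum>a\<in>?B. \<Sum>b\<in>?B. \<Sum>e\<in>nbr. ennreal (bound r ^ 2) * (?H a b e * ennreal Q))"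
    using False
    by (simp add: free_term_def nn_integral_sum nn_integral_cmult outside_free q_def[symmetric]
        card_l1ball[of z] Q_def)
  also have "\<dots> \<le> (\<Sum>a\<in>?B. \<Sum>b\<in>?B. \<Sum>e\<in>(nbr :: (int ^ 'd) set).
      ennreal (bound r ^ 2 * Q / kappa r) * ((\<integral>\<^sup>+\<omega>. visit y a \<omega> \<partial>M) * indicator (-{y}) a))"
  proof (intro sum_mono)
    fix a b and e :: "int ^ 'd"
    assume a: "a \<in> ?B" and b: "b \<in> ?B" and e: "e \<in> nbr"
    have "ennreal (kappa r) * ?H a b e \<le> (\<integral>\<^sup>+\<omega>. visit y a \<omega> \<partial>M)"
    proof (cases "b + e \<in> ?B")
      \<comment> \<open>A step that stays in the ball is no exit: the outer Green function is killed
        there, and \<open>y\<close> lies outside.\<close>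
      case True
      then have "G (-{y} - ?B) (b + e) y \<omega> = 0" for \<omega>
        using False by (auto simp: G_def green_killed ker_def indicator_def)
      then show ?thesis by simp
    next
      case nB: False
      have "l1 (b + e - z) \<le> Suc (l1 (b - z))"
        using l1_step[OF e, of "b - z"] by (simp add: algebra_simps)
      then have "l1 (b + e - z) = r"
        using b nB by (auto simp: l1ball_def)
      then have "ennreal (kappa r) \<le> EG ?B a (b + e)"
        using a by (intro crossing) (auto simp: l1ball_def)
      then have "ennreal (kappa r) * ?H a b e \<le> ?H a b e * EG ?B a (b + e)"
        by (subst mult.commute) (rule mult_left_mono, auto)
      also have "\<dots> \<le> (\<integral>\<^sup>+\<omega>. visit y a \<omega> \<partial>M)"
        using a nB False by (intro outside_crossing) auto
      finally show ?thesis .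
    qed
    then have "ennreal (1 / kappa r) * (ennreal (kappa r) * ?H a b e) \<le> ennreal (1 / kappa r) * (\<integral>\<^sup>+\<omega>. visit y a \<omega> \<partial>M)"
      by (intro mult_left_mono) auto
    then have "?H a b e \<le> ennreal (1 / kappa r) * (\<integral>\<^sup>+\<omega>. visit y a \<omega> \<partial>M)"
      using kappa_pos[of r] by (simp add: mult.assoc[symmetric] ennreal_mult[symmetric])
    then have "ennreal (bound r ^ 2) * (?H a b e * ennreal Q)
        \<le> ennreal (bound r ^ 2) * ((ennreal (1 / kappa r) * (\<integral>\<^sup>+\<omega>. visit y a \<omega> \<partial>M)) * ennreal Q)"
      by (intro mult_left_mono mult_right_mono) auto
    also have "\<dots> = (ennreal (bound r ^ 2) * ennreal (1 / kappa r) * ennreal Q) * (\<integral>\<^sup>+\<omega>. visit y a \<omega> \<partial>M)"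
      by (simp only: mult_ac)
    also have "ennreal (bound r ^ 2) * ennreal (1 / kappa r) * ennreal Q = ennreal (bound r ^ 2 * Q / kappa r)"
      using kappa_pos[of r] q_nonneg by (simp add: ennreal_mult[symmetric] Q_def)
    also have "ennreal (bound r ^ 2 * Q / kappa r) * (\<integral>\<^sup>+\<omega>. visit y a \<omega> \<partial>M)
        = ennreal (bound r ^ 2 * Q / kappa r) * ((\<integral>\<^sup>+\<omega>. visit y a \<omega> \<partial>M) * indicator (-{y}) a)"
      using a False by (auto simp: indicator_def)
    finally show "ennreal (bound r ^ 2) * (?H a b e * ennreal Q)
        \<le> ennreal (bound r ^ 2 * Q / kappa r) * ((\<integral>\<^sup>+\<omega>. visit y a \<omega> \<partial>M) * indicator (-{y}) a)" .
  qed
  also have "\<dots> = (of_nat (card ?B) * of_nat (card (nbr :: (int ^ 'd) set)) * ennreal (bound r ^ 2 * Q / kappa r))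
      * (\<Sum>a\<in>?B. (\<integral>\<^sup>+\<omega>. visit y a \<omega> \<partial>M) * indicator (-{y}) a)"
    by (rule const)
  also have "of_nat (card ?B) * of_nat (card (nbr :: (int ^ 'd) set)) * ennreal (bound r ^ 2 * Q / kappa r)
      = ennreal (cost r)"
    using kappa_pos[of r] q_nonneg
    by (simp add: ennreal_of_nat_eq_real_of_nat ennreal_mult[symmetric] cost_def deg_def card_l1ball[of z]
        Q_def mult_ac)
  finally show ?thesis .
qed

text \<open>Each site \<open>a\<close> lies in as many balls of radius \<open>r\<close> as a ball
  has sites. Summing over the centres \<open>z\<close> therefore gives the mean range times the
  costs, each multiplied by one further cardinality.\<close>

theorem mean_time_bound:
  assumes sum: "summable (\<lambda>r. cost r * real (card (l1ball (0 :: int ^ 'd) r)))"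
  obtains C where "C \<ge> 0" "\<And>y. y \<noteq> 0 \<Longrightarrow>
    (\<Sum>n. of_nat n * time_term y n) \<le> ennreal (C * real (l1 y)) * Z y"
proof -
  obtain K where K: "K \<ge> 0" "\<And>y. y \<noteq> 0 \<Longrightarrow>
    (\<integral>\<^sup>+z. (\<integral>\<^sup>+\<omega>. visit y z \<omega> \<partial>M) * indicator (-{y}) z \<partial>count_space UNIV)
      \<le> ennreal (K * real (l1 y)) * Z y"
    using mean_range_bound by blast
  define s where "s = (\<Sum>r. cost r * real (card (l1ball (0 :: int ^ 'd) r)))"
  have s: "s \<ge> 0" unfolding s_def by (intro suminf_nonneg sum mult_nonneg_nonneg cost_nonneg) auto
  show thesis
  proof
    show "(bound 0 + s) * K \<ge> 0" using s K bound_nonneg by simp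
    fix y :: "int ^ 'd"
    assume y: "y \<noteq> 0"
    define v where "v z = (\<integral>\<^sup>+\<omega>. visit y z \<omega> \<partial>M) * indicator (-{y}) z" for z
    let ?R = "\<integral>\<^sup>+z. v z \<partial>count_space UNIV"
    have swap: "(\<integral>\<^sup>+z. (\<Sum>a\<in>l1ball z r. v a) \<partial>count_space UNIV) = of_nat (card (l1ball (0 :: int ^ 'd) r)) * ?R" for r
    proof -
      let ?F = "\<lambda>z a. v a * indicator (l1ball z r) a"
      have "(\<integral>\<^sup>+z. (\<Sum>a\<in>l1ball z r. v a) \<partial>count_space UNIV) = (\<integral>\<^sup>+z. \<integral>\<^sup>+a. ?F z a \<partial>count_space UNIV \<partial>count_space UNIV)"
        by (subst nn_integral_count_space_indicator[symmetric])
           (simp_all add: nn_integral_count_space_finite)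
      also have "\<dots> = (\<integral>\<^sup>+a. \<integral>\<^sup>+z. ?F z a \<partial>count_space UNIV \<partial>count_space UNIV)"
        using nn_integral_fst_count_space[of "\<lambda>(z, a). ?F z a"]
          nn_integral_snd_count_space[of "\<lambda>(z, a). ?F z a"]
        by (simp only: prod.case)
      also have "\<dots> = (\<integral>\<^sup>+a. \<integral>\<^sup>+z. v a * indicator (l1ball a r) z \<partial>count_space UNIV \<partial>count_space UNIV)"
        by (intro nn_integral_cong) (simp add: l1ball_def indicator_def l1_minus_commute)
      also have "\<dots> = (\<integral>\<^sup>+a. of_nat (card (l1ball (0 :: int ^ 'd) r)) * v a \<partial>count_space UNIV)"
      proof (intro nn_integral_cong)
        fix a :: "int ^ 'd"
        have "(\<integral>\<^sup>+z. v a * indicator (l1ball a r) z \<partial>count_space UNIV) = v a * of_nat (card (l1ball a r))"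
          by (subst nn_integral_cmult) auto
        then show "(\<integral>\<^sup>+z. v a * indicator (l1ball a r) z \<partial>count_space UNIV)
            = of_nat (card (l1ball (0 :: int ^ 'd) r)) * v a"
          by (simp only: card_l1ball[of a] mult.commute)
      qed
      also have "\<dots> = of_nat (card (l1ball (0 :: int ^ 'd) r)) * ?R"
        by (simp add: nn_integral_cmult)
      finally show ?thesis .
    qed
    have "(\<Sum>n. of_nat n * time_term y n)
      \<le> (\<integral>\<^sup>+z. (\<integral>\<^sup>+\<omega>. G (-{y}) 0 z \<omega> * G (-{y}) z y \<omega> \<partial>M) * indicator (-{y}) z \<partial>count_space UNIV)"
      by (rule mean_time_le)
    also have "\<dots> \<le> (\<integral>\<^sup>+z. ennreal (bound 0) * v z + (\<Sum>r. ennreal (cost r) * (\<Sum>a\<in>l1ball z r. v a)) \<partial>count_space UNIV)"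
    proof (intro nn_integral_mono)
      fix z :: "int ^ 'd"
      show "(\<integral>\<^sup>+\<omega>. G (-{y}) 0 z \<omega> * G (-{y}) z y \<omega> \<partial>M) * indicator (-{y}) z
          \<le> ennreal (bound 0) * v z + (\<Sum>r. ennreal (cost r) * (\<Sum>a\<in>l1ball z r. v a))"
      proof (cases "z = y")
        case False
        have "(\<integral>\<^sup>+\<omega>. G (-{y}) 0 z \<omega> * G (-{y}) z y \<omega> \<partial>M)
            \<le> (\<integral>\<^sup>+\<omega>. ennreal (bound 0) * visit y z \<omega> + (\<Sum>r. free_term y z r \<omega>) \<partial>M)"
          using False by (intro nn_integral_mono green_product_le)
        also have "\<dots> = ennreal (bound 0) * v z + (\<Sum>r. \<integral>\<^sup>+\<omega>. free_term y z r \<omega> \<partial>M)"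
          using False by (simp add: v_def nn_integral_add nn_integral_cmult nn_integral_suminf)
        also have "\<dots> \<le> ennreal (bound 0) * v z + (\<Sum>r. ennreal (cost r) * (\<Sum>a\<in>l1ball z r. v a))"
          by (intro add_left_mono suminf_le free_term_le[of y, folded v_def]) auto
        finally show ?thesis using False by simp
      qed simp
    qed
    also have "\<dots> = ennreal (bound 0) * ?R + (\<Sum>r. ennreal (cost r) * (of_nat (card (l1ball (0 :: int ^ 'd) r)) * ?R))"
      by (simp add: nn_integral_add nn_integral_cmult nn_integral_suminf swap)
    also have "\<dots> = ennreal (bound 0) * ?R + (\<Sum>r. ennreal (cost r * real (card (l1ball (0 :: int ^ 'd) r)))) * ?R"
      by (subst ennreal_suminf_multc[symmetric])
         (simp add: ennreal_mult cost_nonneg ennreal_of_nat_eq_real_of_nat mult_ac)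
    also have "(\<Sum>r. ennreal (cost r * real (card (l1ball (0 :: int ^ 'd) r)))) = ennreal s"
      unfolding s_def by (intro suminf_ennreal2 sum) (auto intro: cost_nonneg mult_nonneg_nonneg)
    also have "ennreal (bound 0) * ?R + ennreal s * ?R = ennreal (bound 0 + s) * ?R"
      using s bound_nonneg by (simp add: ennreal_plus distrib_right)
    also have "\<dots> \<le> ennreal (bound 0 + s) * (ennreal (K * real (l1 y)) * Z y)"
      unfolding v_def by (intro mult_left_mono K y) auto
    also have "\<dots> = ennreal ((bound 0 + s) * K * real (l1 y)) * Z y"
      using s K bound_nonneg by (simp add: ennreal_mult mult_ac)
    finally show "(\<Sum>n. of_nat n * time_term y n) \<le> ennreal ((bound 0 + s) * K * real (l1 y)) * Z y" .
  qed
qed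

end

section \<open>Summability of the surgery costs\<close>

lemma power_times_geometric_bounded:
  fixes x :: real
  assumes "0 \<le> x" "x < 1"
  obtains K where "\<And>n. real n ^ k * x ^ n \<le> K"
proof (cases "k = 0")
  case True
  then show ?thesis using assms by (intro that[of 1]) (auto simp: power_le_one)
next
  case False
  define y where "y = root k x"
  have y: "0 \<le> y" "y < 1" "y ^ k = x" using False assms by (auto simp: y_def)
  have "(\<lambda>n. real n * y ^ n) \<longlonglongrightarrow> 0"
    using powser_times_n_limit_0[of y] y by simp
  then obtain B where B: "\<And>n. norm (real n * y ^ n) \<le> B"
    using Bseq_def convergentI convergent_imp_Bseq by metis
  have "real n ^ k * x ^ n \<le> B ^ k" for n
  proof -
    have "real n ^ k * x ^ n = (real n * y ^ n) ^ k"
      unfolding y(3)[symmetric] by (simp add: power_mult_distrib power_mult[symmetric] mult.commute)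
    also have "\<dots> \<le> B ^ k" using B[of n] y by (intro power_mono) auto
    finally show ?thesis .
  qed
  then show ?thesis by (rule that)
qed

lemma summable_power_times_geometric:
  fixes x :: real
  assumes "0 \<le> x" "x < 1"
  shows "summable (\<lambda>n. real n ^ k * x ^ n)"
proof -
  define s where "s = sqrt x"
  have s: "0 \<le> s" "s < 1" "s * s = x" using assms by (auto simp: s_def)
  obtain K where K: "\<And>n. real n ^ k * s ^ n \<le> K"
    using power_times_geometric_bounded s by blast
  show ?thesis
  proof (rule summable_comparison_test')
    show "summable (\<lambda>n. K * s ^ n)" using s by (intro summable_mult summable_geometric) auto
    fix n
    have "real n ^ k * x ^ n = (real n ^ k * s ^ n) * s ^ n"
      unfolding s(3)[symmetric] by (simp add: power_mult_distrib)
    also have "\<dots> \<le> K * s ^ n" using s K by (intro mult_right_mono) auto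
    finally show "norm (real n ^ k * x ^ n) \<le> K * s ^ n" using assms by simp
  qed
qed

context surgery
begin

text \<open>The squared cardinality grows polynomially in \<open>r\<close> and is absorbed by the
  geometric rate; \<open>lam ^ (4 * r)\<close> is the growth of \<open>bound r ^ 2\<close>.\<close>

lemma summable_cost:
  assumes \<theta>: "0 \<le> \<theta>" "\<theta> < 1"
    and ev: "eventually (\<lambda>r. lam ^ (4 * r) * q ^ card (l1ball (0 :: int ^ 'd) r) / kappa r \<le> c * \<theta> ^ r) sequentially"
  shows "summable (\<lambda>r. cost r * real (card (l1ball (0 :: int ^ 'd) r)))"
proof (rule summable_comparison_test_ev)
  define b where "b = (1 / eps + 1) / (1 - \<zeta>)"
  define k where "k = CARD('d) * 2"
  let ?N = "\<lambda>r. card (l1ball (0 :: int ^ 'd) r)"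
  have b: "b \<ge> 0" using eps \<zeta> by (simp add: b_def)
  have bound_le: "bound r ^ 2 \<le> b ^ 2 * lam ^ (4 * r)" for r
  proof -
    have l: "1 \<le> lam ^ (2 * r)" using lam by simp
    have "lam ^ (2 * r) / eps + 1 \<le> lam ^ (2 * r) * (1 / eps + 1)"
      using l by (simp add: algebra_simps)
    then have "bound r \<le> b * lam ^ (2 * r)"
      using \<zeta> by (simp add: bound_def b_def divide_right_mono mult.commute)
    then have "bound r ^ 2 \<le> (b * lam ^ (2 * r)) ^ 2"
      using bound_nonneg by (rule power_mono)
    then show ?thesis by (simp add: power_mult_distrib power_mult[symmetric])
  qed
  show "summable (\<lambda>r. (b ^ 2 * deg * \<bar>c\<bar> * 2 ^ k) * (real r ^ k * \<theta> ^ r))"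
    by (intro summable_mult summable_power_times_geometric \<theta>)
  show "eventually (\<lambda>r. norm (cost r * real (?N r)) \<le> (b ^ 2 * deg * \<bar>c\<bar> * 2 ^ k) * (real r ^ k * \<theta> ^ r)) sequentially"
    using ev
  proof eventually_elim
    fix r
    assume ev: "lam ^ (4 * r) * q ^ ?N r / kappa r \<le> c * \<theta> ^ r"
    have "real (?N r) * real (?N r) \<le> real ((2 * r) ^ CARD('d)) * real ((2 * r) ^ CARD('d))"
      using card_l1ball_le[of "0 :: int ^ 'd" r] by (intro mult_mono) (simp_all only: of_nat_le_iff of_nat_0_le_iff)
    also have "\<dots> = 2 ^ k * real r ^ k"
      by (simp add: k_def power_mult_distrib power_mult power2_eq_square)
    finally have N: "real (?N r) * real (?N r) \<le> 2 ^ k * real r ^ k" .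
    have "cost r * real (?N r) = (bound r ^ 2) * (q ^ ?N r / kappa r) * (deg * (real (?N r) * real (?N r)))"
      by (simp add: cost_def)
    also have "\<dots> \<le> (b ^ 2 * lam ^ (4 * r)) * (q ^ ?N r / kappa r) * (deg * (2 ^ k * real r ^ k))"
    proof (rule mult_mono[OF mult_right_mono[OF bound_le] mult_left_mono[OF N]])
      show "0 \<le> b\<^sup>2 * lam ^ (4 * r) * (q ^ ?N r / kappa r)" "0 \<le> q ^ ?N r / kappa r"
        using q_nonneg kappa_pos[of r] lam by auto
    qed (use deg_pos in auto)
    also have "\<dots> = (lam ^ (4 * r) * q ^ ?N r / kappa r) * (b ^ 2 * deg * 2 ^ k * real r ^ k)"
      by simp
    also have "\<dots> \<le> (\<bar>c\<bar> * \<theta> ^ r) * (b ^ 2 * deg * 2 ^ k * real r ^ k)"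
    proof (intro mult_right_mono)
      show "lam ^ (4 * r) * q ^ ?N r / kappa r \<le> \<bar>c\<bar> * \<theta> ^ r"
        by (rule order_trans[OF ev mult_right_mono]) (use \<theta> in auto)
    qed (use deg_pos in auto)
    finally show "norm (cost r * real (?N r)) \<le> (b ^ 2 * deg * \<bar>c\<bar> * 2 ^ k) * (real r ^ k * \<theta> ^ r)"
      using cost_nonneg[of r] by (simp add: mult_ac)
  qed
qed

end

section \<open>Crossing a ball: the general bound\<close>

lemma trail_append: "trail x (s @ t) = trail x s @ trail (x + sum_list s) (t :: 'a::monoid_add list)"
  by (induction s arbitrary: x) (auto simp: add.assoc)

text \<open>Equality in the triangle inequality locates the path: a geodesic into or out of the
  centre of a ball does not leave it.\<close>

lemma geodesic:
  fixes x w :: "int ^ 'd::finite"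
  obtains s where "set s \<subseteq> nbr" "length s = l1 (x - w)" "x + sum_list s = w"
    "\<And>v. v \<in> set (trail x s) \<Longrightarrow> v \<noteq> w \<and> l1 (x - v) + l1 (v - w) = l1 (x - w)"
proof -
  have "\<exists>s. set s \<subseteq> nbr \<and> length s = l1 (x - w) \<and> x + sum_list s = w \<and>
    (\<forall>v\<in>set (trail x s). v \<noteq> w \<and> l1 (x - v) + l1 (v - w) = l1 (x - w))"
  proof (induction "l1 (x - w)" arbitrary: x)
    case 0
    then show ?case by (intro exI[of _ "[]"]) simp
  next
    case (Suc n)
    then have "x - w \<noteq> 0" by (metis l1_zero nat.distinct(1))
    then obtain e where e: "e \<in> nbr" "l1 (x - w) = Suc (l1 (x - w + e))" by (rule l1_step_down)
    then have n: "n = l1 (x + e - w)" using Suc.hyps(2) by (simp add: algebra_simps)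
    from Suc.hyps(1)[OF n] obtain s where s: "set s \<subseteq> nbr" "length s = l1 (x + e - w)"
      "x + e + sum_list s = w"
      "\<And>v. v \<in> set (trail (x + e) s) \<Longrightarrow> v \<noteq> w \<and> l1 (x + e - v) + l1 (v - w) = l1 (x + e - w)"
      by blast
    have "l1 (x - v) + l1 (v - w) = l1 (x - w)" if "v \<in> set (trail (x + e) s)" for v
    proof -
      have "l1 (x - w) \<le> l1 (x - v) + l1 (v - w)" using l1_triangle[of "x - v" "v - w"] by simp
      moreover have "l1 (x - v) \<le> Suc (l1 (x + e - v))"
        using l1_step[OF uminus_nbr[OF e(1)], of "x + e - v"] by simp
      ultimately show ?thesis using s(4)[OF that] n Suc.hyps(2) by linarith
    qed
    then show ?case
      using e s n Suc.hyps(2) \<open>x - w \<noteq> 0\<close>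
      by (intro exI[of _ "e # s"]) (auto simp: add.assoc)
  qed
  then show ?thesis using that by blast
qed

context iid_weights
begin

lemma EG_ge_path:
  assumes "set s \<subseteq> nbr" "set (trail x s) \<subseteq> A" "x + sum_list s = w"
  shows "ennreal ((moment 1 / deg) ^ length s) \<le> EG A x w"
proof -
  have "(moment 1 / deg) ^ length s \<le> path_coeff A x w s * path_mean (trail x s)"
    using path_mean_ge[of "trail x s"] assms deg_pos
    by (simp add: path_coeff_def power_one_over power_divide divide_right_mono)
  then have "ennreal ((moment 1 / deg) ^ length s)
      \<le> ennreal (path_coeff A x w s) * ennreal (path_mean (trail x s))"
    by (simp add: ennreal_mult[symmetric] path_coeff_nonneg path_mean_nonneg ennreal_leI)
  also have "\<dots> \<le> EG A x w"
    unfolding EG_paths by (rule nn_integral_ge_point) auto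
  finally show ?thesis .
qed

lemma step_weight: "0 < moment 1 / deg" "moment 1 / deg \<le> 1"
  using moment_1_pos moment_1_less_1 deg_pos deg_ge_1 by (auto simp: divide_le_eq)

text \<open>Go straight from \<open>a\<close> to the centre and from there to \<open>c\<close>, in
  fewer than \<open>2 * r\<close> steps. The end point \<open>c\<close> on the sphere is not in the
  trail, so the path stays in the open ball.\<close>

lemma crossing_general:
  assumes a: "l1 (a - z) < r" and c: "l1 (c - z) = r"
  shows "ennreal ((moment 1 / deg) ^ (2 * r)) \<le> EG (l1ball z r) a c"
proof -
  obtain s where s: "set s \<subseteq> nbr" "length s = l1 (a - z)" "a + sum_list s = z"
    "\<And>v. v \<in> set (trail a s) \<Longrightarrow> v \<noteq> z \<and> l1 (a - v) + l1 (v - z) = l1 (a - z)"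
    using geodesic[of a z] by blast
  obtain t where t: "set t \<subseteq> nbr" "length t = l1 (z - c)" "z + sum_list t = c"
    "\<And>v. v \<in> set (trail z t) \<Longrightarrow> v \<noteq> c \<and> l1 (z - v) + l1 (v - c) = l1 (z - c)"
    using geodesic[of z c] by blast
  have "v \<in> l1ball z r" if v: "v \<in> set (trail a s)" for v
    using s(4)[OF v] a by (simp add: l1ball_def)
  moreover have "v \<in> l1ball z r" if v: "v \<in> set (trail z t)" for v
  proof -
    have "l1 (v - c) \<noteq> 0" using t(4)[OF v] by auto
    then have "l1 (z - v) < l1 (z - c)" using t(4)[OF v] by linarith
    then show ?thesis using c by (simp add: l1ball_def l1_minus_commute)
  qed
  ultimately have "ennreal ((moment 1 / deg) ^ length (s @ t)) \<le> EG (l1ball z r) a c"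
    using s t by (intro EG_ge_path) (auto simp: trail_append)
  moreover have "(moment 1 / deg) ^ (2 * r) \<le> (moment 1 / deg) ^ length (s @ t)"
    using a c s(2) t(2) step_weight by (intro power_decreasing) (auto simp: l1_minus_commute)
  ultimately show ?thesis by (meson ennreal_leI order_trans)
qed

text \<open>Continuity from above: the events of a weight beyond \<open>1 - 1 / Suc n\<close>
  decrease to the event of weight 1.\<close>

lemma obstacle_threshold:
  assumes "prob {\<omega> \<in> space M. X 0 \<omega> = 1} < v"
  obtains \<zeta> where "0 \<le> \<zeta>" "\<zeta> < 1" "prob {\<omega> \<in> space M. X 0 \<omega> > \<zeta>} < v"
proof -
  let ?A = "\<lambda>n. {\<omega> \<in> space M. X 0 \<omega> > 1 - 1 / real (Suc n)}"
  have "(\<lambda>n. prob (?A n)) \<longlonglongrightarrow> prob (\<Inter>n. ?A n)"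
  proof (rule finite_Lim_measure_decseq)
    show "decseq ?A"
    proof (intro decseq_SucI subsetI)
      fix n \<omega>
      assume "\<omega> \<in> ?A (Suc n)"
      moreover have "1 / real (Suc (Suc n)) \<le> 1 / real (Suc n)" by (intro divide_left_mono) auto
      ultimately show "\<omega> \<in> ?A n" by simp
    qed
  qed auto
  moreover have "(\<Inter>n. ?A n) = {\<omega> \<in> space M. X 0 \<omega> = 1}"
  proof (intro equalityI subsetI)
    fix \<omega>
    assume "\<omega> \<in> (\<Inter>n. ?A n)"
    then have "\<omega> \<in> space M" and *: "\<And>n. X 0 \<omega> > 1 - 1 / real (Suc n)" by auto
    have "(\<lambda>n. 1 - 1 / real (Suc n)) \<longlonglongrightarrow> 1 - 0"
      by (intro tendsto_intros LIMSEQ_Suc[OF lim_1_over_n])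
    then have "1 \<le> X 0 \<omega>" using * by (intro LIMSEQ_le_const2) (auto intro: less_imp_le)
    then show "\<omega> \<in> {\<omega> \<in> space M. X 0 \<omega> = 1}"
      using \<open>\<omega> \<in> space M\<close> X_le_1[of 0 \<omega>] by (auto intro: antisym)
  qed auto
  ultimately have "(\<lambda>n. prob (?A n)) \<longlonglongrightarrow> prob {\<omega> \<in> space M. X 0 \<omega> = 1}" by simp
  then have "eventually (\<lambda>n. prob (?A n) < v) sequentially"
    using assms by (rule order_tendstoD)
  then obtain n where "prob (?A n) < v" by (auto simp: eventually_sequentially)
  then show ?thesis by (intro that[of "1 - 1 / real (Suc n)"]) auto
qed

end

text \<open>Two coordinate directions span a square of side about \<open>r / 2\<close> inside the
  ball.\<close>

lemma card_l1ball_ge_square: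
  assumes "CARD('d) \<ge> 2"
  shows "r * r \<le> 4 * card (l1ball (0 :: int ^ 'd::finite) r)"
proof -
  obtain i j :: 'd where ij: "i \<noteq> j"
    using assms by (metis (full_types) One_nat_def card_2_iff' card_le_Suc0_iff_eq finite not_less_eq_eq numeral_2_eq_2 UNIV_I)
  define m where "m = (r + 1) div 2"
  let ?f = "\<lambda>(a, b). axis i (int a) + axis j (int b) :: int ^ 'd"
  have l1_axis: "l1 (axis k c :: int ^ 'd) = nat \<bar>c\<bar>" for k c
  proof -
    have "l1 (axis k c :: int ^ 'd) = (\<Sum>l\<in>UNIV. if l = k then nat \<bar>c\<bar> else 0)"
      unfolding l1_def by (intro sum.cong) (auto simp: axis_def)
    then show ?thesis by simp
  qed
  have inj: "inj_on ?f ({..<m} \<times> {..<m})"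
  proof (rule inj_onI)
    fix p p' :: "nat \<times> nat"
    assume "?f p = ?f p'"
    then have "?f p $ i = ?f p' $ i" "?f p $ j = ?f p' $ j" by simp_all
    then show "p = p'" using ij by (cases p; cases p') (auto simp: axis_def)
  qed
  have "?f ` ({..<m} \<times> {..<m}) \<subseteq> l1ball 0 r"
  proof clarify
    fix a b
    assume "a < m" "b < m"
    then have "a + b < r" by (auto simp: m_def)
    moreover have "l1 (axis i (int a) + axis j (int b) :: int ^ 'd) \<le> a + b"
      using l1_triangle[of "axis i (int a) :: int ^ 'd" "axis j (int b)"] by (simp add: l1_axis)
    ultimately show "axis i (int a) + axis j (int b) \<in> l1ball (0 :: int ^ 'd) r"
      by (simp add: l1ball_def)
  qed
  then have "card ({..<m} \<times> {..<m}) \<le> card (l1ball (0 :: int ^ 'd) r)"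
    using inj by (metis card_image card_mono finite_l1ball)
  moreover have "r * r \<le> (2 * m) * (2 * m)" by (intro mult_mono) (auto simp: m_def)
  ultimately show ?thesis by simp
qed

text \<open>With \<open>q ^ j < 1 / (2 * E)\<close>, an exponent of order \<open>r * r\<close>
  eventually exceeds \<open>j * r\<close>.\<close>

lemma gaussian_beats_geometric:
  fixes E q :: real
  assumes "E > 0" "0 \<le> q" "q < 1"
  shows "eventually (\<lambda>r. \<forall>N. r * r \<le> 4 * N \<longrightarrow> E ^ r * q ^ N \<le> (1 / 2) ^ r) sequentially"
proof -
  have "(\<lambda>j. q ^ j) \<longlonglongrightarrow> 0" using assms by (intro LIMSEQ_power_zero) auto
  then have "eventually (\<lambda>j. q ^ j < 1 / (2 * E)) sequentially"
    using assms by (intro order_tendstoD) auto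
  then obtain j where j: "q ^ j < 1 / (2 * E)" by (auto simp: eventually_sequentially)
  show ?thesis
  proof (rule eventually_sequentiallyI[of "4 * j"], intro allI impI)
    fix r N :: nat
    assume r: "4 * j \<le> r" and N: "r * r \<le> 4 * N"
    have "4 * (j * r) \<le> r * r" using mult_right_mono[OF r, of r] by (simp only: mult.assoc)
    then have "j * r \<le> N" using N by linarith
    then have "q ^ N \<le> (q ^ j) ^ r"
      unfolding power_mult[symmetric] using assms by (intro power_decreasing) auto
    also have "\<dots> \<le> (1 / (2 * E)) ^ r" using j assms by (intro power_mono) auto
    finally have "E ^ r * q ^ N \<le> E ^ r * (1 / (2 * E)) ^ r"
      using assms by (intro mult_left_mono) auto
    also have "\<dots> = (1 / 2) ^ r" using assms by (simp add: power_mult_distrib[symmetric])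
    finally show "E ^ r * q ^ N \<le> (1 / 2) ^ r" .
  qed
qed

context iid_weights
begin

lemma mean_time_linear_higher_dim:
  assumes "CARD('d) \<ge> 2"
  obtains C where "C \<ge> 0" "\<And>y. y \<noteq> 0 \<Longrightarrow>
    (\<Sum>n. of_nat n * time_term y n) \<le> ennreal (C * real (l1 y)) * Z y"
proof -
  obtain \<zeta> where \<zeta>: "0 \<le> \<zeta>" "\<zeta> < 1" "prob {\<omega> \<in> space M. X 0 \<omega> > \<zeta>} < 1"
    using obstacle_threshold prob_less_1 by blast
  define b where "b = moment 1 / deg"
  have b: "0 < b" "b \<le> 1" using step_weight by (auto simp: b_def)
  interpret S: surgery M X \<zeta> "2 * deg" 1 "\<lambda>r. b ^ (2 * r)"
  proof
    show "radial_growth TYPE('d) (2 * deg) 1"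
      unfolding deg_def by (rule radial_growth_general)
  qed (use \<zeta> deg_ge_1 b crossing_general in \<open>auto simp: b_def\<close>)
  have "summable (\<lambda>r. S.cost r * real (card (l1ball (0 :: int ^ 'd) r)))"
  proof (rule S.summable_cost[of "1 / 2" 1])
    \<comment> \<open>Everything exponential in \<open>r\<close>: \<open>lam ^ 4\<close> from the
      squared Green bound and \<open>b ^ 2\<close> from the crossing.\<close>
    define E where "E = (2 * deg) ^ 4 / b ^ 2"
    have E: "E > 0" using deg_pos b by (simp add: E_def)
    have "eventually (\<lambda>r. \<forall>N. r * r \<le> 4 * N \<longrightarrow> E ^ r * S.q ^ N \<le> (1 / 2) ^ r) sequentially"
      using E \<zeta> S.q_nonneg by (intro gaussian_beats_geometric) (auto simp: S.q_def)
    then show "\<forall>\<^sub>F r in sequentially. (2 * deg) ^ (4 * r) * S.q ^ card (l1ball (0 :: int ^ 'd) r) / b ^ (2 * r)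
        \<le> 1 * (1 / 2) ^ r"
    proof eventually_elim
      case (elim r)
      then have "E ^ r * S.q ^ card (l1ball (0 :: int ^ 'd) r) \<le> (1 / 2) ^ r"
        using card_l1ball_ge_square[OF assms] by blast
      then show ?case by (simp add: E_def power_divide power_mult)
    qed
  qed auto
  then show thesis using S.mean_time_bound that by blast
qed

end

section \<open>Crossing in dimension one\<close>

text \<open>With \<open>\<kappa> j = c * p ^ Suc j / Suc j\<close>, the divergence of the harmonic series makes the renewal
  sequence grow strictly faster than \<open>p ^ n\<close>, however small \<open>c\<close> is.\<close>

fun renewal :: "(nat \<Rightarrow> real) \<Rightarrow> nat \<Rightarrow> real" where
  "renewal \<kappa> n = (if n = 0 then 1 else \<Sum>j<n. \<kappa> j * renewal \<kappa> (n - Suc j))"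

declare renewal.simps [simp del]

lemma renewal_0 [simp]: "renewal \<kappa> 0 = 1"
  by (simp add: renewal.simps)

lemma renewal_pos: "n > 0 \<Longrightarrow> renewal \<kappa> n = (\<Sum>j<n. \<kappa> j * renewal \<kappa> (n - Suc j))"
  by (subst renewal.simps) simp

lemma renewal_nonneg:
  assumes "\<And>j. 0 \<le> \<kappa> j"
  shows "0 \<le> renewal \<kappa> n"
proof (induction n rule: less_induct)
  case (less n)
  then show ?case
    by (cases "n = 0") (auto simp: renewal_pos intro!: sum_nonneg mult_nonneg_nonneg assms less)
qed

text \<open>Suppose not. Then \<open>v n = renewal \<kappa> n / p ^ n\<close> stays at most 1, so
  its partial sums \<open>S\<close> grow at most linearly. But \<open>v\<close> solves the renewal
  equation with weights \<open>c / (j + 1)\<close>, whose total mass is infinite, and this forces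
  \<open>S\<close> to grow exponentially.\<close>

lemma renewal_exceeds:
  fixes p c :: real
  assumes p: "p > 0" and c: "c > 0" and \<kappa>: "\<And>j. \<kappa> j = c * p ^ Suc j / real (Suc j)"
  obtains n where "n > 0" "renewal \<kappa> n > p ^ n"
proof (rule ccontr)
  note found = that
  assume "\<not> thesis"
  then have le: "renewal \<kappa> n \<le> p ^ n" if pos: "n > 0" for n using found[of n] pos \<open>\<not> thesis\<close> by force
  define v where "v n = renewal \<kappa> n / p ^ n" for n
  define S where "S T = (\<Sum>n\<le>T. v n)" for T
  have v: "0 \<le> v n" "v n \<le> 1" for n
    using renewal_nonneg[of \<kappa> n] le[of n] p c by (cases "n = 0"; simp add: v_def \<kappa>)+
  have v0: "v 0 = 1" by (simp add: v_def)
  have S_le: "S T \<le> real (Suc T)" for T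
    unfolding S_def using sum_bounded_above[of "{..T}" v 1] v by simp
  have S_mono: "S T \<le> S T'" if "T \<le> T'" for T T'
    unfolding S_def using that v by (intro sum_mono2) auto
  have S0: "S T \<ge> 1" for T using S_mono[of 0 T] by (simp add: S_def v0)
  have v_rec: "(\<Sum>j<n. c / real (Suc j) * v (n - Suc j)) \<le> v n" for n
  proof (cases "n = 0")
    case False
    have "c / real (Suc j) * v (n - Suc j) = \<kappa> j * renewal \<kappa> (n - Suc j) / p ^ n" if "j < n" for j
    proof -
      have "p ^ n = p ^ Suc j * p ^ (n - Suc j)" unfolding power_add[symmetric] using that by simp
      then show ?thesis using p by (simp add: v_def \<kappa> del: power_Suc)
    qed
    then have "(\<Sum>j<n. c / real (Suc j) * v (n - Suc j)) = (\<Sum>j<n. \<kappa> j * renewal \<kappa> (n - Suc j)) / p ^ n"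
      by (simp add: sum_divide_distrib)
    then show ?thesis using False by (simp add: v_def renewal_pos)
  qed (use v in simp)
  have "filterlim (harm :: nat \<Rightarrow> real) at_top sequentially" by (rule harm_at_top)
  then have "eventually (\<lambda>n. harm n \<ge> 2 / c) sequentially" by (simp add: filterlim_at_top)
  then obtain N where "harm N \<ge> 2 / c" by (auto simp: eventually_sequentially)
  then have "c * harm N \<ge> c * (2 / c)" using c by (intro mult_left_mono) auto
  moreover have "c * harm N = (\<Sum>j<N. c / real (Suc j))"
    by (simp add: harm_altdef sum_distrib_left divide_inverse)
  ultimately have N: "(\<Sum>j<N. c / real (Suc j)) \<ge> 2" using c by simp
  \<comment> \<open>Sum the renewal equation over all times up to \<open>T + N\<close>. The first
    \<open>N\<close> weights add up to at least 2, and each of them multiplies a partial sum that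
    still contains \<open>S T\<close>.\<close>
  have double: "2 * S T \<le> S (T + N)" for T
  proof -
    have "2 * S T \<le> (\<Sum>j<N. c / real (Suc j)) * S T"
      using N S0[of T] by (intro mult_right_mono) auto
    also have "\<dots> \<le> (\<Sum>j<N. c / real (Suc j) * S (T + N - Suc j))"
      unfolding sum_distrib_right using c by (intro sum_mono mult_left_mono S_mono) auto
    also have "\<dots> \<le> (\<Sum>j<T + N. c / real (Suc j) * S (T + N - Suc j))"
      using c order_trans[OF zero_le_one S0] by (intro sum_mono2 mult_nonneg_nonneg) auto
    also have "\<dots> = (\<Sum>j<T + N. \<Sum>n=Suc j..T + N. c / real (Suc j) * v (n - Suc j))"
    proof (intro sum.cong refl)
      fix j assume "j \<in> {..<T + N}"
      have "S (T + N - Suc j) = (\<Sum>n=Suc j..T + N. v (n - Suc j))"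
        unfolding S_def using \<open>j \<in> _\<close>
        by (intro sum.reindex_bij_witness[of _ "\<lambda>n. n - Suc j" "\<lambda>n. n + Suc j"]) auto
      then show "c / real (Suc j) * S (T + N - Suc j) = (\<Sum>n=Suc j..T + N. c / real (Suc j) * v (n - Suc j))"
        by (simp add: sum_distrib_left)
    qed
    also have "\<dots> = (\<Sum>n\<le>T + N. \<Sum>j<n. c / real (Suc j) * v (n - Suc j))"
      by (rule sum.nested_swap'[symmetric])
    also have "\<dots> \<le> S (T + N)" unfolding S_def by (intro sum_mono v_rec)
    finally show ?thesis .
  qed
  have pow: "2 ^ m \<le> S (m * N)" for m
  proof (induction m)
    case (Suc m)
    then show ?case using double[of "m * N"] by (simp add: add.commute)
  qed (use S0 in simp)
  have "(\<lambda>m. real m * (1 / 2) ^ m) \<longlonglongrightarrow> 0"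
    using powser_times_n_limit_0[of "1 / 2 :: real"] by simp
  then have "(\<lambda>m. real N * (real m * (1 / 2) ^ m) + (1 / 2) ^ m) \<longlonglongrightarrow> real N * 0 + 0"
    by (intro tendsto_intros LIMSEQ_power_zero) auto
  then have "eventually (\<lambda>m. real N * (real m * (1 / 2) ^ m) + (1 / 2) ^ m < 1) sequentially"
    by (intro order_tendstoD) auto
  then obtain m where m: "real N * (real m * (1 / 2) ^ m) + (1 / 2) ^ m < 1"
    by (auto simp: eventually_sequentially)
  have "(2 :: real) ^ m \<le> real (Suc (m * N))" using pow[of m] S_le[of "m * N"] by linarith
  then have "1 \<le> real (Suc (m * N)) * (1 / 2) ^ m"
    by (simp add: power_one_over field_simps)
  then show False using m by (simp add: algebra_simps)
qed

section \<open>Segments of lattice sites\<close>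

lemma of_int_vec_nth: "(of_int k :: int ^ 'd::finite) $ i = k"
  by (cases k rule: int_diff_cases) (simp add: of_nat_index)

lemma l1_of_int_mult: "l1 (of_int k * x) = nat \<bar>k\<bar> * l1 x"
  unfolding l1_def
  by (simp add: sum_distrib_left of_int_vec_nth abs_mult nat_mult_distrib)

lemma l1_of_nat_mult: "l1 (of_nat n * x) = n * l1 x"
  using l1_of_int_mult[of "int n" x] by simp

text \<open>Vectors are multiplied componentwise, so \<open>of_nat j * e\<close> is the
  \<open>j\<close>-fold multiple of \<open>e\<close>. A crossing of the segment starts at
  \<open>a\<close> and ends just behind it, at \<open>a + of_nat n * e\<close>.\<close>

definition seg :: "int ^ 'd::finite \<Rightarrow> int ^ 'd \<Rightarrow> nat \<Rightarrow> (int ^ 'd) set" where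
  "seg e a n = (\<lambda>j. a + of_nat j * e) ` {..<n}"

lemma finite_seg [simp]: "finite (seg e a n)"
  by (simp add: seg_def)

lemma seg_0 [simp]: "seg e a 0 = {}"
  by (simp add: seg_def)

lemma seg_Suc: "seg e a (Suc n) = insert (a + of_nat n * e) (seg e a n)"
  by (simp add: seg_def lessThan_Suc)

lemma seg_add: "seg e a (m + n) = seg e a m \<union> seg e (a + of_nat m * e) n"
  by (induction n) (simp_all add: seg_Suc algebra_simps)

lemma site_inj:
  assumes "e \<in> (nbr :: (int ^ 'd::finite) set)"
  shows "a + of_nat i * e = a + of_nat j * e \<longleftrightarrow> i = j"
proof
  assume "a + of_nat i * e = a + of_nat j * e"
  then have "of_int (int i - int j) * e = 0" by (simp add: algebra_simps)
  then have "nat \<bar>int i - int j\<bar> * l1 e = 0" by (metis l1_of_int_mult l1_zero)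
  then show "i = j" using l1_nbr[OF assms] by simp
qed simp

lemma in_seg_iff:
  assumes "e \<in> (nbr :: (int ^ 'd::finite) set)"
  shows "a + of_nat i * e \<in> seg e a n \<longleftrightarrow> i < n"
  using site_inj[OF assms, of a] by (auto simp: seg_def)

lemma in_seg_self_iff:
  assumes "e \<in> (nbr :: (int ^ 'd::finite) set)"
  shows "a \<in> seg e a n \<longleftrightarrow> n > 0"
  using in_seg_iff[OF assms, of a 0 n] by simp

lemma seg_disjoint:
  assumes e: "e \<in> (nbr :: (int ^ 'd::finite) set)"
  shows "seg e a m \<inter> seg e (a + of_nat m * e) n = {}"
proof -
  have "a + of_nat m * e + of_nat j * e \<notin> seg e a m" for j
    using in_seg_iff[OF e, of a "m + j" m] by (simp add: algebra_simps)
  then show ?thesis by (auto simp: seg_def[of _ "a + of_nat m * e"])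
qed

lemma card_seg:
  assumes "e \<in> (nbr :: (int ^ 'd::finite) set)"
  shows "card (seg e a n) = n"
  unfolding seg_def using site_inj[OF assms, of a] by (subst card_image) (auto simp: inj_on_def)

text \<open>Along the free segment the Green function is discrete harmonic, hence linear, with value
  0 at \<open>a\<close> and 1 at the far end.\<close>

lemma gambler_ruin:
  fixes a e :: "int ^ 'd::finite"
  assumes e: "e \<in> nbr" and nbr: "nbr = {e, -e}"
    and \<phi>: "\<And>x. 0 \<le> \<phi> x" "\<And>x. \<phi> x \<le> 1" and one: "\<And>x. x \<in> seg e (a + e) n \<Longrightarrow> \<phi> x = 1"
  shows "ennreal (1 / real (Suc n)) \<le> green (ker (seg e (a + e) n) \<phi>) (a + e) (a + of_nat (Suc n) * e)"
proof -
  define w where "w = a + of_nat (Suc n) * e"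
  let ?K = "ker (seg e (a + e) n) \<phi>"
  define g where "g j = enn2real (green ?K (a + of_nat j * e) w)" for j
  have in_iff: "a + of_nat j * e \<in> seg e (a + e) n \<longleftrightarrow> 0 < j \<and> j \<le> n" for j
  proof (cases j)
    case 0
    have "a \<notin> seg e (a + e) n"
      using in_seg_self_iff[OF e, of a 1] seg_disjoint[OF e, of a 1 n] by auto
    then show ?thesis using 0 by simp
  next
    case (Suc i)
    then show ?thesis using in_seg_iff[OF e, of "a + e" i n] by (auto simp: algebra_simps)
  qed
  have w_eq: "a + of_nat j * e = w \<longleftrightarrow> j = Suc n" for j
    unfolding w_def by (rule site_inj[OF e])
  have w_out: "w \<notin> seg e (a + e) n" using in_iff[of "Suc n"] by (simp add: w_def)
  have green_eq: "green ?K (a + of_nat j * e) w = ennreal (g j)" for j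
  proof -
    have "green ?K (a + of_nat j * e) w \<le> 1" using w_out by (intro green_ker_le_1 \<phi>)
    then have "green ?K (a + of_nat j * e) w < top" by (rule le_less_trans) simp
    then show ?thesis unfolding g_def by simp
  qed
  have g_nonneg: "0 \<le> g j" for j by (simp add: g_def)
  have "e \<noteq> - e"
  proof
    assume "e = - e"
    then have "of_nat 2 * e = 0" by (simp add: vec_eq_iff)
    then have "2 * l1 e = 0" by (metis l1_of_nat_mult l1_zero)
    then show False using l1_nbr[OF e] by simp
  qed
  then have card: "card (nbr :: (int ^ 'd) set) = 2"
    and sum: "(\<Sum>f\<in>nbr. F f) = F e + F (-e)" for F :: "int ^ 'd \<Rightarrow> ennreal"
    unfolding nbr by auto
  have step: "2 * g j = g (Suc j) + g (j - 1)" if "0 < j" "j \<le> n" for j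
  proof -
    define x where "x = a + of_nat j * e"
    have x: "x \<in> seg e (a + e) n" "x \<noteq> w" using that in_iff[of j] w_eq[of j] by (auto simp: x_def)
    have nb: "x + e = a + of_nat (Suc j) * e" "x + - e = a + of_nat (j - 1) * e"
      using that by (auto simp: x_def algebra_simps of_nat_diff)
    have "ennreal (g j) = ennreal (1 / 2) * (ennreal (g (Suc j)) + ennreal (g (j - 1)))"
      unfolding green_eq[symmetric] x_def[symmetric] nb[symmetric] using x one[of x]
      by (subst green_unfold) (simp add: kstep_def sum ker_def card)
    also have "\<dots> = ennreal (1 / 2 * (g (Suc j) + g (j - 1)))"
      using g_nonneg by (subst ennreal_mult) (simp_all add: ennreal_plus)
    finally show ?thesis using g_nonneg by (simp add: ennreal_inj add_nonneg_nonneg)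
  qed
  have ends: "g 0 = 0" "g (Suc n) = 1"
  proof -
    have "ennreal (g 0) = 0" "ennreal (g (Suc n)) = 1"
      unfolding green_eq[symmetric] using in_iff[of 0] in_iff[of "Suc n"] w_eq[of 0] w_eq[of "Suc n"]
      by (auto simp: green_killed ker_def indicator_def)
    then show "g 0 = 0" "g (Suc n) = 1" using g_nonneg by (auto simp: ennreal_eq_1)
  qed
  have linear: "g j = real j * g 1 \<and> g (Suc j) = real (Suc j) * g 1" if "j \<le> n" for j
    using that
  proof (induction j)
    case 0
    then show ?case using ends by simp
  next
    case (Suc j)
    then have "2 * g (Suc j) = g (Suc (Suc j)) + g j" using step[of "Suc j"] by simp
    then show ?case using Suc by (simp add: algebra_simps)
  qed
  have "g 1 = 1 / real (Suc n)" using linear[of n] ends by (simp add: field_simps)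
  then show ?thesis using green_eq[of 1] unfolding w_def by simp
qed

context iid_weights
begin

lemma G_seg_concat:
  assumes e: "e \<in> nbr" and mn: "m + k = n"
  shows "G (seg e a m) a (a + of_nat m * e) \<omega> * G (seg e (a + of_nat m * e) k) (a + of_nat m * e) (a + of_nat n * e) \<omega>
    \<le> G (seg e a n) a (a + of_nat n * e) \<omega>"
proof -
  have sub: "seg e a n = seg e a m \<union> seg e (a + of_nat m * e) k"
    using seg_add[of e a m k] mn by simp
  have "G (seg e a m) a (a + of_nat m * e) \<omega> * G (seg e (a + of_nat m * e) k) (a + of_nat m * e) (a + of_nat n * e) \<omega>
      \<le> G (seg e a m) a (a + of_nat m * e) \<omega> * G (seg e a n) (a + of_nat m * e) (a + of_nat n * e) \<omega>"
    using sub by (intro mult_left_mono G_mono) auto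
  also have "\<dots> \<le> G (seg e a n) a (a + of_nat n * e) \<omega>"
    using sub in_seg_iff[OF e, of a m m] by (intro G_concat) auto
  finally show ?thesis .
qed

text \<open>Here the expectations factor exactly: each crossing is confined to its own segment, and
  the segments are disjoint.\<close>

lemma EG_seg_supermult:
  assumes e: "e \<in> nbr"
  shows "EG (seg e a m) a (a + of_nat m * e) * EG (seg e (a + of_nat m * e) k) (a + of_nat m * e) (a + of_nat (m + k) * e)
    \<le> EG (seg e a (m + k)) a (a + of_nat (m + k) * e)"
proof -
  have "EG (seg e a m) a (a + of_nat m * e) * EG (seg e (a + of_nat m * e) k) (a + of_nat m * e) (a + of_nat (m + k) * e)
    = (\<integral>\<^sup>+\<omega>. G (seg e a m) a (a + of_nat m * e) \<omega> * G (seg e (a + of_nat m * e) k) (a + of_nat m * e) (a + of_nat (m + k) * e) \<omega> \<partial>M)"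
    unfolding EG_def G_def
    by (rule independent_factors[OF seg_disjoint[OF e, of a m k], symmetric])
       (intro measurable_green_PiM green_restrict order_refl)+
  also have "\<dots> \<le> EG (seg e a (m + k)) a (a + of_nat (m + k) * e)"
    unfolding EG_def by (intro nn_integral_mono G_seg_concat e) auto
  finally show ?thesis .
qed

lemma EG_seg_ge:
  assumes e: "e \<in> nbr"
  shows "ennreal ((moment 1 / deg) ^ n) \<le> EG (seg e a n) a (a + of_nat n * e)"
proof -
  have t: "set (trail (a + of_nat m * e) (replicate k e)) \<subseteq> seg e a (m + k)" for m k
  proof (induction k arbitrary: m)
    case (Suc k)
    have "a + of_nat m * e \<in> seg e a (m + Suc k)" using in_seg_iff[OF e] by simp
    then show ?case using Suc[of "Suc m"] by (simp add: algebra_simps)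
  qed simp
  have "ennreal ((moment 1 / deg) ^ length (replicate n e)) \<le> EG (seg e a n) a (a + of_nat n * e)"
    using e t[of 0 n] by (intro EG_ge_path) (auto simp: sum_list_replicate)
  then show ?thesis by simp
qed

text \<open>A gap of length \<open>n\<close> begins at the renewal site \<open>a\<close>, which is
  counted in \<open>n\<close>. The site behind the gap is left open, so that successive gaps involve
  disjoint sets of sites.\<close>

definition renewal_event :: "int ^ 'd \<Rightarrow> real \<Rightarrow> int ^ 'd \<Rightarrow> nat \<Rightarrow> (int ^ 'd \<Rightarrow> real) \<Rightarrow> ennreal" where
  "renewal_event e mu a n \<phi> = (\<Prod>x\<in>seg e a n. if x = a then indicator {mu..<1} (\<phi> x) else indicator {1} (\<phi> x))"

text \<open>Without a condition for \<open>n = 0\<close>: the last gap may be cut off at the end of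
  the interval, where no renewal site is demanded.\<close>

definition at_obstacle :: "real \<Rightarrow> int ^ 'd \<Rightarrow> nat \<Rightarrow> (int ^ 'd \<Rightarrow> real) \<Rightarrow> ennreal" where
  "at_obstacle mu a n \<phi> = (if n = 0 then 1 else indicator {mu..<1} (\<phi> a))"

lemma renewal_event_1:
  assumes "e \<in> nbr"
  shows "renewal_event e mu a (Suc 0) \<phi> = indicator {mu..<1} (\<phi> a)"
  by (simp add: renewal_event_def seg_Suc)

lemma renewal_event_Suc:
  assumes e: "e \<in> nbr" and n: "n > 0"
  shows "renewal_event e mu a (Suc n) \<phi> = indicator {1} (\<phi> (a + of_nat n * e)) * renewal_event e mu a n \<phi>"
  using in_seg_iff[OF e, of a n n] site_inj[OF e, of a n 0] n
  by (simp add: renewal_event_def seg_Suc)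

text \<open>The events fix the distance from \<open>a\<close> to the next renewal site and so
  exclude each other; the last summand covers the case that none has come so far.\<close>

lemma renewal_events_disjoint:
  assumes e: "e \<in> nbr"
  shows "(\<Sum>j<n. renewal_event e mu a (Suc j) \<phi> * indicator {mu..<1} (\<phi> (a + of_nat (Suc j) * e)))
      + renewal_event e mu a (Suc n) \<phi> \<le> indicator {mu..<1} (\<phi> a)"
proof (induction n)
  case 0
  then show ?case by (simp add: renewal_event_1[OF e])
next
  case (Suc n)
  let ?s = "\<phi> (a + of_nat (Suc n) * e)" and ?E = "renewal_event e mu a (Suc n) \<phi>"
  have "?E * indicator {mu..<1} ?s + renewal_event e mu a (Suc (Suc n)) \<phi>
      = ?E * (indicator {mu..<1} ?s + indicator {1} ?s)"
    by (subst renewal_event_Suc[OF e]) (simp_all add: distrib_left mult.commute)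
  also have "\<dots> \<le> ?E * 1" by (intro mult_left_mono) (auto simp: indicator_def)
  finally have "(\<Sum>j<Suc n. renewal_event e mu a (Suc j) \<phi> * indicator {mu..<1} (\<phi> (a + of_nat (Suc j) * e)))
      + renewal_event e mu a (Suc (Suc n)) \<phi>
      \<le> (\<Sum>j<n. renewal_event e mu a (Suc j) \<phi> * indicator {mu..<1} (\<phi> (a + of_nat (Suc j) * e))) + ?E"
    by (simp add: add.assoc add_left_mono del: of_nat_Suc)
  then show ?case using Suc by (rule order_trans)
qed

text \<open>The summand \<open>j = n - 1\<close> has no condition at its far end and becomes the
  leftover event of \<open>renewal_events_disjoint\<close>.\<close>

lemma renewal_events_le:
  assumes e: "e \<in> nbr" and n: "n > 0"
  shows "(\<Sum>j<n. renewal_event e mu a (Suc j) \<phi> * at_obstacle mu (a + of_nat (Suc j) * e) (n - Suc j) \<phi>)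
    \<le> indicator {mu..<1} (\<phi> a)"
proof -
  obtain m where m: "n = Suc m" using n by (cases n) auto
  have "(\<Sum>j<n. renewal_event e mu a (Suc j) \<phi> * at_obstacle mu (a + of_nat (Suc j) * e) (n - Suc j) \<phi>)
     = (\<Sum>j<m. renewal_event e mu a (Suc j) \<phi> * indicator {mu..<1} (\<phi> (a + of_nat (Suc j) * e)))
      + renewal_event e mu a (Suc m) \<phi>"
    unfolding m by (simp add: at_obstacle_def del: of_nat_Suc)
  also have "\<dots> \<le> indicator {mu..<1} (\<phi> a)" by (rule renewal_events_disjoint[OF e])
  finally show ?thesis .
qed

lemma nn_integral_renewal_event:
  assumes e: "e \<in> nbr"
  shows "(\<integral>\<^sup>+\<omega>. renewal_event e mu a (Suc j) (\<lambda>z. X z \<omega>) \<partial>M)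
    = ennreal (prob {\<omega> \<in> space M. X 0 \<omega> \<in> {mu..<1}} * prob {\<omega> \<in> space M. X 0 \<omega> \<in> {1}} ^ j)"
proof -
  let ?p = "ennreal (prob {\<omega> \<in> space M. X 0 \<omega> \<in> {mu..<1}})"
  let ?r = "ennreal (prob {\<omega> \<in> space M. X 0 \<omega> \<in> {1}})"
  have a: "a \<in> seg e a (Suc j)" using in_seg_self_iff[OF e] by simp
  have "(\<integral>\<^sup>+\<omega>. renewal_event e mu a (Suc j) (\<lambda>z. X z \<omega>) \<partial>M)
      = (\<Prod>x\<in>seg e a (Suc j). \<integral>\<^sup>+\<omega>. (if x = a then indicator {mu..<1} (X x \<omega>) else indicator {1} (X x \<omega>)) \<partial>M)"
    unfolding renewal_event_def
    by (intro indep_vars_nn_integral indep_vars_compose2[OF indep_vars_subset[OF indep]]) auto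
  also have "\<dots> = (\<Prod>x\<in>seg e a (Suc j). if x = a then ?p else ?r)"
    by (intro prod.cong refl) (simp add: nn_integral_indicator_X del: singleton_iff)
  also have "\<dots> = ?p * (\<Prod>x\<in>seg e a (Suc j) - {a}. ?r)"
    using a by (subst prod.remove[of _ a]) (auto intro!: prod.cong)
  also have "\<dots> = ?p * ?r ^ j" using a card_seg[OF e, of a "Suc j"] by simp
  finally show ?thesis by (simp add: ennreal_mult ennreal_power)
qed

text \<open>The first step from \<open>a\<close> has weight at least \<open>mu / 2\<close>, and by
  \<open>gambler_ruin\<close> the \<open>j\<close> free sites behind it are crossed before a return
  to \<open>a\<close> with probability \<open>1 / (j + 1)\<close>. The event multiplies both sides
  to make the bound conditional on it.\<close>

lemma renewal_event_weight:
  assumes e: "e \<in> nbr" and nbr: "nbr = {e, -e}" and mu: "0 \<le> mu"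
  shows "renewal_event e mu a (Suc j) (\<lambda>z. X z \<omega>) * ennreal (mu / (2 * real (Suc j)))
    \<le> renewal_event e mu a (Suc j) (\<lambda>z. X z \<omega>) * G (seg e a (Suc j)) a (a + of_nat (Suc j) * e) \<omega>"
proof (cases "renewal_event e mu a (Suc j) (\<lambda>z. X z \<omega>) = 0")
  case False
  have nz: "(if x = a then indicator {mu..<1} (X x \<omega>) else indicator {1} (X x \<omega>)) \<noteq> (0 :: ennreal)"
    if "x \<in> seg e a (Suc j)" for x
  proof
    assume "(if x = a then indicator {mu..<1} (X x \<omega>) else indicator {1} (X x \<omega>)) = (0 :: ennreal)"
    then have "renewal_event e mu a (Suc j) (\<lambda>z. X z \<omega>) = 0"
      unfolding renewal_event_def using that by (intro prod_zero bexI[of _ x]) auto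
    then show False using False by contradiction
  qed
  have a: "a \<in> seg e a (Suc j)" using in_seg_self_iff[OF e] by simp
  have Xa: "mu \<le> X a \<omega>" using nz[OF a] by (auto simp: indicator_def split: if_splits)
  have split: "seg e a (Suc j) = insert a (seg e (a + e) j)" using seg_add[of e a 1 j] by (simp add: seg_Suc)
  have "a \<notin> seg e (a + e) j" using seg_disjoint[OF e, of a 1 j] in_seg_self_iff[OF e, of a 1] by auto
  then have one: "X x \<omega> = 1" if "x \<in> seg e (a + e) j" for x
    using nz[of x] split that by (auto simp: indicator_def split: if_splits)
  have "card (nbr :: (int ^ 'd) set) \<le> 2" unfolding nbr by (simp add: card_insert_if)
  then have "mu / 2 \<le> X a \<omega> / real (card (nbr :: (int ^ 'd) set))"
    using Xa mu card_nbr_pos[where 'd = 'd] by (intro frac_le) auto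
  then have "ennreal (mu / 2) \<le> ker (seg e a (Suc j)) (\<lambda>z. X z \<omega>) a"
    using a by (simp add: ker_def ennreal_leI)
  moreover have "ennreal (1 / real (Suc j)) \<le> G (seg e a (Suc j)) (a + e) (a + of_nat (Suc j) * e) \<omega>"
  proof -
    have "ennreal (1 / real (Suc j)) \<le> G (seg e (a + e) j) (a + e) (a + of_nat (Suc j) * e) \<omega>"
      unfolding G_def by (intro gambler_ruin e nbr one) auto
    also have "\<dots> \<le> G (seg e a (Suc j)) (a + e) (a + of_nat (Suc j) * e) \<omega>"
      using split by (intro G_mono) auto
    finally show ?thesis .
  qed
  ultimately have "ennreal (mu / 2) * ennreal (1 / real (Suc j))
      \<le> ker (seg e a (Suc j)) (\<lambda>z. X z \<omega>) a * G (seg e a (Suc j)) (a + e) (a + of_nat (Suc j) * e) \<omega>"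
    by (intro mult_mono) auto
  also have "\<dots> \<le> G (seg e a (Suc j)) a (a + of_nat (Suc j) * e) \<omega>"
    unfolding G_def by (rule green_step[OF e])
  also have "ennreal (mu / 2) * ennreal (1 / real (Suc j)) = ennreal (mu / (2 * real (Suc j)))"
    using mu by (simp add: ennreal_mult[symmetric])
  finally show ?thesis by (intro mult_left_mono) auto
qed simp

text \<open>Induction on the length by the first gap. The gap and the rest of the interval involve
  disjoint sites, so expectations factor as in the renewal equation; the condition
  \<open>at_obstacle\<close> hands the renewal site on to the next gap.\<close>

lemma renewal_le_crossing:
  assumes e: "e \<in> nbr" and nbr: "nbr = {e, -e}" and mu: "0 \<le> mu"
    and \<kappa>: "\<And>j. \<kappa> j = prob {\<omega> \<in> space M. X 0 \<omega> \<in> {mu..<1}} * prob {\<omega> \<in> space M. X 0 \<omega> \<in> {1}} ^ j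
      * (mu / (2 * real (Suc j)))"
  shows "ennreal (renewal \<kappa> n)
    \<le> (\<integral>\<^sup>+\<omega>. at_obstacle mu a n (\<lambda>z. X z \<omega>) * G (seg e a n) a (a + of_nat n * e) \<omega> \<partial>M)"
proof (induction n arbitrary: a rule: less_induct)
  case (less n)
  show ?case
  proof (cases "n = 0")
    case True
    then show ?thesis by (simp add: at_obstacle_def G_def green_killed ker_def emeasure_space_1)
  next
    case False
    have \<kappa>_nonneg: "0 \<le> \<kappa> j" for j unfolding \<kappa> using mu by simp
    let ?X = "\<lambda>\<omega> z. X z \<omega>"
    let ?b = "\<lambda>j. a + of_nat (Suc j) * e"
    let ?F = "\<lambda>j \<phi>. at_obstacle mu (?b j) (n - Suc j) \<phi>"
    let ?H = "\<lambda>j \<phi>. ?F j \<phi> * green (ker (seg e (?b j) (n - Suc j)) \<phi>) (?b j) (a + of_nat n * e)"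
    let ?E = "\<lambda>j. renewal_event e mu a (Suc j)"
    have indep_j: "(\<integral>\<^sup>+\<omega>. ?E j (?X \<omega>) * ?H j (?X \<omega>) \<partial>M) = (\<integral>\<^sup>+\<omega>. ?E j (?X \<omega>) \<partial>M) * (\<integral>\<^sup>+\<omega>. ?H j (?X \<omega>) \<partial>M)"
      if "j < n" for j
    proof (rule independent_factors[OF seg_disjoint[OF e, of a "Suc j" "n - Suc j"]])
      have [measurable]: "(\<lambda>\<phi>. \<phi> x) \<in> borel_measurable (PiM A (\<lambda>_. borel))" if "x \<in> A"
        for x :: "int ^ 'd" and A by (rule measurable_component_singleton) (rule that)
      show "?E j \<in> borel_measurable (PiM (seg e a (Suc j)) (\<lambda>_. borel))"
        unfolding renewal_event_def by (intro borel_measurable_prod_ennreal) (auto split: if_split)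
      show "?E j (restrict \<phi> (seg e a (Suc j))) = ?E j \<phi>" for \<phi>
        unfolding renewal_event_def by (intro prod.cong) auto
      have b: "?b j \<in> seg e (?b j) (n - Suc j)" if "n - Suc j \<noteq> 0"
        using in_seg_self_iff[OF e, of "?b j" "n - Suc j"] that by simp
      show "?H j \<in> borel_measurable (PiM (seg e (?b j) (n - Suc j)) (\<lambda>_. borel))"
      proof (intro borel_measurable_times_ennreal measurable_green_PiM order_refl)
        show "?F j \<in> borel_measurable (PiM (seg e (?b j) (n - Suc j)) (\<lambda>_. borel))"
          unfolding at_obstacle_def using b by (cases "n - Suc j = 0") auto
      qed
      show "?H j (restrict \<phi> (seg e (?b j) (n - Suc j))) = ?H j \<phi>" for \<phi>
        unfolding at_obstacle_def using b by (subst green_restrict[OF order_refl]) auto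
    qed
    have "ennreal (renewal \<kappa> n) = ennreal (\<Sum>j<n. \<kappa> j * renewal \<kappa> (n - Suc j))"
      using False by (simp add: renewal_pos)
    also have "\<dots> = (\<Sum>j<n. ennreal (\<kappa> j * renewal \<kappa> (n - Suc j)))"
      using \<kappa>_nonneg renewal_nonneg[of \<kappa>] by (intro sum_ennreal[symmetric]) auto
    also have "\<dots> = (\<Sum>j<n. ennreal (\<kappa> j) * ennreal (renewal \<kappa> (n - Suc j)))"
      using \<kappa>_nonneg renewal_nonneg[of \<kappa>] by (simp add: ennreal_mult)
    also have "\<dots> \<le> (\<Sum>j<n. ennreal (\<kappa> j) * (\<integral>\<^sup>+\<omega>. ?H j (?X \<omega>) \<partial>M))"
    proof (intro sum_mono mult_left_mono)
      fix j assume "j \<in> {..<n}"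
      then have eq: "?b j + of_nat (n - Suc j) * e = a + of_nat n * e" and "n - Suc j < n"
        by (auto simp: algebra_simps of_nat_diff)
      from less[OF this(2), of "?b j"]
      show "ennreal (renewal \<kappa> (n - Suc j)) \<le> (\<integral>\<^sup>+\<omega>. ?H j (?X \<omega>) \<partial>M)"
        by (simp only: eq G_def)
    qed auto
    also have "\<dots> = (\<Sum>j<n. \<integral>\<^sup>+\<omega>. ennreal (mu / (2 * real (Suc j))) * (?E j (?X \<omega>) * ?H j (?X \<omega>)) \<partial>M)"
    proof (intro sum.cong refl)
      fix j assume j: "j \<in> {..<n}"
      have [measurable]: "(\<lambda>\<omega>. ?E j (?X \<omega>)) \<in> borel_measurable M" "(\<lambda>\<omega>. ?F j (?X \<omega>)) \<in> borel_measurable M"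
        unfolding renewal_event_def at_obstacle_def
        by (auto intro!: borel_measurable_prod_ennreal split: if_split)
      have "(\<integral>\<^sup>+\<omega>. ennreal (mu / (2 * real (Suc j))) * (?E j (?X \<omega>) * ?H j (?X \<omega>)) \<partial>M)
          = ennreal (mu / (2 * real (Suc j))) * (\<integral>\<^sup>+\<omega>. ?E j (?X \<omega>) * ?H j (?X \<omega>) \<partial>M)"
        unfolding G_def[symmetric] by (rule nn_integral_cmult) measurable
      also have "\<dots> = ennreal (mu / (2 * real (Suc j))) * ((\<integral>\<^sup>+\<omega>. ?E j (?X \<omega>) \<partial>M) * (\<integral>\<^sup>+\<omega>. ?H j (?X \<omega>) \<partial>M))"
        using j by (subst indep_j) auto
      also have "\<dots> = ennreal (\<kappa> j) * (\<integral>\<^sup>+\<omega>. ?H j (?X \<omega>) \<partial>M)"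
        unfolding \<kappa> nn_integral_renewal_event[OF e] mult.assoc[symmetric] using mu
        by (subst ennreal_mult[symmetric]) (simp_all add: mult_ac)
      finally show "ennreal (\<kappa> j) * (\<integral>\<^sup>+\<omega>. ?H j (?X \<omega>) \<partial>M)
          = (\<integral>\<^sup>+\<omega>. ennreal (mu / (2 * real (Suc j))) * (?E j (?X \<omega>) * ?H j (?X \<omega>)) \<partial>M)" ..
    qed
    also have "\<dots> \<le> (\<Sum>j<n. \<integral>\<^sup>+\<omega>. (?E j (?X \<omega>) * ?F j (?X \<omega>)) * G (seg e a n) a (a + of_nat n * e) \<omega> \<partial>M)"
    proof (intro sum_mono nn_integral_mono)
      fix j \<omega> assume j: "j \<in> {..<n}"
      let ?g = "G (seg e (?b j) (n - Suc j)) (?b j) (a + of_nat n * e) \<omega>"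
      have "ennreal (mu / (2 * real (Suc j))) * (?E j (?X \<omega>) * ?H j (?X \<omega>))
          = (?E j (?X \<omega>) * ennreal (mu / (2 * real (Suc j)))) * (?F j (?X \<omega>) * ?g)"
        by (simp add: G_def mult_ac)
      also have "\<dots> \<le> (?E j (?X \<omega>) * G (seg e a (Suc j)) a (?b j) \<omega>) * (?F j (?X \<omega>) * ?g)"
        by (intro mult_right_mono renewal_event_weight e nbr mu) auto
      also have "\<dots> = (?E j (?X \<omega>) * ?F j (?X \<omega>)) * (G (seg e a (Suc j)) a (?b j) \<omega> * ?g)"
        by (simp only: mult_ac)
      also have "\<dots> \<le> (?E j (?X \<omega>) * ?F j (?X \<omega>)) * G (seg e a n) a (a + of_nat n * e) \<omega>"
        using j by (intro mult_left_mono G_seg_concat e) auto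
      finally show "ennreal (mu / (2 * real (Suc j))) * (?E j (?X \<omega>) * ?H j (?X \<omega>))
          \<le> (?E j (?X \<omega>) * ?F j (?X \<omega>)) * G (seg e a n) a (a + of_nat n * e) \<omega>" .
    qed
    also have "\<dots> = (\<integral>\<^sup>+\<omega>. (\<Sum>j<n. ?E j (?X \<omega>) * ?F j (?X \<omega>)) * G (seg e a n) a (a + of_nat n * e) \<omega> \<partial>M)"
    proof -
      have [measurable]: "(\<lambda>\<omega>. ?E j (?X \<omega>)) \<in> borel_measurable M" "(\<lambda>\<omega>. ?F j (?X \<omega>)) \<in> borel_measurable M" for j
        unfolding renewal_event_def at_obstacle_def
        by (auto intro!: borel_measurable_prod_ennreal split: if_split)
      show ?thesis unfolding sum_distrib_right by (rule nn_integral_sum[symmetric]) measurable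
    qed
    also have "\<dots> \<le> (\<integral>\<^sup>+\<omega>. at_obstacle mu a n (?X \<omega>) * G (seg e a n) a (a + of_nat n * e) \<omega> \<partial>M)"
      using False renewal_events_le[OF e, of n mu a]
      by (intro nn_integral_mono mult_right_mono) (auto simp: at_obstacle_def[of mu a n])
    finally show ?thesis .
  qed
qed

lemma positive_obstacle_level:
  assumes "prob {\<omega> \<in> space M. 0 < X 0 \<omega> \<and> X 0 \<omega> < 1} > 0"
  obtains mu where "mu > 0" "prob {\<omega> \<in> space M. X 0 \<omega> \<in> {mu..<1}} > 0"
proof (rule ccontr)
  note found = that
  assume "\<not> thesis"
  then have zero: "prob {\<omega> \<in> space M. X 0 \<omega> \<in> {mu..<1}} = 0" if pos: "mu > 0" for mu
    using found[of mu] pos \<open>\<not> thesis\<close> by (metis measure_nonneg order_le_less)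
  have "AE \<omega> in M. \<forall>n. \<not> (X 0 \<omega> \<in> {1 / real (Suc n)..<1})"
    unfolding AE_all_countable
  proof
    fix n
    have "AE \<omega> in M. \<omega> \<notin> {\<omega> \<in> space M. X 0 \<omega> \<in> {1 / real (Suc n)..<1}}"
      using zero[of "1 / real (Suc n)"] by (subst prob_eq_0[symmetric]) auto
    then show "AE \<omega> in M. \<not> (X 0 \<omega> \<in> {1 / real (Suc n)..<1})"
      using AE_space by eventually_elim auto
  qed
  then have "AE \<omega> in M. \<not> (0 < X 0 \<omega> \<and> X 0 \<omega> < 1)"
  proof eventually_elim
    fix \<omega>
    assume *: "\<forall>n. \<not> (X 0 \<omega> \<in> {1 / real (Suc n)..<1})"
    show "\<not> (0 < X 0 \<omega> \<and> X 0 \<omega> < 1)"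
    proof
      assume "0 < X 0 \<omega> \<and> X 0 \<omega> < 1"
      moreover from this obtain n where "1 / real (Suc n) < X 0 \<omega>" using nat_approx_posE by blast
      ultimately show False using *[rule_format, of n] by simp
    qed
  qed
  then have "prob {\<omega> \<in> space M. 0 < X 0 \<omega> \<and> X 0 \<omega> < 1} = 0"
    by (subst prob_eq_0) auto
  then show False using assms by simp
qed

text \<open>By \<open>renewal_exceeds\<close> some block length \<open>n\<close> is crossed with
  mean weight above \<open>p ^ n\<close>. Concatenating blocks gives the rate \<open>u > p\<close>
  along multiples of \<open>n\<close>, and the fewer than \<open>n\<close> remaining sites are
  walked straight, at the bounded price \<open>b ^ n\<close>.\<close>

lemma crossing_exponent:
  assumes nbr: "\<And>e. e \<in> nbr \<Longrightarrow> nbr = {e, -e :: int ^ 'd}"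
    and mid: "prob {\<omega> \<in> space M. 0 < X 0 \<omega> \<and> X 0 \<omega> < 1} > 0"
  obtains u c where "prob {\<omega> \<in> space M. X 0 \<omega> = 1} < u" "u \<le> 1" "c > 0"
    "\<And>e a n. e \<in> nbr \<Longrightarrow> ennreal (c * u ^ n) \<le> EG (seg e a n) a (a + of_nat n * e)"
proof -
  define p where "p = prob {\<omega> \<in> space M. X 0 \<omega> = 1}"
  define b where "b = moment 1 / deg"
  have b: "0 < b" "b \<le> 1" using step_weight by (auto simp: b_def)
  show thesis
  proof (cases "p = 0")
    \<comment> \<open>Any positive rate exceeds \<open>p = 0\<close>, and the straight path provides
      one.\<close>
    case True
    then show thesis
      using b EG_seg_ge by (intro that[of b 1]) (auto simp: p_def b_def)
  next
    case False
    then have p: "0 < p" "p < 1" using prob_less_1 by (auto simp: p_def less_le)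
    obtain mu where mu: "mu > 0" "prob {\<omega> \<in> space M. X 0 \<omega> \<in> {mu..<1}} > 0"
      using positive_obstacle_level mid by blast
    define \<eta> where "\<eta> = prob {\<omega> \<in> space M. X 0 \<omega> \<in> {mu..<1}}"
    define \<kappa> where "\<kappa> j = \<eta> * p ^ j * (mu / (2 * real (Suc j)))" for j
    obtain n where n: "n > 0" "renewal \<kappa> n > p ^ n"
    proof (rule renewal_exceeds)
      show "\<kappa> j = (\<eta> * mu / (2 * p)) * p ^ Suc j / real (Suc j)" for j
        using p by (simp add: \<kappa>_def)
    qed (use p mu in \<open>auto simp: \<eta>_def\<close>)
    \<comment> \<open>The truncation ensures \<open>u <= 1\<close>, so that powers of
      \<open>u\<close> decrease in the exponent.\<close>
    define v where "v = min 1 (renewal \<kappa> n)"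
    define u where "u = root n v"
    have v: "p ^ n < v" "v \<le> 1" "0 < v"
      using n p power_less_one_iff[of p n] less_trans[OF zero_less_power[OF p(1)] n(2)] by (auto simp: v_def)
    have u: "u ^ n = v" "0 < u" "u \<le> 1" using v n by (auto simp: u_def)
    have "p < u" using v(1) u(1,2) by (metis less_imp_le power_less_imp_less_base)
    have cross_n: "ennreal v \<le> EG (seg e a n) a (a + of_nat n * e)" if e: "e \<in> nbr" for e a
    proof -
      have "ennreal v \<le> ennreal (renewal \<kappa> n)" by (intro ennreal_leI) (simp add: v_def)
      also have "\<dots> \<le> (\<integral>\<^sup>+\<omega>. at_obstacle mu a n (\<lambda>z. X z \<omega>) * G (seg e a n) a (a + of_nat n * e) \<omega> \<partial>M)"
        using mu nbr[OF e] e by (intro renewal_le_crossing) (auto simp: \<kappa>_def \<eta>_def p_def)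
      also have "\<dots> \<le> (\<integral>\<^sup>+\<omega>. 1 * G (seg e a n) a (a + of_nat n * e) \<omega> \<partial>M)"
        by (intro nn_integral_mono mult_right_mono) (auto simp: at_obstacle_def indicator_def)
      finally show ?thesis by (simp add: EG_def)
    qed
    have cross_mult: "ennreal (v ^ k) \<le> EG (seg e a (k * n)) a (a + of_nat (k * n) * e)" if e: "e \<in> nbr" for e a k
    proof (induction k arbitrary: a)
      case 0
      then show ?case by (simp add: EG_def G_def green_killed ker_def emeasure_space_1)
    next
      case (Suc k)
      have "ennreal (v ^ Suc k) = ennreal v * ennreal (v ^ k)" using v by (simp add: ennreal_mult)
      also have "\<dots> \<le> EG (seg e a n) a (a + of_nat n * e)
          * EG (seg e (a + of_nat n * e) (k * n)) (a + of_nat n * e) (a + of_nat (n + k * n) * e)"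
        using Suc[of "a + of_nat n * e"] cross_n[OF e]
        by (intro mult_mono) (auto simp: algebra_simps)
      also have "\<dots> \<le> EG (seg e a (Suc k * n)) a (a + of_nat (Suc k * n) * e)"
        using EG_seg_supermult[OF e, of a n "k * n"] by simp
      finally show ?case .
    qed
    show thesis
    proof (rule that)
      show "prob {\<omega> \<in> space M. X 0 \<omega> = 1} < u" using \<open>p < u\<close> by (simp add: p_def)
      show "u \<le> 1" by fact
      show "b ^ n > 0" using b by simp
      fix e a :: "int ^ 'd" and m
      assume e: "e \<in> nbr"
      define k l where "k = m div n" and "l = m mod n"
      have m: "m = k * n + l" and l: "l < n" using n by (auto simp: k_def l_def)
      have "b ^ n * u ^ m \<le> v ^ k * b ^ l"
      proof -
        have "u ^ m \<le> u ^ (k * n)" using u by (intro power_decreasing) (auto simp: m)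
        also have "\<dots> = v ^ k" by (simp add: u(1)[symmetric] power_mult[symmetric] mult.commute)
        finally have "u ^ m \<le> v ^ k" .
        moreover have "b ^ n \<le> b ^ l" using b l by (intro power_decreasing) auto
        ultimately show ?thesis using b u v by (subst mult.commute) (intro mult_mono, auto)
      qed
      then have "ennreal (b ^ n * u ^ m) \<le> ennreal (v ^ k) * ennreal (b ^ l)"
        using v b by (simp add: ennreal_mult[symmetric] ennreal_leI)
      also have "\<dots> \<le> EG (seg e a (k * n)) a (a + of_nat (k * n) * e)
          * EG (seg e (a + of_nat (k * n) * e) l) (a + of_nat (k * n) * e) (a + of_nat (k * n + l) * e)"
        using EG_seg_ge[OF e, of l "a + of_nat (k * n) * e"] cross_mult[OF e]
        by (intro mult_mono) (auto simp: b_def algebra_simps)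
      also have "\<dots> \<le> EG (seg e a m) a (a + of_nat m * e)"
        unfolding m by (rule EG_seg_supermult[OF e])
      finally show "ennreal (b ^ n * u ^ m) \<le> EG (seg e a m) a (a + of_nat m * e)" .
    qed
  qed
qed

end

section \<open>The one-dimensional lattice\<close>

lemma nbr_one_dim:
  assumes "CARD('d::finite) = 1"
  shows "(nbr :: (int ^ 'd) set) = {1, -1}"
proof -
  obtain i :: 'd where "UNIV = {i}" using assms by (auto simp: card_1_singleton_iff)
  then have i: "j = i" for j by auto
  have "axis j 1 = (1 :: int ^ 'd)" "axis j (-1) = (-1 :: int ^ 'd)" for j
    using i by (simp_all add: vec_eq_iff axis_def) metis+
  then show ?thesis by (auto simp: nbr_def)
qed

lemma of_int_one_dim:
  assumes "CARD('d::finite) = 1"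
  obtains k where "x = (of_int k :: int ^ 'd)"
proof -
  obtain i :: 'd where "UNIV = {i}" using assms by (auto simp: card_1_singleton_iff)
  then have "j = i" for j by auto
  then have "x = of_int (x $ i)" by (auto simp: vec_eq_iff of_int_vec_nth) metis
  then show ?thesis by (rule that)
qed

lemma l1_of_int:
  assumes "CARD('d::finite) = 1"
  shows "l1 (of_int k :: int ^ 'd) = nat \<bar>k\<bar>"
  using assms by (simp add: l1_def of_int_vec_nth)

lemma card_l1ball_one_dim:
  assumes "CARD('d::finite) = 1"
  shows "2 * r - 1 \<le> card (l1ball (0 :: int ^ 'd) r)"
proof -
  have "card ((of_int :: int \<Rightarrow> int ^ 'd) ` {- int r<..<int r}) \<le> card (l1ball (0 :: int ^ 'd) r)"
    by (intro card_mono finite_l1ball) (auto simp: l1ball_def l1_of_int[OF assms])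
  then show ?thesis by (subst (asm) card_image) (auto simp: inj_on_def)
qed

text \<open>Walk from \<open>a\<close> in the direction in which \<open>c\<close> is seen from the
  centre. As \<open>a\<close> may lie on the opposite side, nearly the whole diameter
  \<open>2 * r\<close> may have to be crossed.\<close>

lemma seg_in_l1ball_one_dim:
  assumes one: "CARD('d::finite) = 1" and a: "l1 (a - z) < r" and c: "l1 (c - z) = r"
  obtains e n where "e \<in> (nbr :: (int ^ 'd) set)" "n < 2 * r" "c = a + of_nat n * e" "seg e a n \<subseteq> l1ball z r"
proof -
  obtain s where s: "c - z = of_int s" using of_int_one_dim[OF one] by blast
  obtain t where t: "a - z = of_int t" using of_int_one_dim[OF one] by blast
  have sr: "\<bar>s\<bar> = int r" and tr: "\<bar>t\<bar> < int r"
    using a c by (auto simp: s t l1_of_int[OF one])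
  define n where "n = nat \<bar>s - t\<bar>"
  define e where "e = (of_int (sgn s) :: int ^ 'd)"
  have r: "sgn s = 1 \<or> sgn s = -1" using sr tr by (auto simp: sgn_if)
  have st: "s - t = int n * sgn s" using sr tr by (auto simp: n_def sgn_if)
  have n: "n < 2 * r" using sr tr by (auto simp: n_def)
  show thesis
  proof
    show "e \<in> nbr" using r by (auto simp: e_def nbr_one_dim[OF one])
    show "n < 2 * r" by (rule n)
    have "c - a = of_int (s - t)" using s t by (simp add: algebra_simps)
    then show "c = a + of_nat n * e" by (simp add: st e_def algebra_simps)
    show "seg e a n \<subseteq> l1ball z r"
    proof
      fix x assume "x \<in> seg e a n"
      then obtain j where j: "j < n" "x = a + of_nat j * e" by (auto simp: seg_def)
      then have "x - z = of_int (t + int j * sgn s)" using t by (simp add: e_def algebra_simps)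
      then have "l1 (x - z) = nat \<bar>t + int j * sgn s\<bar>" by (simp only: l1_of_int[OF one])
      moreover have "\<bar>t + int j * sgn s\<bar> < int r"
        using r j st sr tr by (auto simp: sgn_if split: if_splits)
      ultimately show "x \<in> l1ball z r" by (simp add: l1ball_def)
    qed
  qed
qed

context iid_weights
begin

lemma mean_time_linear_one_dim:
  assumes one: "CARD('d) = 1" and mid: "prob {\<omega> \<in> space M. 0 < X 0 \<omega> \<and> X 0 \<omega> < 1} > 0"
  obtains C where "C \<ge> 0" "\<And>y. y \<noteq> 0 \<Longrightarrow>
    (\<Sum>n. of_nat n * time_term y n) \<le> ennreal (C * real (l1 y)) * Z y"
proof -
  have nbr: "nbr = {e, -e}" if "e \<in> nbr" for e :: "int ^ 'd"
    using that by (auto simp: nbr_one_dim[OF one])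
  obtain u c where u: "prob {\<omega> \<in> space M. X 0 \<omega> = 1} < u" "u \<le> 1" and c: "c > 0"
    and cross: "\<And>e a n. e \<in> nbr \<Longrightarrow> ennreal (c * u ^ n) \<le> EG (seg e a n) a (a + of_nat n * e)"
    using crossing_exponent[OF nbr mid] by blast
  obtain \<zeta> where \<zeta>: "0 \<le> \<zeta>" "\<zeta> < 1" "prob {\<omega> \<in> space M. X 0 \<omega> > \<zeta>} < u"
    using obstacle_threshold u(1) by blast
  have u0: "u > 0" using u(1) measure_nonneg by (rule le_less_trans[rotated])
  \<comment> \<open>An upper bound for the probability of a free site, kept positive for the
    divisions below and still smaller than the crossing rate \<open>u\<close>.\<close>
  define q where "q = max (u / 2) (prob {\<omega> \<in> space M. X 0 \<omega> > \<zeta>})"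
  have q: "0 < q" "q < u" "prob {\<omega> \<in> space M. X 0 \<omega> > \<zeta>} \<le> q"
    using \<zeta> u0 by (auto simp: q_def)
  \<comment> \<open>The ratio of free ball to crossing is of order \<open>(q / u) ^ (2 * r)\<close>.
    With \<open>lam ^ 4 = u / q\<close> the Green bounds consume half of this gain, and
    \<open>(q / u) ^ r\<close> remains.\<close>
  define lam where "lam = root 4 (u / q)"
  have lam: "lam > 1" "lam ^ 4 = u / q" using q by (auto simp: lam_def)
  define eps where "eps = (lam + 1 / lam) / 2 - 1"
  have eps: "eps > 0"
  proof -
    have "0 < (lam - 1) ^ 2 / (2 * lam)" using lam(1) by simp
    also have "\<dots> = eps" using lam(1) by (simp add: eps_def field_simps power2_eq_square)
    finally show ?thesis .
  qed
  have card: "card (nbr :: (int ^ 'd) set) = 2"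
    unfolding nbr_one_dim[OF one] by (auto simp: vec_eq_iff)
  interpret S: surgery M X \<zeta> lam eps "\<lambda>r. c * u ^ (2 * r)"
  proof
    show "radial_growth TYPE('d) lam eps"
      unfolding eps_def by (intro radial_growth_one_dim card lam)
    show "ennreal (c * u ^ (2 * r)) \<le> EG (l1ball z r) a b"
      if ab: "l1 (a - z) < r" "l1 (b - z) = r" for r z a b
    proof -
      obtain e n where en: "e \<in> nbr" "n < 2 * r" "b = a + of_nat n * e" "seg e a n \<subseteq> l1ball z r"
        using seg_in_l1ball_one_dim[OF one ab] by blast
      have "ennreal (c * u ^ (2 * r)) \<le> ennreal (c * u ^ n)"
        using c u u0 en by (intro ennreal_leI mult_left_mono power_decreasing) auto
      also have "\<dots> \<le> EG (seg e a n) a b" using cross en by simp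
      also have "\<dots> \<le> EG (l1ball z r) a b" by (rule EG_mono) fact
      finally show ?thesis .
    qed
  qed (use \<zeta> lam eps c u0 in auto)
  have "summable (\<lambda>r. S.cost r * real (card (l1ball (0 :: int ^ 'd) r)))"
  proof (rule S.summable_cost[of "q / u" "1 / (c * q)"])
    show "\<forall>\<^sub>F r in sequentially. lam ^ (4 * r) * S.q ^ card (l1ball (0 :: int ^ 'd) r) / (c * u ^ (2 * r))
        \<le> 1 / (c * q) * (q / u) ^ r"
    proof (rule eventually_sequentiallyI[of 1])
      fix r :: nat
      assume r: "1 \<le> r"
      have "S.q ^ card (l1ball (0 :: int ^ 'd) r) \<le> q ^ card (l1ball (0 :: int ^ 'd) r)"
        using q S.q_nonneg by (intro power_mono) (auto simp: S.q_def)
      also have "\<dots> \<le> q ^ (2 * r - 1)"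
        using q u card_l1ball_one_dim[OF one, of r] by (intro power_decreasing) auto
      also have "\<dots> = q ^ (2 * r) / q" using r q by (simp add: power_diff)
      finally have "lam ^ (4 * r) * S.q ^ card (l1ball (0 :: int ^ 'd) r) / (c * u ^ (2 * r))
          \<le> lam ^ (4 * r) * (q ^ (2 * r) / q) / (c * u ^ (2 * r))"
        using lam c u0 by (intro divide_right_mono mult_left_mono) auto
      also have "\<dots> = (u / q) ^ r * (q ^ (2 * r) / q) / (c * u ^ (2 * r))"
        by (simp only: power_mult lam(2))
      also have "\<dots> = 1 / (c * q) * (q / u) ^ r"
        using q u0 c by (simp add: field_simps power_mult power2_eq_square power_mult_distrib)
      finally show "lam ^ (4 * r) * S.q ^ card (l1ball (0 :: int ^ 'd) r) / (c * u ^ (2 * r))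
        \<le> 1 / (c * q) * (q / u) ^ r" .
    qed
  qed (use q u0 in auto)
  then show thesis using S.mean_time_bound that by blast
qed

end

section \<open>Lyapunov exponents\<close>

text \<open>Adding \<open>K\<close> makes the function exactly subadditive, and the limit is the
  infimum of \<open>h t / t\<close>. The linear bound \<open>B\<close> controls the remainder of
  \<open>r\<close> modulo \<open>t\<close>. The constant \<open>K\<close> will absorb the rounding
  to lattice points.\<close>

lemma fekete_real:
  fixes g :: "real \<Rightarrow> real"
  assumes sub: "\<And>r s. r \<ge> 0 \<Longrightarrow> s \<ge> 0 \<Longrightarrow> g (r + s) \<le> g r + g s + K"
    and nonneg: "\<And>r. r \<ge> 0 \<Longrightarrow> 0 \<le> g r" and bound: "\<And>r. r \<ge> 0 \<Longrightarrow> g r \<le> B * (1 + r)"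
    and K: "K \<ge> 0"
  obtains L where "((\<lambda>r. g r / r) \<longlongrightarrow> L) at_top"
proof -
  define h where "h r = g r + K" for r
  have h_nonneg: "0 \<le> h r" if "r \<ge> 0" for r using nonneg[OF that] K by (simp add: h_def)
  have h_mult: "h (real n * t + s) \<le> real n * h t + h s" if "t \<ge> 0" "s \<ge> 0" for n t s
  proof (induction n)
    case (Suc n)
    have "h (real (Suc n) * t + s) = h (t + (real n * t + s))" by (simp add: algebra_simps)
    also have "\<dots> \<le> h t + h (real n * t + s)"
      using sub[of t "real n * t + s"] that by (simp add: h_def)
    finally show ?case using Suc by (simp add: algebra_simps)
  qed simp
  have B: "B \<ge> 0" using nonneg[of 0] bound[of 0] by simp
  define L where "L = (INF t\<in>{0<..}. h t / t)"
  have bdd: "bdd_below ((\<lambda>t. h t / t) ` {0<..})"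
    by (rule bdd_belowI[of _ 0]) (auto intro!: divide_nonneg_pos h_nonneg)
  have lower: "L \<le> h r / r" if "r > 0" for r
    unfolding L_def using bdd that by (intro cINF_lower) auto
  have "((\<lambda>r. h r / r) \<longlongrightarrow> L) at_top"
  proof (rule order_tendstoI)
    fix a assume "a < L"
    then show "eventually (\<lambda>r. a < h r / r) at_top"
      using lower by (intro eventually_mono[OF eventually_gt_at_top[of 0]]) (auto intro: less_le_trans)
  next
    fix a assume "L < a"
    then obtain t where t: "t > 0" "h t / t < a"
      unfolding L_def by (subst (asm) cINF_less_iff[OF _ bdd]) auto
    define b where "b = B * (1 + t) + K"
    have "((\<lambda>r. h t / t + b / r) \<longlongrightarrow> h t / t + 0) at_top"
      by (intro tendsto_intros tendsto_divide_0[OF tendsto_const] filterlim_at_top_imp_at_infinity filterlim_ident)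
    then have "eventually (\<lambda>r. h t / t + b / r < a) at_top"
      using t by (intro order_tendstoD) auto
    then show "eventually (\<lambda>r. h r / r < a) at_top"
      using eventually_gt_at_top[of 0]
    proof eventually_elim
      fix r :: real
      assume less: "h t / t + b / r < a" and r: "r > 0"
      define n where "n = nat \<lfloor>r / t\<rfloor>"
      define s where "s = r - real n * t"
      have "real n = of_int \<lfloor>r / t\<rfloor>" using r t by (simp add: n_def)
      then have n: "real n \<le> r / t" "r / t < real n + 1" by linarith+
      have s: "0 \<le> s" "s \<le> t" using n t by (auto simp: s_def field_simps)
      have "h r \<le> real n * h t + h s" using h_mult[of t s n] s t by (simp add: s_def)
      also have "\<dots> \<le> r / t * h t + b"
      proof (intro add_mono mult_right_mono)
        have "g s \<le> B * (1 + s)" using bound s by simp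
        also have "\<dots> \<le> B * (1 + t)" using s B by (intro mult_left_mono) auto
        finally show "h s \<le> b" by (simp add: h_def b_def)
      qed (use n h_nonneg t in auto)
      finally have "h r / r \<le> h t / t + b / r" using r t by (simp add: field_simps)
      then show "h r / r < a" using less by simp
    qed
  qed
  then have "((\<lambda>r. h r / r - K / r) \<longlongrightarrow> L - 0) at_top"
    by (intro tendsto_diff tendsto_divide_0[OF tendsto_const] filterlim_at_top_imp_at_infinity filterlim_ident)
  then have "((\<lambda>r. g r / r) \<longlongrightarrow> L) at_top"
    by (simp add: h_def add_divide_distrib)
  then show ?thesis by (rule that)
qed

text \<open>By concavity the difference quotients at 0 increase as \<open>l\<close> decreases to 0;
  being bounded by \<open>C\<close>, they converge to their supremum.\<close>

lemma concave_right_derivative: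
  fixes B :: "real \<Rightarrow> real"
  assumes concave: "\<And>l m. 0 < l \<Longrightarrow> l < m \<Longrightarrow> (l / m) * B m + (1 - l / m) * B 0 \<le> B l"
    and bound: "\<And>l. 0 < l \<Longrightarrow> B l - B 0 \<le> l * C"
  obtains D where "(B has_real_derivative D) (at_right 0)" "D \<le> C"
proof -
  define q where "q l = (B l - B 0) / l" for l
  have q_le: "q l \<le> C" if "l > 0" for l
    using bound[OF that] that by (simp add: q_def divide_le_eq mult.commute)
  have q_anti: "q m \<le> q l" if "0 < l" "l < m" for l m
  proof -
    have "(l / m) * (B m - B 0) \<le> B l - B 0"
      using concave[OF that] by (simp add: algebra_simps)
    then show ?thesis using that by (simp add: q_def field_simps)
  qed
  define D where "D = (SUP l\<in>{0<..}. q l)"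
  have bdd: "bdd_above (q ` {0<..})" by (rule bdd_aboveI[of _ C]) (auto intro: q_le)
  have "(q \<longlongrightarrow> D) (at_right 0)"
  proof (rule order_tendstoI)
    fix a assume "a < D"
    then obtain m where m: "m > 0" "a < q m"
      unfolding D_def by (subst (asm) less_cSUP_iff[OF _ bdd]) auto
    show "eventually (\<lambda>l. a < q l) (at_right 0)"
      using eventually_at_right_less[of 0] eventually_at_rightI[of 0 m "\<lambda>l. l < m"] m
      by (auto elim!: eventually_elim2 intro: less_le_trans[OF _ q_anti])
  next
    fix a assume "D < a"
    have "q l \<le> D" if "l > 0" for l unfolding D_def using that bdd by (intro cSUP_upper) auto
    then show "eventually (\<lambda>l. q l < a) (at_right 0)"
      using \<open>D < a\<close> by (intro eventually_mono[OF eventually_at_right_less]) (auto intro: le_less_trans)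
  qed
  then have "(B has_real_derivative D) (at_right 0)"
    by (simp add: has_field_derivative_iff q_def[abs_def])
  moreover have "D \<le> C" unfolding D_def by (intro cSUP_least) (auto intro: q_le)
  ultimately show ?thesis by (rule that)
qed

lemma lattice_floor_add:
  "l1 (lattice_floor (x + y) - lattice_floor x - lattice_floor y) \<le> CARD('d)"
  for x y :: "real ^ 'd::finite"
proof -
  have "l1 (lattice_floor (x + y) - lattice_floor x - lattice_floor y) \<le> (\<Sum>i\<in>(UNIV :: 'd set). 1)"
    unfolding l1_def
  proof (rule sum_mono)
    fix i
    have "\<lfloor>x $ i + y $ i\<rfloor> - \<lfloor>x $ i\<rfloor> - \<lfloor>y $ i\<rfloor> \<in> {0, 1}" by simp linarith
    then show "nat \<bar>(lattice_floor (x + y) - lattice_floor x - lattice_floor y) $ i\<bar> \<le> 1"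
      by (auto simp: lattice_floor_def)
  qed
  then show ?thesis by simp
qed

lemma l1_lattice_floor_le:
  fixes x :: "real ^ 'd::finite"
  shows "real (l1 (lattice_floor x)) \<le> real CARD('d) + (\<Sum>i\<in>UNIV. \<bar>x $ i\<bar>)"
proof -
  have "real (l1 (lattice_floor x)) \<le> (\<Sum>i\<in>(UNIV :: 'd set). 1 + \<bar>x $ i\<bar>)"
    unfolding l1_def of_nat_sum
  proof (rule sum_mono)
    fix i
    show "real (nat \<bar>lattice_floor x $ i\<bar>) \<le> 1 + \<bar>x $ i\<bar>"
      by (simp add: lattice_floor_def) linarith
  qed
  then show ?thesis by (simp add: sum.distrib)
qed

context iid_weights
begin

lemma enn2real_Z_pos: "0 < enn2real (Z y)" and enn2real_Z_le_1: "enn2real (Z y) \<le> 1"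
  and ennreal_enn2real_Z: "ennreal (enn2real (Z y)) = Z y"
proof -
  have "Z y < top" using Z_le_1[of y] by (rule le_less_trans) simp
  then show "0 < enn2real (Z y)" "ennreal (enn2real (Z y)) = Z y"
    using Z_pos[of y] by (auto simp: enn2real_positive_iff)
  show "enn2real (Z y) \<le> 1" using enn2real_mono[OF Z_le_1[of y]] by simp
qed

text \<open>\<open>Lim\<close> is unspecified without convergence, so the exponent carries
  information only once the limit exists. Rounding makes \<open>- ln Z\<close> subadditive along a
  ray only up to an error, which is at most \<open>c * CARD('d)\<close>.\<close>

lemma lyapunov_limit:
  obtains L where "((\<lambda>r. 1 / r * ln (enn2real (Z (lattice_floor (r *\<^sub>R h))))) \<longlongrightarrow> L) at_top"
proof -
  define a where "a y = - ln (enn2real (Z y))" for y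
  define c where "c = - ln (moment 1 / deg)"
  have c: "c \<ge> 0" using step_weight by (simp add: c_def)
  have a_nonneg: "0 \<le> a y" for y
    using enn2real_Z_pos[of y] enn2real_Z_le_1[of y] by (simp add: a_def)
  have a_sub: "a (x + y) \<le> a x + a y" for x y
  proof -
    have "ennreal (enn2real (Z x) * enn2real (Z y)) \<le> ennreal (enn2real (Z (x + y)))"
      using Z_supermult[of x y] by (simp add: ennreal_mult ennreal_enn2real_Z)
    then have "ln (enn2real (Z x) * enn2real (Z y)) \<le> ln (enn2real (Z (x + y)))"
      using enn2real_Z_pos[of x] enn2real_Z_pos[of y] enn2real_Z_pos[of "x + y"]
      by (subst ln_le_cancel_iff) (auto simp: ennreal_le_iff)
    then show ?thesis
      using enn2real_Z_pos[of x] enn2real_Z_pos[of y] by (simp add: a_def ln_mult)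
  qed
  have a_le: "a y \<le> c * real (l1 y)" for y
  proof -
    have "ennreal ((moment 1 / deg) ^ l1 y) \<le> ennreal (enn2real (Z y))"
      using Z_ge by (simp add: ennreal_enn2real_Z)
    then have "ln ((moment 1 / deg) ^ l1 y) \<le> ln (enn2real (Z y))"
      using enn2real_Z_pos[of y] step_weight by (subst ln_le_cancel_iff) (auto simp: ennreal_le_iff)
    then show ?thesis using step_weight by (simp add: a_def c_def ln_realpow mult.commute)
  qed
  define H where "H = (\<Sum>i\<in>UNIV. \<bar>h $ i\<bar>)"
  obtain L where L: "((\<lambda>r. a (lattice_floor (r *\<^sub>R h)) / r) \<longlongrightarrow> L) at_top"
  proof (rule fekete_real[of "\<lambda>r. a (lattice_floor (r *\<^sub>R h))" "c * real CARD('d)" "c * (real CARD('d) + H)"])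
    fix r s :: real
    let ?x = "lattice_floor (r *\<^sub>R h)" and ?y = "lattice_floor (s *\<^sub>R h)"
      and ?z = "lattice_floor ((r + s) *\<^sub>R h)"
    have "a ?z = a ((?x + ?y) + (?z - ?x - ?y))" by simp
    also have "\<dots> \<le> a (?x + ?y) + a (?z - ?x - ?y)" by (rule a_sub)
    also have "a (?x + ?y) \<le> a ?x + a ?y" by (rule a_sub)
    also have "a (?z - ?x - ?y) \<le> c * real (l1 (?z - ?x - ?y))" by (rule a_le)
    also have "\<dots> \<le> c * real CARD('d)"
      using c lattice_floor_add[of "r *\<^sub>R h" "s *\<^sub>R h"]
      by (intro mult_left_mono) (auto simp: scaleR_add_left)
    finally show "a ?z \<le> a ?x + a ?y + c * real CARD('d)" by simp
  next
    fix r :: real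
    assume r: "r \<ge> 0"
    have "a (lattice_floor (r *\<^sub>R h)) \<le> c * real (l1 (lattice_floor (r *\<^sub>R h)))" by (rule a_le)
    also have "\<dots> \<le> c * (real CARD('d) + r * H)"
      using c l1_lattice_floor_le[of "r *\<^sub>R h"] r
      by (intro mult_left_mono) (auto simp: H_def abs_mult sum_distrib_left)
    also have "\<dots> \<le> c * ((real CARD('d) + H) * (1 + r))"
    proof (intro mult_left_mono c)
      have "0 \<le> H" by (simp add: H_def sum_nonneg)
      then show "real CARD('d) + r * H \<le> (real CARD('d) + H) * (1 + r)"
        using r by (simp add: algebra_simps)
    qed
    finally show "a (lattice_floor (r *\<^sub>R h)) \<le> c * (real CARD('d) + H) * (1 + r)"
      by (simp add: mult.assoc)
  qed (use c a_nonneg in auto)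
  have "((\<lambda>r. - (a (lattice_floor (r *\<^sub>R h)) / r)) \<longlongrightarrow> - L) at_top"
    by (rule tendsto_minus[OF L])
  then show ?thesis by (intro that[of "- L"]) (simp add: a_def)
qed

text \<open>Adding a constant \<open>l\<close> to the potential multiplies all weights by
  \<open>exp (- l)\<close>. The locale is stable under this, so its results hold for the shifted
  potential as well.\<close>

lemma scaled_iid_weights:
  assumes "l \<ge> 0"
  shows "iid_weights M (\<lambda>z \<omega>. exp (- l) * X z \<omega>)"
proof unfold_locales
  show "indep_vars (\<lambda>_. borel) (\<lambda>z \<omega>. exp (- l) * X z \<omega>) UNIV"
    by (rule indep_vars_compose2[OF indep]) auto
  show "distr M borel (\<lambda>\<omega>. exp (- l) * X z \<omega>) = distr M borel (\<lambda>\<omega>. exp (- l) * X 0 \<omega>)" for z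
    using distr_distr[of "(*) (exp (- l))" borel borel "X z" M]
      distr_distr[of "(*) (exp (- l))" borel borel "X 0" M]
    by (simp add: o_def ident[of z])
  show "0 \<le> exp (- l) * X z \<omega>" for z \<omega> by simp
  show le: "exp (- l) * X z \<omega> \<le> 1" for z \<omega>
    using assms by (intro mult_le_one) auto
  show "0 < prob {\<omega> \<in> space M. 0 < exp (- l) * X 0 \<omega>}"
    using prob_pos by (simp add: zero_less_mult_iff)
  have "X 0 \<omega> = 1" if "exp (- l) * X 0 \<omega> = 1" for \<omega>
  proof -
    have "exp (- l) * X 0 \<omega> \<le> 1 * X 0 \<omega>" using assms by (intro mult_right_mono) auto
    then show ?thesis using that X_le_1[of 0 \<omega>] by (simp del: X_le_1)
  qed
  then have "prob {\<omega> \<in> space M. exp (- l) * X 0 \<omega> = 1} \<le> prob {\<omega> \<in> space M. X 0 \<omega> = 1}"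
    by (intro finite_measure_mono) auto
  then show "prob {\<omega> \<in> space M. exp (- l) * X 0 \<omega> = 1} < 1"
    using prob_less_1 by simp
qed

lemma kstep_ker_scaled:
  assumes "\<And>z. 0 \<le> \<phi> z"
  shows "(kstep (ker A (\<lambda>z. exp (- l) * \<phi> z)) ^^ n) g x = ennreal (exp (- l * real n)) * (kstep (ker A \<phi>) ^^ n) g x"
proof (induction n arbitrary: x)
  case (Suc n)
  have k: "ker A (\<lambda>z. exp (- l) * \<phi> z) x = ennreal (exp (- l)) * ker A \<phi> x"
    by (simp add: ker_def assms ennreal_mult[symmetric] mult_ac)
  have e: "ennreal (exp (- l * real (Suc n))) = ennreal (exp (- l)) * ennreal (exp (- l * real n))"
    by (simp add: ennreal_mult[symmetric] exp_add[symmetric] algebra_simps)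
  show ?case
    unfolding kstep_pow_Suc Suc k e sum_distrib_left[symmetric] by (simp only: mult_ac)
qed simp

text \<open>The Laplace transform of the hitting time of \<open>y\<close>. By
  \<open>tilted_eq_Z\<close> it is the partition function for the potential shifted by
  \<open>l\<close>, written so that the dependence on \<open>l\<close> is explicit.\<close>

definition tilted :: "real \<Rightarrow> int ^ 'd \<Rightarrow> real" where
  "tilted l y = (\<Sum>n. exp (- l * real n) * enn2real (time_term y n))"

lemma time_term_le_1: "time_term y n \<le> 1"
proof -
  have "time_term y n = (\<Sum>n\<in>{n}. time_term y n)" by simp
  also have "\<dots> \<le> (\<Sum>n. time_term y n)" by (rule sum_le_suminf) auto
  also have "\<dots> \<le> 1" unfolding suminf_time_term by (rule Z_le_1)
  finally show ?thesis .
qed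

lemma ennreal_time_term: "ennreal (enn2real (time_term y n)) = time_term y n"
  using time_term_le_1[of y n] by (intro ennreal_enn2real) (auto intro: le_less_trans)

lemma summable_time_term: "summable (\<lambda>n. enn2real (time_term y n))"
proof (rule summable_suminf_not_top)
  show "(\<Sum>n. ennreal (enn2real (time_term y n))) \<noteq> top"
    using Z_le_1[of y] by (auto simp: ennreal_time_term suminf_time_term top_unique)
qed simp

lemma summable_tilted: "l \<ge> 0 \<Longrightarrow> summable (\<lambda>n. exp (- l * real n) * enn2real (time_term y n))"
  by (rule summable_comparison_test'[OF summable_time_term[of y]]) (auto simp: mult_left_le_one_le)

lemma tilted_eq_Z:
  assumes l: "l \<ge> 0"
  shows "tilted l y = enn2real (iid_weights.Z M (\<lambda>z \<omega>. exp (- l) * X z \<omega>) y)"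
proof -
  interpret S: iid_weights M "\<lambda>z \<omega>. exp (- l) * X z \<omega>" by (rule scaled_iid_weights[OF l])
  have "S.time_term y n = ennreal (exp (- l * real n)) * time_term y n" for n
    unfolding S.time_term_def time_term_def
    by (subst kstep_ker_scaled) (auto simp: nn_integral_cmult)
  then have "S.Z y = (\<Sum>n. ennreal (exp (- l * real n) * enn2real (time_term y n)))"
    unfolding S.suminf_time_term[symmetric]
    by (intro suminf_cong) (simp only: ennreal_mult ennreal_time_term exp_ge_zero enn2real_nonneg)
  also have "\<dots> = ennreal (tilted l y)"
    unfolding tilted_def by (intro suminf_ennreal2 summable_tilted l) auto
  finally have "S.Z y = ennreal (tilted l y)" .
  moreover have "0 \<le> tilted l y" unfolding tilted_def by (intro suminf_nonneg summable_tilted l) auto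
  ultimately show ?thesis by simp
qed

lemma tilted_pos: "l \<ge> 0 \<Longrightarrow> 0 < tilted l y"
  using iid_weights.enn2real_Z_pos[OF scaled_iid_weights[of l]] by (simp add: tilted_eq_Z)

lemma tilted_0: "tilted 0 y = enn2real (Z y)"
  by (simp add: tilted_eq_Z)

text \<open>Hoelder's inequality, from the convexity of the exponential function.\<close>

lemma tilted_log_convex:
  assumes "0 < l" "l < m"
  shows "ln (tilted l y) \<le> (l / m) * ln (tilted m y) + (1 - l / m) * ln (tilted 0 y)"
proof -
  define t where "t = l / m"
  have t: "0 \<le> t" "t \<le> 1" "l = t * m" using assms by (auto simp: t_def)
  let ?c = "\<lambda>n. enn2real (time_term y n)"
  \<comment> \<open>Shifting the exponents by \<open>a\<close> and \<open>b\<close> normalises both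
    sums to 1, after which convexity is applied term by term.\<close>
  define a where "a = ln (tilted m y)"
  define b where "b = ln (tilted 0 y)"
  have a: "exp (- a) * tilted m y = 1" and b: "exp (- b) * tilted 0 y = 1"
    using tilted_pos[of m y] tilted_pos[of 0 y] assms by (auto simp: a_def b_def exp_minus)
  have conv: "exp (t * u + (1 - t) * v) \<le> t * exp u + (1 - t) * exp v" for u v :: real
    using convex_onD[OF exp_convex, of "1 - t" u v] t by simp
  have e: "exp (- (t * a + (1 - t) * b)) * (exp (- l * real n) * ?c n)
      = exp (t * (- m * real n - a) + (1 - t) * (- b)) * ?c n" for n
  proof -
    have "- (t * a + (1 - t) * b) + - l * real n = t * (- m * real n - a) + (1 - t) * (- b)"
      unfolding t(3) by (simp add: algebra_simps)
    then show ?thesis by (simp only: mult.assoc[symmetric] mult_exp_exp)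
  qed
  have "exp (- (t * a + (1 - t) * b)) * tilted l y
      = (\<Sum>n. exp (- (t * a + (1 - t) * b)) * (exp (- l * real n) * ?c n))"
    unfolding tilted_def using assms by (intro suminf_mult[symmetric] summable_tilted) simp
  also have "\<dots> = (\<Sum>n. exp (t * (- m * real n - a) + (1 - t) * (- b)) * ?c n)"
    by (simp only: e)
  also have "\<dots> \<le> (\<Sum>n. t * exp (- a) * (exp (- m * real n) * ?c n) + (1 - t) * exp (- b) * (exp (- 0 * real n) * ?c n))"
  proof (rule suminf_le)
    fix n
    have "exp (t * (- m * real n - a) + (1 - t) * (- b)) * ?c n
        \<le> (t * exp (- m * real n - a) + (1 - t) * exp (- b)) * ?c n"
      by (intro mult_right_mono conv) auto
    then show "exp (t * (- m * real n - a) + (1 - t) * (- b)) * ?c n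
        \<le> t * exp (- a) * (exp (- m * real n) * ?c n) + (1 - t) * exp (- b) * (exp (- 0 * real n) * ?c n)"
      by (simp add: algebra_simps exp_diff exp_minus divide_inverse)
  next
    show "summable (\<lambda>n. exp (t * (- m * real n - a) + (1 - t) * (- b)) * ?c n)"
      unfolding e[symmetric] using assms by (intro summable_mult summable_tilted) simp
    show "summable (\<lambda>n. t * exp (- a) * (exp (- m * real n) * ?c n) + (1 - t) * exp (- b) * (exp (- 0 * real n) * ?c n))"
      using assms by (intro summable_add summable_mult summable_tilted) auto
  qed
  also have "\<dots> = t * exp (- a) * tilted m y + (1 - t) * exp (- b) * tilted 0 y"
    unfolding tilted_def using assms
    by (intro sums_unique[symmetric] sums_add sums_mult summable_sums summable_tilted) auto
  also have "\<dots> = 1" using a b by (simp add: mult.assoc)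
  finally have "tilted l y \<le> exp (t * a + (1 - t) * b)"
    unfolding exp_minus by (simp add: pos_divide_le_eq divide_inverse[symmetric] mult.commute)
  then have "ln (tilted l y) \<le> ln (exp (t * a + (1 - t) * b))"
    using tilted_pos[of l y] assms by (subst ln_le_cancel_iff) auto
  then show ?thesis by (simp add: t_def a_def b_def)
qed

text \<open>Jensen's inequality, from the tangent of the exponential function at the mean time.\<close>

lemma tilted_ge:
  assumes l: "0 \<le> l" and T: "T \<ge> 0" and mean: "(\<Sum>n. of_nat n * time_term y n) \<le> ennreal T * Z y"
  shows "ln (tilted 0 y) - l * T \<le> ln (tilted l y)"
proof -
  let ?c = "\<lambda>n. enn2real (time_term y n)"
  have Z: "Z y = ennreal (tilted 0 y)" by (simp add: tilted_0 ennreal_enn2real_Z)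
  have eq: "(\<Sum>n. of_nat n * time_term y n) = (\<Sum>n. ennreal (real n * ?c n))"
    by (simp add: ennreal_mult ennreal_time_term ennreal_of_nat_eq_real_of_nat)
  have "(\<Sum>n. ennreal (real n * ?c n)) \<le> ennreal (T * tilted 0 y)"
    using mean tilted_pos[of 0 y] T unfolding eq Z by (simp add: ennreal_mult)
  moreover from this have sum: "summable (\<lambda>n. real n * ?c n)"
    by (intro summable_suminf_not_top) (auto simp: top_unique)
  ultimately have mean': "(\<Sum>n. real n * ?c n) \<le> T * tilted 0 y"
    using tilted_pos[of 0 y] T by (subst (asm) suminf_ennreal2) (auto simp: ennreal_le_iff)
  have "exp (- l * T) * tilted 0 y \<le> exp (- l * T) * ((1 + l * T) * tilted 0 y - l * (\<Sum>n. real n * ?c n))"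
    using mean' l mult_left_mono[OF mean' l] by (intro mult_left_mono) (auto simp: algebra_simps)
  also have "\<dots> = exp (- l * T) * (\<Sum>n. (1 + l * T) * ?c n - l * (real n * ?c n))"
    unfolding tilted_def using sum summable_time_term
    by (simp add: suminf_diff[symmetric] suminf_mult summable_mult)
  also have "\<dots> = (\<Sum>n. exp (- l * T) * ((1 + l * T) * ?c n - l * (real n * ?c n)))"
    using sum summable_time_term by (intro suminf_mult[symmetric] summable_diff summable_mult) auto
  also have "\<dots> \<le> tilted l y"
    unfolding tilted_def
  proof (rule suminf_le)
    fix n
    have "exp (- l * T) * (1 + (- l * real n + l * T)) \<le> exp (- l * T) * exp (- l * real n + l * T)"
      by (intro mult_left_mono exp_ge_add_one_self) auto
    also have "\<dots> = exp (- l * real n)" by (simp add: exp_add[symmetric])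
    finally have "exp (- l * T) * (1 + (- l * real n + l * T)) * ?c n \<le> exp (- l * real n) * ?c n"
      by (intro mult_right_mono) auto
    then show "exp (- l * T) * ((1 + l * T) * ?c n - l * (real n * ?c n)) \<le> exp (- l * real n) * ?c n"
      by (simp add: algebra_simps)
  next
    show "summable (\<lambda>n. exp (- l * T) * ((1 + l * T) * ?c n - l * (real n * ?c n)))"
      using sum summable_time_term by (intro summable_mult summable_diff)
  qed (rule summable_tilted[OF l])
  finally have "ln (exp (- l * T) * tilted 0 y) \<le> ln (tilted l y)"
    using tilted_pos[of 0 y] tilted_pos[of l y] l by (subst ln_le_cancel_iff) auto
  then show ?thesis using tilted_pos[of 0 y] by (simp add: ln_mult)
qed

text \<open>Log-convexity of \<open>tilted\<close> and its tangent bound pass to the limit along the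
  ray; the first gives concavity of \<beta>, the second the bound on its slope.\<close>

lemma lyapunov_right_derivative:
  fixes h :: "real ^ 'd"
  assumes C: "C \<ge> 0" and mean: "\<And>y. y \<noteq> 0 \<Longrightarrow> (\<Sum>n. of_nat n * time_term y n) \<le> ennreal (C * real (l1 y)) * Z y"
    and beta: "\<And>l. l \<ge> 0 \<Longrightarrow> \<beta> l = - Lim at_top (\<lambda>r. 1 / r * ln (tilted l (lattice_floor (r *\<^sub>R h))))"
  obtains D where "(\<beta> has_real_derivative D) (at_right 0)" "D \<le> C * (\<Sum>i\<in>UNIV. \<bar>h $ i\<bar>)"
proof (rule concave_right_derivative[of \<beta>])
  define H where "H = (\<Sum>i\<in>UNIV. \<bar>h $ i\<bar>)"
  let ?y = "\<lambda>r. lattice_floor (r *\<^sub>R h)"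
  have lim: "((\<lambda>r. 1 / r * ln (tilted l (?y r))) \<longlongrightarrow> - \<beta> l) at_top" if l: "l \<ge> 0" for l
  proof -
    interpret S: iid_weights M "\<lambda>z \<omega>. exp (- l) * X z \<omega>" by (rule scaled_iid_weights[OF l])
    obtain L where L: "((\<lambda>r. 1 / r * ln (tilted l (?y r))) \<longlongrightarrow> L) at_top"
      using S.lyapunov_limit[of h] unfolding tilted_eq_Z[OF l] by blast
    moreover have "\<beta> l = - L"
      unfolding beta[OF l] using tendsto_Lim[OF _ L] by simp
    ultimately show ?thesis by simp
  qed
  show "(l / m) * \<beta> m + (1 - l / m) * \<beta> 0 \<le> \<beta> l" if lm: "0 < l" "l < m" for l m
  proof -
    have "- \<beta> l \<le> (l / m) * (- \<beta> m) + (1 - l / m) * (- \<beta> 0)"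
    proof (rule tendsto_le[OF _ _ lim])
      show "((\<lambda>r. (l / m) * (1 / r * ln (tilted m (?y r))) + (1 - l / m) * (1 / r * ln (tilted 0 (?y r))))
          \<longlongrightarrow> (l / m) * (- \<beta> m) + (1 - l / m) * (- \<beta> 0)) at_top"
        using lm by (intro tendsto_intros lim) auto
      show "eventually (\<lambda>r. 1 / r * ln (tilted l (?y r))
          \<le> (l / m) * (1 / r * ln (tilted m (?y r))) + (1 - l / m) * (1 / r * ln (tilted 0 (?y r)))) at_top"
        using eventually_gt_at_top[of 0]
      proof eventually_elim
        fix r :: real assume r: "r > 0"
        have "1 / r * ln (tilted l (?y r)) \<le> 1 / r * ((l / m) * ln (tilted m (?y r)) + (1 - l / m) * ln (tilted 0 (?y r)))"
          using r by (intro mult_left_mono tilted_log_convex lm) auto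
        then show "1 / r * ln (tilted l (?y r))
          \<le> (l / m) * (1 / r * ln (tilted m (?y r))) + (1 - l / m) * (1 / r * ln (tilted 0 (?y r)))"
          by (simp only: distrib_left mult_ac)
      qed
    qed (use lm in auto)
    then show ?thesis by (simp add: algebra_simps)
  qed
  show "\<beta> l - \<beta> 0 \<le> l * (C * H)" if l: "0 < l" for l
  proof -
    have "- \<beta> 0 - l * C * (0 + H) \<le> - \<beta> l"
    proof (rule tendsto_le)
      show "((\<lambda>r. 1 / r * ln (tilted 0 (?y r)) - l * C * (real CARD('d) / r + H)) \<longlongrightarrow> - \<beta> 0 - l * C * (0 + H)) at_top"
        by (intro tendsto_intros lim tendsto_divide_0[OF tendsto_const] filterlim_at_top_imp_at_infinity filterlim_ident) simp
      show "((\<lambda>r. 1 / r * ln (tilted l (?y r))) \<longlongrightarrow> - \<beta> l) at_top" using l by (intro lim) simp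
      show "eventually (\<lambda>r. 1 / r * ln (tilted 0 (?y r)) - l * C * (real CARD('d) / r + H)
          \<le> 1 / r * ln (tilted l (?y r))) at_top"
        using eventually_gt_at_top[of 0]
      proof eventually_elim
        fix r :: real assume r: "r > 0"
        have l1: "real (l1 (?y r)) \<le> real CARD('d) + r * H"
          using l1_lattice_floor_le[of "r *\<^sub>R h"] r by (simp add: H_def abs_mult sum_distrib_left)
        have "ln (tilted 0 (?y r)) - l * (C * real (l1 (?y r))) \<le> ln (tilted l (?y r))"
        proof (cases "?y r = 0")
          \<comment> \<open>The origin is not covered by \<open>mean\<close>; there the target is
            hit at once and both logarithms vanish.\<close>
          case True
          interpret S: iid_weights M "\<lambda>z \<omega>. exp (- l) * X z \<omega>" using l by (intro scaled_iid_weights) simp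
          have "tilted l 0 = 1" "tilted 0 0 = 1" using l by (auto simp: tilted_eq_Z tilted_0)
          then show ?thesis using True by simp
        next
          case False
          then show ?thesis using mean C l by (intro tilted_ge) auto
        qed
        moreover have "l * (C * real (l1 (?y r))) \<le> l * (C * (real CARD('d) + r * H))"
          using l C l1 by (intro mult_left_mono) auto
        ultimately have "ln (tilted 0 (?y r)) - l * (C * (real CARD('d) + r * H)) \<le> ln (tilted l (?y r))"
          by linarith
        then have "(ln (tilted 0 (?y r)) - l * (C * (real CARD('d) + r * H))) / r \<le> ln (tilted l (?y r)) / r"
          using r by (intro divide_right_mono) auto
        then show "1 / r * ln (tilted 0 (?y r)) - l * C * (real CARD('d) / r + H) \<le> 1 / r * ln (tilted l (?y r))"
          using r by (simp add: field_simps)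
      qed
    qed simp
    then show ?thesis by (simp add: algebra_simps)
  qed
qed (use that in auto)

end

section \<open>Green functions as path integrals\<close>

definition path_of_steps :: "int ^ 'd::finite \<Rightarrow> (nat \<Rightarrow> int ^ 'd) \<Rightarrow> 'd path" where
  "path_of_steps x \<xi> n = x + (\<Sum>k<n. \<xi> k)"

lemma measurable_path_of_steps [measurable]:
  "path_of_steps x \<in> PiM UNIV (\<lambda>_::nat. measure_pmf step_pmf) \<rightarrow>\<^sub>M path_space"
  unfolding path_space_def
proof (rule measurable_PiM_single')
  fix n
  show "(\<lambda>\<xi>. path_of_steps x \<xi> n) \<in> PiM UNIV (\<lambda>_::nat. measure_pmf step_pmf) \<rightarrow>\<^sub>M count_space UNIV"
  proof (induction n)
    case (Suc n)
    have c: "(\<lambda>\<xi>. \<xi> n) \<in> PiM UNIV (\<lambda>_::nat. measure_pmf step_pmf) \<rightarrow>\<^sub>M count_space UNIV"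
      using measurable_component_singleton[of n UNIV "\<lambda>_::nat. measure_pmf step_pmf"]
      by (simp cong: measurable_cong_sets)
    have "(\<lambda>\<xi>. path_of_steps x \<xi> n + \<xi> n)
            \<in> PiM UNIV (\<lambda>_::nat. measure_pmf step_pmf) \<rightarrow>\<^sub>M count_space UNIV"
      by (rule measurable_compose_countable[OF measurable_compose[OF c] Suc]) simp
    then show ?case by (simp add: path_of_steps_def add.assoc)
  qed (simp add: path_of_steps_def)
qed (auto simp: space_PiM)

lemma nn_integral_walk_law:
  assumes "F \<in> borel_measurable path_space"
  shows "(\<integral>\<^sup>+S. F S \<partial>walk_law x) = (\<integral>\<^sup>+\<xi>. F (path_of_steps x \<xi>) \<partial>PiM UNIV (\<lambda>_::nat. measure_pmf step_pmf))"
proof -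
  have "walk_law x = distr (PiM UNIV (\<lambda>_::nat. measure_pmf step_pmf)) path_space (path_of_steps x)"
    unfolding walk_law_def by (simp add: path_of_steps_def[abs_def])
  then show ?thesis using assms by (simp add: nn_integral_distr)
qed

text \<open>The Markov property at time 1: the first increment is split off the i.i.d. sequence by
  \<open>PiM_iter\<close>.\<close>

lemma walk_law_first_step:
  fixes x :: "int ^ 'd::finite"
  assumes F: "F \<in> borel_measurable path_space"
  shows "(\<integral>\<^sup>+S. F S \<partial>walk_law x)
    = (\<Sum>e\<in>nbr. \<integral>\<^sup>+S. F (case_nat x S) \<partial>walk_law (x + e)) / of_nat (card (nbr :: (int ^ 'd) set))"
proof -
  let ?p = "measure_pmf (step_pmf :: (int ^ 'd) pmf)"
  interpret sequence_space ?p by unfold_locales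
  interpret P: prob_space S by (rule prob_space_PiM) unfold_locales
  note [measurable] = F
  have case_path [measurable]: "case_nat x \<in> path_space \<rightarrow>\<^sub>M path_space" for x :: "int ^ 'd"
    unfolding path_space_def
  proof (rule measurable_PiM_single')
    fix n
    show "(\<lambda>S. case_nat x S n) \<in> PiM UNIV (\<lambda>_. count_space UNIV) \<rightarrow>\<^sub>M count_space UNIV"
      by (cases n) (simp_all add: measurable_component_singleton)
  qed (auto simp: space_PiM)
  have shift: "path_of_steps x (case_nat e \<xi>) = case_nat x (path_of_steps (x + e) \<xi>)" for e \<xi>
  proof
    fix n
    show "path_of_steps x (case_nat e \<xi>) n = case_nat x (path_of_steps (x + e) \<xi>) n"
      by (cases n) (simp_all add: path_of_steps_def sum.lessThan_Suc_shift add.assoc del: sum.lessThan_Suc)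
  qed
  have "(\<integral>\<^sup>+S. F S \<partial>walk_law x) = (\<integral>\<^sup>+\<xi>. F (path_of_steps x \<xi>) \<partial>distr (?p \<Otimes>\<^sub>M S) S (\<lambda>(s, \<omega>). case_nat s \<omega>))"
    by (simp add: nn_integral_walk_law F PiM_iter)
  also have "\<dots> = (\<integral>\<^sup>+p. F (path_of_steps x (case_nat (fst p) (snd p))) \<partial>(?p \<Otimes>\<^sub>M S))"
    by (subst nn_integral_distr) (simp_all add: split_beta')
  also have "\<dots> = (\<integral>\<^sup>+e. \<integral>\<^sup>+\<xi>. F (path_of_steps x (case_nat e \<xi>)) \<partial>S \<partial>?p)"
    by (subst P.nn_integral_fst[symmetric]) simp_all
  also have "\<dots> = (\<integral>\<^sup>+e. \<integral>\<^sup>+S. F (case_nat x S) \<partial>walk_law (x + e) \<partial>?p)"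
    by (subst nn_integral_walk_law) (simp_all add: shift)
  also have "\<dots> = (\<Sum>e\<in>nbr. \<integral>\<^sup>+S. F (case_nat x S) \<partial>walk_law (x + e)) / of_nat (card (nbr :: (int ^ 'd) set))"
    unfolding step_pmf_def nbr_def[symmetric] by (subst nn_integral_pmf_of_set) auto
  finally show ?thesis .
qed

definition walk_term :: "(int ^ 'd::finite \<Rightarrow> ennreal) \<Rightarrow> int ^ 'd \<Rightarrow> nat \<Rightarrow> 'd path \<Rightarrow> ennreal" where
  "walk_term \<kappa> y n S = (\<Prod>i<n. \<kappa> (S i)) * indicator {y} (S n)"

lemma measurable_walk_term [measurable]: "walk_term \<kappa> y n \<in> borel_measurable path_space"
proof -
  have [measurable]: "(\<lambda>S. f (S i)) \<in> borel_measurable path_space" for f :: "int ^ 'd \<Rightarrow> ennreal" and i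
    by (rule measurable_compose[OF measurable_path_nth]) simp
  show ?thesis unfolding walk_term_def[abs_def] by measurable
qed

lemma nn_integral_walk_term:
  fixes x :: "int ^ 'd::finite"
  shows "(\<integral>\<^sup>+S. walk_term \<kappa> y n S \<partial>walk_law x)
    = (kstep (\<lambda>z. \<kappa> z / of_nat (card (nbr :: (int ^ 'd) set))) ^^ n) (indicator {y}) x"
proof (induction n arbitrary: x)
  case 0
  interpret W: prob_space "PiM UNIV (\<lambda>_::nat. measure_pmf (step_pmf :: (int ^ 'd) pmf))"
    by (rule prob_space_PiM) unfold_locales
  have "(\<integral>\<^sup>+S. walk_term \<kappa> y 0 S \<partial>walk_law x)
      = (\<integral>\<^sup>+\<xi>. indicator {y} x \<partial>PiM UNIV (\<lambda>_::nat. measure_pmf (step_pmf :: (int ^ 'd) pmf)))"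
    by (subst nn_integral_walk_law) (simp_all add: walk_term_def path_of_steps_def)
  then show ?case by (simp add: W.emeasure_space_1)
next
  case (Suc n)
  have "walk_term \<kappa> y (Suc n) (case_nat x S) = \<kappa> x * walk_term \<kappa> y n S" for S
    by (simp add: walk_term_def prod.lessThan_Suc_shift mult.assoc del: prod.lessThan_Suc)
  then have "(\<integral>\<^sup>+S. walk_term \<kappa> y (Suc n) S \<partial>walk_law x)
      = (\<Sum>e\<in>nbr. \<kappa> x * (\<integral>\<^sup>+S. walk_term \<kappa> y n S \<partial>walk_law (x + e))) / of_nat (card (nbr :: (int ^ 'd) set))"
    by (subst walk_law_first_step) (simp_all add: nn_integral_cmult cong: measurable_cong_sets)
  also have "\<dots> = \<kappa> x / of_nat (card (nbr :: (int ^ 'd) set)) * (\<Sum>e\<in>nbr. \<integral>\<^sup>+S. walk_term \<kappa> y n S \<partial>walk_law (x + e))"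
    by (simp add: sum_distrib_left[symmetric] divide_ennreal_def mult_ac)
  finally show ?case by (simp add: Suc kstep_def)
qed

lemma exp_minus_add: "0 \<le> a \<Longrightarrow> 0 \<le> b \<Longrightarrow> exp_minus (a + b) = exp_minus a * exp_minus b"
  by (cases a; cases b) (auto simp: exp_minus_def mult_exp_exp ennreal_mult[symmetric])

lemma exp_minus_sum:
  assumes "\<And>i :: nat. i < n \<Longrightarrow> 0 \<le> f i"
  shows "exp_minus (\<Sum>i<n. f i) = (\<Prod>i<n. exp_minus (f i))"
  using assms
proof (induction n)
  case 0
  then show ?case by (simp add: exp_minus_def zero_ereal_def)
next
  case (Suc n)
  then have "exp_minus ((\<Sum>i<n. f i) + f n) = exp_minus (\<Sum>i<n. f i) * exp_minus (f n)"
    by (intro exp_minus_add sum_nonneg) auto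
  then show ?case using Suc by simp
qed

lemma hit_time_eq_enat_iff: "hit_time y S = enat n \<longleftrightarrow> S n = y \<and> (\<forall>i<n. S i \<noteq> y)"
proof
  assume h: "hit_time y S = enat n"
  have ne: "{n. S n = y} \<noteq> {}"
  proof
    assume "{n. S n = y} = {}"
    then show False using h by (simp only: hit_time_def image_empty Inf_empty) (simp add: top_enat_def)
  qed
  then obtain m where "S m = y" by blast
  then have "hit_time y S \<in> enat ` {n. S n = y}"
    unfolding hit_time_def by (intro wellorder_InfI[of "enat m"]) simp
  then have "S n = y" using h by auto
  moreover have "n \<le> i" if "S i = y" for i
  proof -
    have "hit_time y S \<le> enat i" unfolding hit_time_def using that by (intro INF_lower) simp
    then show ?thesis by (simp add: h)
  qed
  ultimately show "S n = y \<and> (\<forall>i<n. S i \<noteq> y)" by force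
next
  assume "S n = y \<and> (\<forall>i<n. S i \<noteq> y)"
  then show "hit_time y S = enat n"
    unfolding hit_time_def by (intro antisym INF_lower INF_greatest) (auto simp: not_less[symmetric])
qed

lemma hit_time_infinite: "hit_time y S = \<infinity> \<Longrightarrow> S n \<noteq> y"
proof
  assume "hit_time y S = \<infinity>" "S n = y"
  moreover from this have "hit_time y S \<le> enat n" unfolding hit_time_def by (intro INF_lower) simp
  ultimately show False by simp
qed

text \<open>The weight 0 at \<open>y\<close> removes all terms after the first visit, the indicator
  in \<open>walk_term\<close> those before it. On paths that never hit \<open>y\<close> both sides
  vanish, even if \<open>f\<close> is infinite there. Constant \<open>f\<close> yields the partition
  function, \<open>ennreal_of_enat\<close> the mean hitting time.\<close>

lemma weighted_hit_time_eq:
  assumes "\<And>z. 0 \<le> V z \<omega>"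
  shows "f (hit_time y S) * path_weight V y \<omega> S
    = (\<Sum>n. f (enat n) * walk_term (\<lambda>z. if z = y then 0 else exp_minus (V z \<omega>)) y n S)"
proof (cases "hit_time y S")
  case (enat N)
  then have S: "S N = y" "\<And>i. i < N \<Longrightarrow> S i \<noteq> y" by (auto simp: hit_time_eq_enat_iff)
  let ?t = "\<lambda>n. walk_term (\<lambda>z. if z = y then 0 else exp_minus (V z \<omega>)) y n S"
  have "?t n = 0" if "n \<noteq> N" for n
  proof (cases "n < N")
    case True
    then show ?thesis using S by (simp add: walk_term_def)
  next
    case False
    then have "(\<Prod>i<n. if S i = y then 0 else exp_minus (V (S i) \<omega>)) = 0"
      using S that by (intro prod_zero) auto
    then show ?thesis by (simp add: walk_term_def)
  qed
  then have "(\<Sum>n. f (enat n) * ?t n) = (\<Sum>n\<in>{N}. f (enat n) * ?t n)"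
    by (intro suminf_finite) auto
  also have "?t N = (\<Prod>i<N. exp_minus (V (S i) \<omega>))"
    using S by (simp add: walk_term_def cong: prod.cong_simp)
  then have "(\<Sum>n\<in>{N}. f (enat n) * ?t n) = f (enat N) * (\<Prod>i<N. exp_minus (V (S i) \<omega>))" by simp
  also have "\<dots> = f (hit_time y S) * path_weight V y \<omega> S"
    using assms by (simp add: path_weight_def enat exp_minus_sum)
  finally show ?thesis by simp
next
  case infinity
  then show ?thesis
    using hit_time_infinite[OF infinity] by (simp add: path_weight_def walk_term_def)
qed

section \<open>Independent potentials\<close>

text \<open>Potentials are negative on a null set only; the value 1 keeps the weights in \<open>[0, 1]\<close> everywhere.\<close>

definition weight_of :: "ereal \<Rightarrow> real" where
  "weight_of x = (if 0 \<le> x then enn2real (exp_minus x) else 1)"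

lemma measurable_weight_of [measurable]: "weight_of \<in> borel_measurable borel"
  unfolding weight_of_def[abs_def] by measurable

lemma weight_of_simps [simp]: "weight_of (ereal r) = (if 0 \<le> r then exp (- r) else 1)" "weight_of \<infinity> = 0" "weight_of (- \<infinity>) = 1"
  by (auto simp: weight_of_def exp_minus_def)

lemma exp_minus_shift: "0 \<le> x \<Longrightarrow> exp_minus (ereal l + x) = ennreal (exp (- l) * weight_of x)"
  by (cases x) (auto simp: exp_minus_def mult_exp_exp)

locale iid_potential = prob_space M for M :: "'w measure" +
  fixes V :: "int ^ 'd::finite \<Rightarrow> 'w \<Rightarrow> ereal"
  assumes indep_V: "indep_vars (\<lambda>_. borel) V UNIV"
    and ident_V: "\<And>z. distr M borel (V z) = distr M borel (V 0)"
    and nonneg_V: "AE \<omega> in M. 0 \<le> V 0 \<omega>"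
    and nonzero_V: "prob {\<omega> \<in> space M. V 0 \<omega> = 0} < 1"
    and finite_V: "\<not> (AE \<omega> in M. V 0 \<omega> = \<infinity>)"
begin

lemma measurable_V [measurable]: "V z \<in> borel_measurable M"
  using indep_V by (auto simp: indep_vars_def)

lemma AE_nonneg_V: "AE \<omega> in M. \<forall>z. 0 \<le> V z \<omega>"
  unfolding AE_all_countable
proof
  fix z
  have "AE x in distr M borel (V 0). 0 \<le> x"
    using nonneg_V by (subst AE_distr_iff) auto
  then have "AE x in distr M borel (V z). 0 \<le> x" by (simp only: ident_V[of z])
  then show "AE \<omega> in M. 0 \<le> V z \<omega>" by (subst (asm) AE_distr_iff) auto
qed

sublocale iid_weights M "\<lambda>z \<omega>. weight_of (V z \<omega>)"
proof unfold_locales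
  show "indep_vars (\<lambda>_. borel) (\<lambda>z \<omega>. weight_of (V z \<omega>)) UNIV"
    by (rule indep_vars_compose2[OF indep_V]) auto
  show "distr M borel (\<lambda>\<omega>. weight_of (V z \<omega>)) = distr M borel (\<lambda>\<omega>. weight_of (V 0 \<omega>))" for z
    using distr_distr[of weight_of borel borel "V z" M] distr_distr[of weight_of borel borel "V 0" M]
    by (simp add: o_def ident_V[of z])
  show "0 \<le> weight_of (V z \<omega>)" for z \<omega> by (simp add: weight_of_def)
  show "weight_of (V z \<omega>) \<le> 1" for z \<omega> by (cases "V z \<omega>") auto
  show "0 < prob {\<omega> \<in> space M. 0 < weight_of (V 0 \<omega>)}"
  proof (rule ccontr)
    assume "\<not> ?thesis"
    then have "prob {\<omega> \<in> space M. 0 < weight_of (V 0 \<omega>)} = 0" by (simp add: not_less measure_le_0_iff)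
    then have "AE \<omega> in M. \<omega> \<notin> {\<omega> \<in> space M. 0 < weight_of (V 0 \<omega>)}"
      by (subst prob_eq_0[symmetric]) auto
    then have "AE \<omega> in M. V 0 \<omega> = \<infinity>"
      using AE_space
    proof eventually_elim
      case (elim \<omega>)
      then show ?case by (cases "V 0 \<omega>") (auto split: if_splits)
    qed
    then show False using finite_V by contradiction
  qed
  have "prob {\<omega> \<in> space M. weight_of (V 0 \<omega>) = 1} \<le> prob {\<omega> \<in> space M. V 0 \<omega> = 0}"
  proof (rule finite_measure_mono_AE)
    show "AE \<omega> in M. \<omega> \<in> {\<omega> \<in> space M. weight_of (V 0 \<omega>) = 1} \<longrightarrow> \<omega> \<in> {\<omega> \<in> space M. V 0 \<omega> = 0}"
      using nonneg_V
    proof eventually_elim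
      case (elim \<omega>)
      then show ?case by (cases "V 0 \<omega>") (auto simp: zero_ereal_def)
    qed
  qed auto
  then show "prob {\<omega> \<in> space M. weight_of (V 0 \<omega>) = 1} < 1"
    using nonzero_V by simp
qed

lemma path_integral:
  assumes "\<And>z. 0 \<le> V z \<omega>" "l \<ge> 0"
  shows "(\<integral>\<^sup>+S. f (hit_time y S) * path_weight (\<lambda>z \<omega>. ereal l + V z \<omega>) y \<omega> S \<partial>walk_law 0)
    = (\<Sum>n. f (enat n) * (kstep (ker (-{y}) (\<lambda>z. exp (- l) * weight_of (V z \<omega>))) ^^ n) (indicator {y}) 0)"
proof -
  let ?\<kappa> = "\<lambda>z. if z = y then 0 else exp_minus (ereal l + V z \<omega>)"
  have ker: "(\<lambda>z. ?\<kappa> z / of_nat (card (nbr :: (int ^ 'd) set))) = ker (-{y}) (\<lambda>z. exp (- l) * weight_of (V z \<omega>))"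
  proof
    fix z
    have "ennreal (exp (- l) * weight_of (V z \<omega>)) / of_nat (card (nbr :: (int ^ 'd) set))
        = ennreal (exp (- l) * weight_of (V z \<omega>) / real (card (nbr :: (int ^ 'd) set)))"
      using card_nbr_pos[where 'd = 'd] by (simp add: ennreal_of_nat_eq_real_of_nat divide_ennreal)
    then show "?\<kappa> z / of_nat (card (nbr :: (int ^ 'd) set)) = ker (-{y}) (\<lambda>z. exp (- l) * weight_of (V z \<omega>)) z"
      using assms by (simp add: ker_def exp_minus_shift)
  qed
  have [measurable]: "(\<lambda>S. walk_term ?\<kappa> y n S) \<in> borel_measurable (walk_law 0)" for n
    by (simp cong: measurable_cong_sets)
  have "(\<integral>\<^sup>+S. f (hit_time y S) * path_weight (\<lambda>z \<omega>. ereal l + V z \<omega>) y \<omega> S \<partial>walk_law 0)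
      = (\<integral>\<^sup>+S. (\<Sum>n. f (enat n) * walk_term ?\<kappa> y n S) \<partial>walk_law 0)"
    using assms by (subst weighted_hit_time_eq) auto
  also have "\<dots> = (\<Sum>n. f (enat n) * (\<integral>\<^sup>+S. walk_term ?\<kappa> y n S \<partial>walk_law 0))"
    by (simp add: nn_integral_suminf nn_integral_cmult)
  finally show ?thesis by (simp only: nn_integral_walk_term ker)
qed

lemma Z_ann_eq:
  assumes "l \<ge> 0"
  shows "Z_ann M (\<lambda>z \<omega>. ereal l + V z \<omega>) y = iid_weights.Z M (\<lambda>z \<omega>. exp (- l) * weight_of (V z \<omega>)) y"
proof -
  interpret S: iid_weights M "\<lambda>z \<omega>. exp (- l) * weight_of (V z \<omega>)" by (rule scaled_iid_weights[OF assms])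
  have "Z_ann M (\<lambda>z \<omega>. ereal l + V z \<omega>) y = (\<integral>\<^sup>+\<omega>. S.G (-{y}) 0 y \<omega> \<partial>M)"
    unfolding Z_ann_def
  proof (rule nn_integral_cong_AE)
    show "AE \<omega> in M. (\<integral>\<^sup>+S. path_weight (\<lambda>z \<omega>. ereal l + V z \<omega>) y \<omega> S \<partial>walk_law 0) = S.G (-{y}) 0 y \<omega>"
      using AE_nonneg_V
    proof eventually_elim
      case (elim \<omega>)
      then show ?case
        using path_integral[of \<omega> l "\<lambda>_. 1" y] assms by (simp add: S.G_def green_def potential_def)
    qed
  qed
  then show ?thesis by (simp add: S.Z_def S.EG_def)
qed

lemma Z_ann_eq_0: "Z_ann M V y = Z y"
  using Z_ann_eq[of 0 y] by (simp add: zero_ereal_def[symmetric])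

lemma mean_hit_time:
  "(\<integral>\<^sup>+S. ennreal_of_enat (hit_time y S) \<partial>Q_ann M V y) = (\<Sum>n. of_nat n * time_term y n) / Z y"
proof -
  interpret W: prob_space "walk_law (0 :: int ^ 'd)" by (rule prob_space_walk_law)
  let ?J = "M \<Otimes>\<^sub>M walk_law (0 :: int ^ 'd)"
  let ?h = "\<lambda>S. ennreal_of_enat (hit_time y S)"
  have w [measurable]: "(\<lambda>p. path_weight V y (fst p) (snd p)) \<in> borel_measurable ?J"
    using measurable_path_weight[where V = V and y = y and M = M]
    by (simp add: split_beta' cong: measurable_cong_sets)
  have s [measurable]: "snd \<in> ?J \<rightarrow>\<^sub>M path_space"
    using measurable_snd[of M "walk_law (0 :: int ^ 'd)"] by (simp cong: measurable_cong_sets)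
  have h [measurable]: "?h \<in> borel_measurable path_space"
    by (rule measurable_compose[OF measurable_hit_time]) simp
  have h' [measurable]: "(\<lambda>p. ?h (snd p)) \<in> borel_measurable ?J"
    by (rule measurable_compose[OF s h])
  have d: "snd \<in> density ?J (\<lambda>(\<omega>, S). path_weight V y \<omega> S / Z_ann M V y) \<rightarrow>\<^sub>M path_space"
    using s by simp
  have "(\<integral>\<^sup>+S. ?h S \<partial>Q_ann M V y)
      = (\<integral>\<^sup>+p. ?h (snd p) \<partial>density ?J (\<lambda>(\<omega>, S). path_weight V y \<omega> S / Z_ann M V y))"
    unfolding Q_ann_def by (rule nn_integral_distr[OF d]) (use h in simp)
  also have "\<dots> = (\<integral>\<^sup>+p. (path_weight V y (fst p) (snd p) / Z_ann M V y) * ?h (snd p) \<partial>?J)"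
    unfolding split_beta' by (rule nn_integral_density) measurable
  also have "\<dots> = (\<integral>\<^sup>+p. (?h (snd p) * path_weight V y (fst p) (snd p)) / Z_ann M V y \<partial>?J)"
    by (intro nn_integral_cong) (simp add: ennreal_times_divide mult.commute)
  also have "\<dots> = (\<integral>\<^sup>+p. ?h (snd p) * path_weight V y (fst p) (snd p) \<partial>?J) / Z_ann M V y"
    by (rule nn_integral_divide) measurable
  also have "(\<integral>\<^sup>+p. ?h (snd p) * path_weight V y (fst p) (snd p) \<partial>?J)
      = (\<integral>\<^sup>+\<omega>. (\<integral>\<^sup>+S. ?h S * path_weight V y \<omega> S \<partial>walk_law 0) \<partial>M)"
    by (subst W.nn_integral_fst[symmetric]) simp_all
  also have "\<dots> = (\<integral>\<^sup>+\<omega>. (\<Sum>n. of_nat n * (kstep (ker (-{y}) (\<lambda>z. weight_of (V z \<omega>))) ^^ n) (indicator {y}) 0) \<partial>M)"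
  proof (rule nn_integral_cong_AE)
    show "AE \<omega> in M. (\<integral>\<^sup>+S. ?h S * path_weight V y \<omega> S \<partial>walk_law 0)
        = (\<Sum>n. of_nat n * (kstep (ker (-{y}) (\<lambda>z. weight_of (V z \<omega>))) ^^ n) (indicator {y}) 0)"
      using AE_nonneg_V
    proof eventually_elim
      case (elim \<omega>)
      then show ?case
        using path_integral[of \<omega> 0 ennreal_of_enat y] by (simp add: zero_ereal_def[symmetric])
    qed
  qed
  also have "\<dots> = (\<Sum>n. of_nat n * time_term y n)"
    unfolding time_term_def by (simp add: nn_integral_suminf nn_integral_cmult)
  finally show ?thesis by (simp only: Z_ann_eq_0)
qed

lemma lyapunov_ann_eq:
  assumes "l \<ge> 0"
  shows "lyapunov_ann M (\<lambda>z \<omega>. ereal l + V z \<omega>) h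
    = - Lim at_top (\<lambda>r. 1 / r * ln (tilted l (lattice_floor (r *\<^sub>R h))))"
  unfolding lyapunov_ann_def Z_ann_eq[OF assms] tilted_eq_Z[OF assms] ..

end

text \<open>Equivalence of norms: \<open>N\<close> is Lipschitz and therefore attains a positive
  minimum on the Euclidean unit sphere.\<close>

lemma l1_norm_le_norm:
  fixes N :: "real ^ 'd::finite \<Rightarrow> real"
  assumes N: "is_norm N"
  obtains K where "K > 0" "\<And>x. (\<Sum>i\<in>UNIV. \<bar>x $ i\<bar>) \<le> K * N x"
proof -
  have N0: "N x = 0 \<longleftrightarrow> x = 0" and scale: "N (a *\<^sub>R x) = \<bar>a\<bar> * N x" and tri: "N (x + y) \<le> N x + N y" for a x y
    using N by (auto simp: is_norm_def)
  have nonneg: "0 \<le> N x" for x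
    using tri[of x "- 1 *\<^sub>R x"] scale[of "-1" x] N0[of 0] by simp
  define c where "c = (\<Sum>i\<in>UNIV. N (axis i 1))"
  have c: "c \<ge> 0" by (simp add: c_def sum_nonneg nonneg)
  have sum_le: "N (\<Sum>i\<in>I. f i) \<le> (\<Sum>i\<in>I. N (f i))" for I :: "'d set" and f
  proof (induction I rule: infinite_finite_induct)
    case (insert i I)
    then show ?case using tri[of "f i" "\<Sum>i\<in>I. f i"] by simp
  qed (simp_all add: N0[THEN iffD2])
  have le: "N x \<le> c * norm x" for x
  proof -
    have "x = (\<Sum>i\<in>UNIV. x $ i *\<^sub>R axis i 1)"
      using basis_expansion[of x] by (simp add: scalar_mult_eq_scaleR)
    then have "N x \<le> (\<Sum>i\<in>UNIV. \<bar>x $ i\<bar> * N (axis i 1))"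
      using sum_le[of "\<lambda>i. x $ i *\<^sub>R axis i 1" UNIV] by (simp add: scale)
    also have "\<dots> \<le> (\<Sum>i\<in>UNIV. norm x * N (axis i 1))"
      by (intro sum_mono mult_right_mono component_le_norm_cart nonneg)
    finally show ?thesis by (simp add: c_def sum_distrib_left mult.commute)
  qed
  have lip: "\<bar>N x - N y\<bar> \<le> c * norm (x - y)" for x y
    using tri[of "x - y" y] tri[of "y - x" x] le[of "x - y"] le[of "y - x"]
    by (simp add: norm_minus_commute abs_le_iff)
  have cont: "continuous_on (sphere 0 1) N"
    unfolding continuous_on_iff
  proof (intro ballI allI impI)
    fix x :: "real ^ 'd" and e :: real
    assume "e > 0"
    then show "\<exists>d>0. \<forall>x'\<in>sphere 0 1. dist x' x < d \<longrightarrow> dist (N x') (N x) < e"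
      using c
    proof (intro exI[of _ "e / (c + 1)"] conjI ballI impI)
      fix x' assume d: "dist x' x < e / (c + 1)"
      have "dist (N x') (N x) \<le> c * dist x' x" using lip by (simp add: dist_norm)
      also have "\<dots> \<le> (c + 1) * dist x' x" by (intro mult_right_mono) auto
      also have "\<dots> < e" using d c by (simp add: pos_less_divide_eq mult.commute)
      finally show "dist (N x') (N x) < e" .
    qed (simp add: add_nonneg_pos)
  qed
  have "axis undefined 1 \<in> sphere (0 :: real ^ 'd) 1" by simp
  then have "sphere (0 :: real ^ 'd) 1 \<noteq> {}" by blast
  from continuous_attains_inf[OF compact_sphere this cont]
  obtain u where u: "norm u = 1" "\<And>x. norm x = 1 \<Longrightarrow> N u \<le> N x" by auto
  define m where "m = N u"
  have m: "m > 0" using u(1) N0[of u] nonneg[of u] by (auto simp: m_def less_le)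
  have norm_le: "norm x \<le> N x / m" for x
  proof (cases "x = 0")
    case False
    then have "m \<le> N ((1 / norm x) *\<^sub>R x)" unfolding m_def by (intro u(2)) simp
    also have "\<dots> = N x / norm x" by (simp add: scale)
    finally show ?thesis using m False by (simp add: field_simps)
  qed (simp add: N0[THEN iffD2])
  show ?thesis
  proof
    show "real CARD('d) / m > 0" using m by simp
    fix x :: "real ^ 'd"
    have "(\<Sum>i\<in>UNIV. \<bar>x $ i\<bar>) \<le> real CARD('d) * norm x"
      using sum_bounded_above[of UNIV "\<lambda>i. \<bar>x $ i\<bar>" "norm x", OF component_le_norm_cart] by simp
    also have "\<dots> \<le> real CARD('d) * (N x / m)" by (intro mult_left_mono norm_le) simp
    finally show "(\<Sum>i\<in>UNIV. \<bar>x $ i\<bar>) \<le> real CARD('d) / m * N x" by simp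
  qed
qed

lemma l1_real_vec: "real (l1 y) = (\<Sum>i\<in>UNIV. \<bar>real_vec y $ i\<bar>)"
  by (simp add: l1_def real_vec_def)

theorem corollary1p1:
  fixes M :: "'w measure"
    and V :: "int ^ 'd::finite \<Rightarrow> 'w \<Rightarrow> ereal"
    and N :: "real ^ 'd \<Rightarrow> real"
  assumes "prob_space M"
    and "is_norm N"
    and "prob_space.indep_vars M (\<lambda>_. borel) V UNIV"
    and "\<And>z. distr M borel (V z) = distr M borel (V 0)"
    and "AE \<omega> in M. 0 \<le> V 0 \<omega>"
    and "measure M {\<omega> \<in> space M. V 0 \<omega> = 0} < 1"
    and "essinf M (V 0) = 0"
    and "CARD('d) = 1 \<Longrightarrow> measure M {\<omega> \<in> space M. 0 < V 0 \<omega> \<and> V 0 \<omega> < \<infinity>} > 0"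
  shows "\<exists>C::real. C > 0 \<and>
    Limsup (filtercomap (\<lambda>y. N (real_vec y)) at_top)
      (\<lambda>y. (\<integral>\<^sup>+S. ennreal_of_enat (hit_time y S) \<partial>Q_ann M V y) / ennreal (N (real_vec y)))
      \<le> ennreal C \<and>
    (\<forall>s. N s = 1 \<longrightarrow>
      (\<exists>D. ((\<lambda>l. lyapunov_ann M (\<lambda>z \<omega>. ereal l + V z \<omega>) s) has_real_derivative D) (at_right 0)
           \<and> D \<le> C))"
proof -
  interpret prob_space M by fact
  have V0 [measurable]: "V 0 \<in> borel_measurable M" using assms(3) by (auto simp: indep_vars_def)
  \<comment> \<open>An almost surely infinite potential would have essential infimum \<infinity>
    instead of 0.\<close>
  have finite_V: "\<not> (AE \<omega> in M. V 0 \<omega> = \<infinity>)"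
  proof
    assume "AE \<omega> in M. V 0 \<omega> = \<infinity>"
    then have "esssup M (\<lambda>\<omega>. - V 0 \<omega>) = esssup M (\<lambda>\<omega>. - \<infinity> :: ereal)"
      by (intro esssup_AE_cong) (auto elim: eventually_mono)
    also have "\<dots> = - \<infinity>" by (rule esssup_const) (simp add: emeasure_space_1)
    finally show False using assms(7) by (simp add: essinf_def)
  qed
  interpret iid_potential M V
    by unfold_locales (use assms(3-6) finite_V in auto)
  obtain C where C: "C \<ge> 0" and mean: "\<And>y. y \<noteq> 0 \<Longrightarrow>
    (\<Sum>n. of_nat n * time_term y n) \<le> ennreal (C * real (l1 y)) * Z y"
  proof (cases "CARD('d) = 1")
    case True
    have "prob {\<omega> \<in> space M. 0 < V 0 \<omega> \<and> V 0 \<omega> < \<infinity>}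
        \<le> prob {\<omega> \<in> space M. 0 < weight_of (V 0 \<omega>) \<and> weight_of (V 0 \<omega>) < 1}"
    proof (rule finite_measure_mono)
      show "{\<omega> \<in> space M. 0 < V 0 \<omega> \<and> V 0 \<omega> < \<infinity>}
          \<subseteq> {\<omega> \<in> space M. 0 < weight_of (V 0 \<omega>) \<and> weight_of (V 0 \<omega>) < 1}"
      proof clarify
        fix \<omega> assume "0 < V 0 \<omega>" "V 0 \<omega> < \<infinity>"
        then show "0 < weight_of (V 0 \<omega>) \<and> weight_of (V 0 \<omega>) < 1" by (cases "V 0 \<omega>") auto
      qed
    qed measurable
    then have "prob {\<omega> \<in> space M. 0 < weight_of (V 0 \<omega>) \<and> weight_of (V 0 \<omega>) < 1} > 0"
      using assms(8)[OF True] by linarith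
    then show thesis using mean_time_linear_one_dim[OF True] that by blast
  next
    case False
    moreover have "CARD('d) \<noteq> 0" by simp
    ultimately have "CARD('d) \<ge> 2" by linarith
    then show thesis using mean_time_linear_higher_dim that by blast
  qed
  obtain K where K: "K > 0" and l1_le: "\<And>x. (\<Sum>i\<in>UNIV. \<bar>x $ i\<bar>) \<le> K * N x"
    using l1_norm_le_norm[OF assms(2)] by blast
  \<comment> \<open>The summand 1 makes the constant strictly positive, as \<open>C\<close> may be
    0.\<close>
  have pos: "C * K + 1 > 0" using C K by (simp add: add_nonneg_pos)
  \<comment> \<open>Restricting to norm at least 1 does not affect the limit superior, and it
    excludes \<open>y = 0\<close> as well as a division by 0.\<close>
  have ratio: "(\<integral>\<^sup>+S. ennreal_of_enat (hit_time y S) \<partial>Q_ann M V y) / ennreal (N (real_vec y)) \<le> ennreal (C * K + 1)"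
    if y: "N (real_vec y) \<ge> 1" for y
  proof -
    have "N 0 = 0" using assms(2) by (auto simp: is_norm_def)
    moreover have "real_vec 0 = (0 :: real ^ 'd)" by (simp add: real_vec_def vec_eq_iff)
    ultimately have "y \<noteq> 0" using y by auto
    have "(\<integral>\<^sup>+S. ennreal_of_enat (hit_time y S) \<partial>Q_ann M V y) \<le> (ennreal (C * real (l1 y)) * Z y) / Z y"
      unfolding mean_hit_time by (intro divide_right_mono_ennreal mean \<open>y \<noteq> 0\<close>)
    also have "\<dots> = ennreal (C * real (l1 y))"
      using Z_pos[of y] Z_le_1[of y] by (intro mult_divide_eq_ennreal) (auto simp: top_unique)
    also have "\<dots> \<le> ennreal ((C * K + 1) * N (real_vec y))"
    proof (rule ennreal_leI)
      have "C * real (l1 y) \<le> C * (K * N (real_vec y))"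
        unfolding l1_real_vec by (intro mult_left_mono l1_le C)
      then show "C * real (l1 y) \<le> (C * K + 1) * N (real_vec y)" using y by (simp add: algebra_simps)
    qed
    finally have "(\<integral>\<^sup>+S. ennreal_of_enat (hit_time y S) \<partial>Q_ann M V y) / ennreal (N (real_vec y))
        \<le> ennreal ((C * K + 1) * N (real_vec y)) / ennreal (N (real_vec y))"
      by (rule divide_right_mono_ennreal)
    also have "\<dots> = ennreal (C * K + 1)" using y pos by (simp add: divide_ennreal)
    finally show ?thesis .
  qed
  have ev: "eventually (\<lambda>y. N (real_vec y) \<ge> 1) (filtercomap (\<lambda>y :: int ^ 'd. N (real_vec y)) at_top)"
    by (rule eventually_filtercomapI[OF eventually_ge_at_top])
  show ?thesis
  proof (rule exI[of _ "C * K + 1"], intro conjI allI impI)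
    show "C * K + 1 > 0" by (rule pos)
    show "Limsup (filtercomap (\<lambda>y. N (real_vec y)) at_top)
      (\<lambda>y. (\<integral>\<^sup>+S. ennreal_of_enat (hit_time y S) \<partial>Q_ann M V y) / ennreal (N (real_vec y)))
      \<le> ennreal (C * K + 1)"
      by (rule Limsup_bounded) (use ratio ev in \<open>auto elim: eventually_mono\<close>)
    fix s :: "real ^ 'd"
    assume s: "N s = 1"
    obtain D where D: "((\<lambda>l. lyapunov_ann M (\<lambda>z \<omega>. ereal l + V z \<omega>) s) has_real_derivative D) (at_right 0)"
      "D \<le> C * (\<Sum>i\<in>UNIV. \<bar>s $ i\<bar>)"
      using lyapunov_right_derivative[OF C mean lyapunov_ann_eq] by blast
    have "C * (\<Sum>i\<in>UNIV. \<bar>s $ i\<bar>) \<le> C * K" using l1_le[of s] s C by (intro mult_left_mono) auto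
    then show "\<exists>D. ((\<lambda>l. lyapunov_ann M (\<lambda>z \<omega>. ereal l + V z \<omega>) s) has_real_derivative D) (at_right 0)
           \<and> D \<le> C * K + 1"
      using D by (intro exI[of _ D]) auto
  qed
qed

end
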